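(* For all $a,b\in\mathbb N_0$, the set $S_{a,b}=\{d_c\mid c\in\mathrm{Conn}(a,b)\}$ is a basis of $\mathrm{Hom}_{\mathrm{sBr}}(a,b)$. In particular $\mathrm{Hom}_{\mathrm{sBr}}(a,b)$ has dimension $(a+b-1)!!$ if $a+b$ is even and is $0$ otherwise.
   Context: Work over $\mathbb C$; in a monoidal supercategory the super interchange law $(f\otimes g)\circ(h\otimes k)=(-1)^{\bar g\bar h}(f\circ h)\otimes(g\circ k)$ holds. The Brauer supercategory $\mathrm{sBr}$ is the $\mathbb C$-linear strict monoidal supercategory generated by one object $\star$ and morphisms $s:\star\otimes\star\to\star\otimes\star$ (even), $b:\star\otimes\star\to\mathbb 1$ (odd), $b^*:\mathbb 1\to\star\otimes\star$ (odd), subject to: (R1) $s\circ s=1$, $(s\otimes 1)(1\otimes s)(s\otimes 1)=(1\otimes s)(s\otimes1)(1\otimes s)$; (R2) $(b\otimes 1_\star)\circ(1_\star\otimes b^* )=-1_\star$, $(1_\star\otimes b)\circ(b^*\otimes 1_\star)=1_\star$; (R3) $(1_\star\otimes s)\circ(b^*\otimes 1_\star)=(s\otimes 1_\star)\circ(1_\star\otimes b^* )$, $s\circ b^*=-b^*$. Objects are identified with $a\in\mathbb N_0$. A diagram is a morphism obtained as a finite composite of tensor products of generators and identities; it is drawn (read bottom to top) by depicting $s$ as a crossing, $b$ as a cap (arc joining two bottom points), $b^*$ as a cup (arc joining two top points), identities as vertical strands. The resulting curves are strings: a string with both ends on top is a cup, with both ends on the bottom a cap, with one end on each a through string, with no ends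 a loop. For $d:a\to b$ without loops, the connector $P(d)$ is the partition of the $a+b$ endpoints into pairs joined by strings; $\mathrm{Conn}(a,b)$ is the set of all perfect matchings of these $a+b$ points. A diagram is normal if: any two strings intersect at most once; no string intersects itself; no two cups or caps are at the same height; all cups are above all caps; the heights of caps decrease when caps are ordered left to right by their left ends; the heights of cups increase when cups are ordered left to right by their left ends. For each $c\in\mathrm{Conn}(a,b)$ a normal diagram $d_c$ with $P(d_c)=c$ is fixed. *)

theory Defs
  imports Complex_Main
begin

fun dfact :: "nat \<Rightarrow> nat" where
  "dfact 0 = 1"
| "dfact (Suc 0) = 1"
| "dfact (Suc (Suc n)) = Suc (Suc n) * dfact n"

section \<open>Free (syntactic) morphisms of the monoidal supercategory generated by s, b, b*\<close>

datatype gen = GS | GB | GBs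

datatype mor = Gen gen | Idn nat | Comp mor mor | Tens mor mor
  (* Comp f g  is  f \<circ> g  (first g, then f);  Tens f g  is  f \<otimes> g *)

fun gsrc :: "gen \<Rightarrow> nat" where
  "gsrc GS = 2" | "gsrc GB = 2" | "gsrc GBs = 0"
fun gtgt :: "gen \<Rightarrow> nat" where
  "gtgt GS = 2" | "gtgt GB = 0" | "gtgt GBs = 2"
fun gpar :: "gen \<Rightarrow> nat" where
  "gpar GS = 0" | "gpar GB = 1" | "gpar GBs = 1"

fun src :: "mor \<Rightarrow> nat" where
  "src (Gen g) = gsrc g"
| "src (Idn n) = n"
| "src (Comp f g) = src g"
| "src (Tens f g) = src f + src g"

fun tgt :: "mor \<Rightarrow> nat" where
  "tgt (Gen g) = gtgt g"
| "tgt (Idn n) = n"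
| "tgt (Comp f g) = tgt f"
| "tgt (Tens f g) = tgt f + tgt g"

fun par :: "mor \<Rightarrow> nat" where
  "par (Gen g) = gpar g"
| "par (Idn n) = 0"
| "par (Comp f g) = (par f + par g) mod 2"
| "par (Tens f g) = (par f + par g) mod 2"

fun wt :: "mor \<Rightarrow> bool" where
  "wt (Gen g) = True"
| "wt (Idn n) = True"
| "wt (Comp f g) = (wt f \<and> wt g \<and> tgt g = src f)"
| "wt (Tens f g) = (wt f \<and> wt g)"

abbreviation "sS \<equiv> Gen GS"
abbreviation "bB \<equiv> Gen GB"
abbreviation "bBs \<equiv> Gen GBs"
abbreviation "one \<equiv> Idn 1"

type_synonym vec = "mor \<Rightarrow> complex"

definition delta :: "mor \<Rightarrow> vec" where
  "delta m = (\<lambda>m'. if m' = m then 1 else 0)"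

definition V :: "nat \<Rightarrow> nat \<Rightarrow> vec set" where
  "V a b = {x. finite {m. x m \<noteq> 0} \<and> (\<forall>m. x m \<noteq> 0 \<longrightarrow> wt m \<and> src m = a \<and> tgt m = b)}"

text \<open>Bilinear extensions of composition / tensor with a single term.\<close>
definition compL :: "mor \<Rightarrow> vec \<Rightarrow> vec" where
  "compL f x = (\<lambda>m. case m of Comp g h \<Rightarrow> (if g = f then x h else 0) | _ \<Rightarrow> 0)"
definition compR :: "vec \<Rightarrow> mor \<Rightarrow> vec" where
  "compR x f = (\<lambda>m. case m of Comp g h \<Rightarrow> (if h = f then x g else 0) | _ \<Rightarrow> 0)"
definition tensL :: "mor \<Rightarrow> vec \<Rightarrow> vec" where
  "tensL f x = (\<lambda>m. case m of Tens g h \<Rightarrow> (if g = f then x h else 0) | _ \<Rightarrow> 0)"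
definition tensR :: "vec \<Rightarrow> mor \<Rightarrow> vec" where
  "tensR x f = (\<lambda>m. case m of Tens g h \<Rightarrow> (if h = f then x g else 0) | _ \<Rightarrow> 0)"

text \<open>Basic relations  lhs = c * rhs : axioms of a strict monoidal C-linear supercategory
  (with the super interchange law) and the defining relations (R1)-(R3) of sBr.\<close>
inductive basic_rel :: "mor \<Rightarrow> complex \<Rightarrow> mor \<Rightarrow> bool" where
  cat_assoc: "\<lbrakk>wt f; wt g; wt h; tgt h = src g; tgt g = src f\<rbrakk>
     \<Longrightarrow> basic_rel (Comp (Comp f g) h) 1 (Comp f (Comp g h))"
| cat_idl: "wt f \<Longrightarrow> basic_rel (Comp (Idn (tgt f)) f) 1 f"
| cat_idr: "wt f \<Longrightarrow> basic_rel (Comp f (Idn (src f))) 1 f"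
| ten_assoc: "\<lbrakk>wt f; wt g; wt h\<rbrakk> \<Longrightarrow> basic_rel (Tens (Tens f g) h) 1 (Tens f (Tens g h))"
| ten_unitl: "wt f \<Longrightarrow> basic_rel (Tens (Idn 0) f) 1 f"
| ten_unitr: "wt f \<Longrightarrow> basic_rel (Tens f (Idn 0)) 1 f"
| ten_id: "basic_rel (Tens (Idn m) (Idn n)) 1 (Idn (m + n))"
| interchange: "\<lbrakk>wt f; wt g; wt h; wt k; tgt h = src f; tgt k = src g\<rbrakk>
     \<Longrightarrow> basic_rel (Comp (Tens f g) (Tens h k)) ((-1) ^ (par g * par h)) (Tens (Comp f h) (Comp g k))"
| R1a: "basic_rel (Comp sS sS) 1 (Idn 2)"
| R1b: "basic_rel (Comp (Comp (Tens sS one) (Tens one sS)) (Tens sS one)) 1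
                  (Comp (Comp (Tens one sS) (Tens sS one)) (Tens one sS))"
| R2a: "basic_rel (Comp (Tens bB one) (Tens one bBs)) (-1) one"
| R2b: "basic_rel (Comp (Tens one bB) (Tens bBs one)) 1 one"
| R3a: "basic_rel (Comp (Tens one sS) (Tens bBs one)) 1 (Comp (Tens sS one) (Tens one bBs))"
| R3b: "basic_rel (Comp sS bBs) (-1) bBs"

text \<open>rel_ideal a b x : x lies in the subspace of the free Hom space V a b that is
  generated (as a two-sided tensor ideal) by the basic relations.
  Hom_sBr(a,b) is the quotient V a b / {x. rel_ideal a b x}.\<close>
inductive rel_ideal :: "nat \<Rightarrow> nat \<Rightarrow> vec \<Rightarrow> bool" where
  ri_zero: "rel_ideal a b (\<lambda>_. 0)"
| ri_add: "rel_ideal a b x \<Longrightarrow> rel_ideal a b y \<Longrightarrow> rel_ideal a b (\<lambda>m. x m + y m)"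
| ri_smult: "rel_ideal a b x \<Longrightarrow> rel_ideal a b (\<lambda>m. c * x m)"
| ri_basic: "basic_rel f c g \<Longrightarrow>
     rel_ideal (src f) (tgt f) (\<lambda>m. delta f m - c * delta g m)"
| ri_compL: "rel_ideal a b x \<Longrightarrow> wt f \<Longrightarrow> src f = b \<Longrightarrow> rel_ideal a (tgt f) (compL f x)"
| ri_compR: "rel_ideal a b x \<Longrightarrow> wt f \<Longrightarrow> tgt f = a \<Longrightarrow> rel_ideal (src f) b (compR x f)"
| ri_tensL: "rel_ideal a b x \<Longrightarrow> wt f \<Longrightarrow> rel_ideal (src f + a) (tgt f + b) (tensL f x)"
| ri_tensR: "rel_ideal a b x \<Longrightarrow> wt f \<Longrightarrow> rel_ideal (a + src f) (b + tgt f) (tensR x f)"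

text \<open>An indexed family (phi i)_{i in C} of terms a -> b gives a basis of Hom_sBr(a,b):
  its classes span the quotient and are linearly independent (in particular pairwise distinct).\<close>
definition hom_basis :: "nat \<Rightarrow> nat \<Rightarrow> 'i set \<Rightarrow> ('i \<Rightarrow> mor) \<Rightarrow> bool" where
  "hom_basis a b C phi \<longleftrightarrow>
     finite C \<and>
     (\<forall>i\<in>C. wt (phi i) \<and> src (phi i) = a \<and> tgt (phi i) = b) \<and>
     (\<forall>x\<in>V a b. \<exists>coef. rel_ideal a b (\<lambda>m. x m - (\<Sum>i\<in>C. coef i * delta (phi i) m))) \<and>
     (\<forall>coef. rel_ideal a b (\<lambda>m. \<Sum>i\<in>C. coef i * delta (phi i) m) \<longrightarrow> (\<forall>i\<in>C. coef i = 0))"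

definition hom_dim :: "nat \<Rightarrow> nat \<Rightarrow> nat \<Rightarrow> bool" where
  "hom_dim a b n \<longleftrightarrow> (\<exists>phi. hom_basis a b {..<n} phi)"

text \<open>A layer is a tensor product (left to right) of generators and identities 1_star;
  a diagram is a nonempty list of layers, read bottom to top.\<close>
datatype item = I1 | Sx | Cap | Cup

fun isrc :: "item \<Rightarrow> nat" where
  "isrc I1 = 1" | "isrc Sx = 2" | "isrc Cap = 2" | "isrc Cup = 0"
fun itgt :: "item \<Rightarrow> nat" where
  "itgt I1 = 1" | "itgt Sx = 2" | "itgt Cap = 0" | "itgt Cup = 2"
fun item_mor :: "item \<Rightarrow> mor" where
  "item_mor I1 = one" | "item_mor Sx = sS" | "item_mor Cap = bB" | "item_mor Cup = bBs"

type_synonym layer = "item list"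
type_synonym diagram = "layer list"

definition lsrc :: "layer \<Rightarrow> nat" where "lsrc L = sum_list (map isrc L)"
definition ltgt :: "layer \<Rightarrow> nat" where "ltgt L = sum_list (map itgt L)"

fun layer_mor :: "layer \<Rightarrow> mor" where
  "layer_mor [] = Idn 0"
| "layer_mor [x] = item_mor x"
| "layer_mor (x # xs) = Tens (item_mor x) (layer_mor xs)"

fun diag_mor :: "diagram \<Rightarrow> mor" where
  "diag_mor [] = Idn 0"
| "diag_mor (L # Ls) = foldl (\<lambda>acc L'. Comp (layer_mor L') acc) (layer_mor L) Ls"

definition is_diagram :: "nat \<Rightarrow> nat \<Rightarrow> diagram \<Rightarrow> bool" where
  "is_diagram a b D \<longleftrightarrow> D \<noteq> [] \<and> lsrc (hd D) = a \<and> ltgt (last D) = b \<and>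
     (\<forall>i. Suc i < length D \<longrightarrow> ltgt (D ! i) = lsrc (D ! Suc i))"

text \<open>Points of the drawing: (level, position); level i lies between layer i-1 and layer i
  (levels 0 .. length D; level 0 = bottom boundary, level length D = top boundary).
  Occurrences (x, i, ob, ot): item x in layer i, starting at bottom position ob and top position ot.\<close>
fun layer_occs :: "nat \<Rightarrow> nat \<Rightarrow> layer \<Rightarrow> (item \<times> nat \<times> nat) set" where
  "layer_occs ob ot [] = {}"
| "layer_occs ob ot (x # xs) = insert (x, ob, ot) (layer_occs (ob + isrc x) (ot + itgt x) xs)"

definition occs :: "diagram \<Rightarrow> (item \<times> nat \<times> nat \<times> nat) set" where
  "occs D = {(x, i, ob, ot) | x i ob ot. i < length D \<and> (x, ob, ot) \<in> layer_occs 0 0 (D ! i)}"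

fun item_edges :: "nat \<Rightarrow> nat \<Rightarrow> nat \<Rightarrow> item \<Rightarrow> ((nat \<times> nat) \<times> (nat \<times> nat)) set" where
  "item_edges i ob ot I1 = {((i, ob), (Suc i, ot))}"
| "item_edges i ob ot Sx = {((i, ob), (Suc i, Suc ot)), ((i, Suc ob), (Suc i, ot))}"
| "item_edges i ob ot Cap = {((i, ob), (i, Suc ob))}"
| "item_edges i ob ot Cup = {((Suc i, ot), (Suc i, Suc ot))}"

definition edges :: "diagram \<Rightarrow> ((nat \<times> nat) \<times> (nat \<times> nat)) set" where
  "edges D = (\<Union>(x, i, ob, ot)\<in>occs D. item_edges i ob ot x)"

definition conn :: "diagram \<Rightarrow> nat \<times> nat \<Rightarrow> nat \<times> nat \<Rightarrow> bool" where
  "conn D u v \<longleftrightarrow> (u, v) \<in> (edges D \<union> (edges D)\<inverse>)\<^sup>*"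

datatype pt = Bot nat | Top nat

definition pts :: "nat \<Rightarrow> nat \<Rightarrow> pt set" where
  "pts a b = Bot ` {..<a} \<union> Top ` {..<b}"

fun vtx :: "diagram \<Rightarrow> pt \<Rightarrow> nat \<times> nat" where
  "vtx D (Bot p) = (0, p)"
| "vtx D (Top q) = (length D, q)"

definition no_loops :: "nat \<Rightarrow> nat \<Rightarrow> diagram \<Rightarrow> bool" where
  "no_loops a b D \<longleftrightarrow> (\<forall>(u, v)\<in>edges D. \<exists>e\<in>pts a b. conn D u (vtx D e))"

definition connector :: "nat \<Rightarrow> nat \<Rightarrow> diagram \<Rightarrow> pt set set" where
  "connector a b D = {{x, y} | x y. x \<in> pts a b \<and> y \<in> pts a b \<and> x \<noteq> y \<and> conn D (vtx D x) (vtx D y)}"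

definition Conn :: "nat \<Rightarrow> nat \<Rightarrow> pt set set set" where
  "Conn a b = {M. (\<forall>e\<in>M. e \<subseteq> pts a b \<and> card e = 2) \<and> (\<forall>x\<in>pts a b. \<exists>!e. e \<in> M \<and> x \<in> e)}"

text \<open>Crossings (i, ob): the two crossing strands start at (i, ob) and (i, ob+1).\<close>
definition crossings :: "diagram \<Rightarrow> (nat \<times> nat) set" where
  "crossings D = {(i, ob) | i ob ot. (Sx, i, ob, ot) \<in> occs D}"

definition cup_lefts :: "nat \<Rightarrow> diagram \<Rightarrow> nat set" where
  "cup_lefts b D = {q. \<exists>q'. q < q' \<and> q' < b \<and> conn D (length D, q) (length D, q')}"
definition cap_lefts :: "nat \<Rightarrow> diagram \<Rightarrow> nat set" where
  "cap_lefts a D = {p. \<exists>p'. p < p' \<and> p' < a \<and> conn D (0, p) (0, p')}"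

text \<open>Height of the cup through top point q: the height (layer) of its lowest point, i.e. the
  lowest b^* occurring on it; height of the cap through bottom point p: the height of its highest
  point, i.e. the highest b occurring on it.\<close>
definition cup_height :: "diagram \<Rightarrow> nat \<Rightarrow> nat" where
  "cup_height D q = Min {i. \<exists>ob ot. (Cup, i, ob, ot) \<in> occs D \<and> conn D (Suc i, ot) (length D, q)}"
definition cap_height :: "diagram \<Rightarrow> nat \<Rightarrow> nat" where
  "cap_height D p = Max {i. \<exists>ob ot. (Cap, i, ob, ot) \<in> occs D \<and> conn D (i, ob) (0, p)}"

definition normal :: "nat \<Rightarrow> nat \<Rightarrow> diagram \<Rightarrow> bool" where
  "normal a b D \<longleftrightarrow>
     \<comment> \<open>no string intersects itself\<close>
     (\<forall>(i, ob)\<in>crossings D. \<not> conn D (i, ob) (i, Suc ob)) \<and>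
     \<comment> \<open>any two strings intersect at most once\<close>
     (\<forall>(i, ob)\<in>crossings D. \<forall>(j, oc)\<in>crossings D. (i, ob) \<noteq> (j, oc) \<longrightarrow>
        \<not> ((conn D (i, ob) (j, oc) \<and> conn D (i, Suc ob) (j, Suc oc)) \<or>
           (conn D (i, ob) (j, Suc oc) \<and> conn D (i, Suc ob) (j, oc)))) \<and>
     \<comment> \<open>no two cups or caps are at the same height\<close>
     (\<forall>q\<in>cup_lefts b D. \<forall>q'\<in>cup_lefts b D. q \<noteq> q' \<longrightarrow> cup_height D q \<noteq> cup_height D q') \<and>
     (\<forall>p\<in>cap_lefts a D. \<forall>p'\<in>cap_lefts a D. p \<noteq> p' \<longrightarrow> cap_height D p \<noteq> cap_height D p') \<and>
     (\<forall>q\<in>cup_lefts b D. \<forall>p\<in>cap_lefts a D. cup_height D q \<noteq> cap_height D p) \<and>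
     \<comment> \<open>all cups are above all caps\<close>
     (\<forall>q\<in>cup_lefts b D. \<forall>p\<in>cap_lefts a D. cap_height D p < cup_height D q) \<and>
     \<comment> \<open>cap heights decrease from left to right\<close>
     (\<forall>p\<in>cap_lefts a D. \<forall>p'\<in>cap_lefts a D. p < p' \<longrightarrow> cap_height D p' < cap_height D p) \<and>
     \<comment> \<open>cup heights increase from left to right\<close>
     (\<forall>q\<in>cup_lefts b D. \<forall>q'\<in>cup_lefts b D. q < q' \<longrightarrow> cup_height D q < cup_height D q')"

definition normal_choice :: "nat \<Rightarrow> nat \<Rightarrow> (pt set set \<Rightarrow> diagram) \<Rightarrow> bool" where
  "normal_choice a b d \<longleftrightarrow>
     (\<forall>c\<in>Conn a b. is_diagram a b (d c) \<and> no_loops a b (d c) \<and> normal a b (d c)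
                     \<and> connector a b (d c) = c)"

end

theory Submission
  imports Defs "HOL-Library.Multiset"
begin

text \<open>
  Spanning. Up to scalars, bending reduces morphisms \<open>a \<rightarrow> b\<close> to morphisms \<open>0 \<rightarrow> a + b\<close>, and each of
  these reduces to a composite of operations ``insert a cup whose left leg is leftmost''. Such
  composites are indexed by lists of positions of the right legs, of which there are
  \<open>(a + b - 1)!!\<close>. Scalars vanish only through the loop \<open>b b\<^sup>* = 0\<close>, a consequence of \<open>b s = b\<close> and
  \<open>s b\<^sup>* = - b\<^sup>*\<close>.

  Independence. Represent sBr on the tensor powers of the superspace of dimension \<open>N | N\<close> with an odd form.
  A matrix entry of a diagram is a signed count of labellings of its strings. In a loop-free
  diagram a labelling is determined by its boundary values, so for boundary values that use each
  index on one string of \<open>c\<close> only, the entry of \<open>d\<^sub>c\<close> is nonzero and that of every other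
  \<open>d\<^sub>c'\<close> is zero. Hence \<open>d\<^sub>c\<close> is a nonzero multiple of a standard composite, and by counting each
  standard composite arises from exactly one matching.

  Existence of normal diagrams. Build the diagram upwards from its bottom line: push the cap with the rightmost left
  end together and close it; sort the through strings by adjacent transpositions; when they are
  sorted, open the leftmost cup. Every crossing produced in this way is forced, in the sense that its
  two strings interlace on the boundary circle.
\<close>

section \<open>Reduction of morphisms up to scalars\<close>

text \<open>Signs are the obstacle: a direct reduction would have to show that no diagram is forced
  to equal its own negative. Rewriting therefore forgets scalars, and every fact about them is
  recovered from matrix entries. If a loop-free diagram reduces to a standard composite with an
  unknown factor, one nonzero entry of the diagram forces that factor to be nonzero; even the sign
  in \<open>b s = b\<close> is read off from an entry. The labelling that exhibits such an entry is
  not guessed from the diagram. It is written down for the standard composite, where every cup can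
  be given its own index, and carried back along the reduction, because \<open>rel\<close> is
  invariant under each rewriting step, loop removal included. Choosing \<open>N = a + b + 1\<close>
  provides enough indices. In the construction of normal diagrams, drawing a forced crossing turns
  an interlaced pair into one that is not interlaced. This single fact both ends the sorting and
  keeps two strings from meeting twice.\<close>

inductive brel :: "mor \<Rightarrow> mor \<Rightarrow> bool" where
  b_assoc: "brel (Comp (Comp f g) h) (Comp f (Comp g h))"
| b_idl: "brel (Comp (Idn (tgt f)) f) f"
| b_idr: "brel (Comp f (Idn (src f))) f"
| b_tassoc: "brel (Tens (Tens f g) h) (Tens f (Tens g h))"
| b_tunitl: "brel (Tens (Idn 0) f) f"
| b_tunitr: "brel (Tens f (Idn 0)) f"
| b_tid: "brel (Tens (Idn m) (Idn n)) (Idn (m + n))"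
| b_inter: "\<lbrakk>tgt h = src f; tgt k = src g\<rbrakk>
     \<Longrightarrow> brel (Comp (Tens f g) (Tens h k)) (Tens (Comp f h) (Comp g k))"
| b_R1a: "brel (Comp sS sS) (Idn 2)"
| b_R1b: "brel (Comp (Comp (Tens sS one) (Tens one sS)) (Tens sS one))
               (Comp (Comp (Tens one sS) (Tens sS one)) (Tens one sS))"
| b_R2a: "brel (Comp (Tens bB one) (Tens one bBs)) one"
| b_R2b: "brel (Comp (Tens one bB) (Tens bBs one)) one"
| b_R3a: "brel (Comp (Tens one sS) (Tens bBs one)) (Comp (Tens sS one) (Tens one bBs))"
| b_R3b: "brel (Comp sS bBs) bBs"

text \<open>Scalars are dropped, so that signs need not be tracked. The flag \<open>l\<close> permits removing loops; without it
  the relation is symmetric and only nonzero scalars are hidden.\<close>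

inductive red :: "bool \<Rightarrow> mor \<Rightarrow> mor \<Rightarrow> bool" for l where
  red_fwd: "brel f g \<Longrightarrow> red l f g"
| red_bwd: "brel f g \<Longrightarrow> red l g f"
| red_loop: "l \<Longrightarrow> red l (Comp bB bBs) (Idn 0)"
| red_refl: "red l f f"
| red_trans: "red l f g \<Longrightarrow> red l g h \<Longrightarrow> red l f h"
| red_compL: "red l m m' \<Longrightarrow> red l (Comp f m) (Comp f m')"
| red_compR: "red l m m' \<Longrightarrow> red l (Comp m f) (Comp m' f)"
| red_tensL: "red l m m' \<Longrightarrow> red l (Tens f m) (Tens f m')"
| red_tensR: "red l m m' \<Longrightarrow> red l (Tens m f) (Tens m' f)"

abbreviation eqv (infix "\<approx>" 50) where "x \<approx> y \<equiv> red False x y"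
abbreviation reds (infix "\<leadsto>" 50) where "x \<leadsto> y \<equiv> red True x y"

lemma eqv_refl[simp, intro]: "x \<approx> x" "x \<leadsto> x" by (rule red_refl)+

lemma eqv_sym: "x \<approx> y \<Longrightarrow> y \<approx> x"
  by (induction rule: red.induct) (auto intro: red.intros)

lemma eqv_trans[trans]: "x \<approx> y \<Longrightarrow> y \<approx> z \<Longrightarrow> x \<approx> z" by (rule red_trans)
lemma reds_trans[trans]: "x \<leadsto> y \<Longrightarrow> y \<leadsto> z \<Longrightarrow> x \<leadsto> z" by (rule red_trans)

lemma eqv_reds: "x \<approx> y \<Longrightarrow> x \<leadsto> y"
  by (induction rule: red.induct) (auto intro: red.intros)

lemma eqv_reds_trans[trans]: "x \<approx> y \<Longrightarrow> y \<leadsto> z \<Longrightarrow> x \<leadsto> z"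
  "x \<leadsto> y \<Longrightarrow> y \<approx> z \<Longrightarrow> x \<leadsto> z"
  using eqv_reds reds_trans by blast+

text \<open>\<open>brel\<close> carries no premises \<open>wt\<close>. Since both sides are well
  typed simultaneously, assuming it of one end of a reduction is enough to recover the premises of
  \<open>basic_rel\<close>.\<close>

lemma brel_type: "brel f g \<Longrightarrow> src f = src g \<and> tgt f = tgt g \<and> wt f = wt g"
  by (induction rule: brel.induct) auto

lemma red_type: "red l f g \<Longrightarrow> src f = src g \<and> tgt f = tgt g \<and> wt f = wt g"
  by (induction rule: red.induct) (auto dest: brel_type)

lemma eqv_comp: "f \<approx> f' \<Longrightarrow> g \<approx> g' \<Longrightarrow> Comp f g \<approx> Comp f' g'"
  by (meson red_compL red_compR red_trans)
lemma eqv_tens: "f \<approx> f' \<Longrightarrow> g \<approx> g' \<Longrightarrow> Tens f g \<approx> Tens f' g'"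
  by (meson red_tensL red_tensR red_trans)

lemma eqv_idl: "n = tgt f \<Longrightarrow> Comp (Idn n) f \<approx> f"
  by (simp add: b_idl red_fwd)
lemma eqv_idr: "n = src f \<Longrightarrow> Comp f (Idn n) \<approx> f"
  by (simp add: b_idr red_fwd)
lemma eqv_assoc: "Comp (Comp f g) h \<approx> Comp f (Comp g h)"
  by (simp add: b_assoc red_fwd)
lemma eqv_tassoc: "Tens (Tens f g) h \<approx> Tens f (Tens g h)"
  by (simp add: b_tassoc red_fwd)
lemma eqv_tid: "Tens (Idn m) (Idn n) \<approx> Idn (m + n)"
  by (simp add: b_tid red_fwd)
lemma eqv_inter: "\<lbrakk>tgt h = src f; tgt k = src g\<rbrakk>
     \<Longrightarrow> Comp (Tens f g) (Tens h k) \<approx> Tens (Comp f h) (Comp g k)"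
  by (simp add: b_inter red_fwd)

section \<open>Whiskering and the action of a morphism on adjacent strands\<close>

definition wh :: "nat \<Rightarrow> mor \<Rightarrow> nat \<Rightarrow> mor" where
  "wh k g n = Tens (Idn k) (Tens g (Idn n))"

lemma wh_type[simp]: "src (wh k g n) = k + src g + n" "tgt (wh k g n) = k + tgt g + n"
  "wt (wh k g n) = wt g"
  by (auto simp: wh_def)

lemma wh_cong: "g \<approx> g' \<Longrightarrow> wh k g n \<approx> wh k g' n"
  by (simp add: wh_def red_tensL red_tensR)

lemma wh_comp: assumes "tgt g = src f"
  shows "wh k (Comp f g) n \<approx> Comp (wh k f n) (wh k g n)"
proof -
  have "Comp (wh k f n) (wh k g n) \<approx> Tens (Comp (Idn k) (Idn k)) (Comp (Tens f (Idn n)) (Tens g (Idn n)))"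
    unfolding wh_def by (rule eqv_inter) (auto simp: assms)
  also have "\<dots> \<approx> Tens (Idn k) (Tens (Comp f g) (Comp (Idn n) (Idn n)))"
    by (intro eqv_tens eqv_inter eqv_idl) (auto simp: assms)
  also have "\<dots> \<approx> wh k (Comp f g) n" unfolding wh_def
    by (intro eqv_tens eqv_idl eqv_refl) auto
  finally show ?thesis by (rule eqv_sym)
qed

lemma wh_id: "wh k (Idn p) n \<approx> Idn (k + p + n)"
  unfolding wh_def
  using eqv_trans[OF eqv_tens[OF eqv_refl(1) eqv_tid] eqv_tid] by (simp add: add.assoc)

lemma wh_tensL: "wh k (Tens (Idn l) g) n \<approx> wh (k + l) g n"
proof -
  have "wh k (Tens (Idn l) g) n \<approx> Tens (Idn k) (Tens (Idn l) (Tens g (Idn n)))"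
    unfolding wh_def by (intro eqv_tens eqv_tassoc eqv_refl)
  also have "\<dots> \<approx> Tens (Tens (Idn k) (Idn l)) (Tens g (Idn n))"
    by (rule eqv_sym, rule eqv_tassoc)
  also have "\<dots> \<approx> wh (k + l) g n" unfolding wh_def
    by (intro eqv_tens eqv_tid eqv_refl)
  finally show ?thesis .
qed

lemma wh_tensR: "wh k (Tens g (Idn l)) n \<approx> wh k g (l + n)"
proof -
  have "wh k (Tens g (Idn l)) n \<approx> Tens (Idn k) (Tens g (Tens (Idn l) (Idn n)))"
    unfolding wh_def by (intro eqv_tens eqv_tassoc eqv_refl)
  also have "\<dots> \<approx> wh k g (l + n)" unfolding wh_def
    by (intro eqv_tens eqv_tid eqv_refl)
  finally show ?thesis .
qed

text \<open>Together with \<open>tens_split2\<close> this lets either factor act first. Comparing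
  the two orders is what makes distant morphisms commute; the sign of super interchange is hidden in
  \<open>\<approx>\<close>.\<close>

lemma tens_split1: "Tens f g \<approx> Comp (Tens f (Idn (tgt g))) (Tens (Idn (src f)) g)"
proof -
  have "Comp (Tens f (Idn (tgt g))) (Tens (Idn (src f)) g) \<approx> Tens (Comp f (Idn (src f))) (Comp (Idn (tgt g)) g)"
    by (rule eqv_inter) auto
  also have "\<dots> \<approx> Tens f g" by (intro eqv_tens eqv_idl eqv_idr) auto
  finally show ?thesis by (rule eqv_sym)
qed

lemma tens_split2: "Tens f g \<approx> Comp (Tens (Idn (tgt f)) g) (Tens f (Idn (src g)))"
proof -
  have "Comp (Tens (Idn (tgt f)) g) (Tens f (Idn (src g))) \<approx> Tens (Comp (Idn (tgt f)) f) (Comp g (Idn (src g)))"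
    by (rule eqv_inter) auto
  also have "\<dots> \<approx> Tens f g" by (intro eqv_tens eqv_idl eqv_idr) auto
  finally show ?thesis by (rule eqv_sym)
qed

text \<open>The generator \<open>g\<close> applied to the outputs \<open>k, k + 1, \<dots>\<close> of \<open>x\<close>; meaningful if \<open>k + src g \<le> tgt x\<close>.\<close>

definition act :: "nat \<Rightarrow> mor \<Rightarrow> mor \<Rightarrow> mor" where
  "act k g x = Comp (wh k g (tgt x - k - src g)) x"

lemma act_type[simp]: "src (act k g x) = src x"
  "tgt (act k g x) = k + tgt g + (tgt x - k - src g)"
  by (auto simp: act_def)

lemma act_wt[simp]: "k + src g \<le> tgt x \<Longrightarrow> wt (act k g x) = (wt g \<and> wt x)"
  by (auto simp: act_def)

lemma act_cong: "red l x y \<Longrightarrow> red l (act k g x) (act k g y)"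
  by (metis act_def red_compL red_type)

lemma act_congL: "g \<approx> g' \<Longrightarrow> act k g x \<approx> act k g' x"
  by (metis act_def red_compR red_type wh_cong)

lemma act_comp: assumes "tgt g = src f" "k + src g \<le> tgt x"
  shows "act k (Comp f g) x \<approx> act k f (act k g x)"
proof -
  let ?n = "tgt x - k - src g"
  have "act k (Comp f g) x \<approx> Comp (Comp (wh k f ?n) (wh k g ?n)) x"
    unfolding act_def using wh_comp[OF assms(1)] by (simp add: red_compR)
  also have "\<dots> \<approx> Comp (wh k f ?n) (Comp (wh k g ?n) x)" by (rule eqv_assoc)
  also have "\<dots> = act k f (act k g x)" using assms by (simp add: act_def add.commute)
  finally show ?thesis .
qed

lemma act_id: assumes "k + n \<le> tgt x" shows "act k (Idn n) x \<approx> x"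
proof -
  have "act k (Idn n) x \<approx> Comp (Idn (tgt x)) x"
    unfolding act_def using wh_id[of k n "tgt x - k - n"] assms by (simp add: red_compR)
  also have "\<dots> \<approx> x" by (rule eqv_idl) simp
  finally show ?thesis .
qed

lemma act_tens_idL: "act k (Tens (Idn l) g) x \<approx> act (k + l) g x"
  unfolding act_def using wh_tensL[of k l g "tgt x - k - l - src g"]
  by (auto intro: red_compR simp: algebra_simps)

lemma act_tens_idR: "k + src g + l \<le> tgt x \<Longrightarrow> act k (Tens g (Idn l)) x \<approx> act k g x"
  unfolding act_def using wh_tensR[of k g l "tgt x - k - (src g + l)"] by (simp add: red_compR)

lemma act_tens1: assumes "k + src f + src g \<le> tgt x"
  shows "act k (Tens f g) x \<approx> act k f (act (k + src f) g x)"
proof -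
  have "act k (Tens f g) x \<approx> act k (Comp (Tens f (Idn (tgt g))) (Tens (Idn (src f)) g)) x"
    by (rule act_congL, rule tens_split1)
  also have "\<dots> \<approx> act k (Tens f (Idn (tgt g))) (act k (Tens (Idn (src f)) g) x)"
    by (rule act_comp) (use assms in auto)
  also have "\<dots> \<approx> act k (Tens f (Idn (tgt g))) (act (k + src f) g x)"
    by (intro act_cong act_tens_idL)
  also have "\<dots> \<approx> act k f (act (k + src f) g x)"
    by (rule act_tens_idR) (use assms in auto)
  finally show ?thesis .
qed

lemma act_tens2: assumes "k + src f + src g \<le> tgt x"
  shows "act k (Tens f g) x \<approx> act (k + tgt f) g (act k f x)"
proof -
  have "act k (Tens f g) x \<approx> act k (Comp (Tens (Idn (tgt f)) g) (Tens f (Idn (src g)))) x"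
    by (rule act_congL, rule tens_split2)
  also have "\<dots> \<approx> act k (Tens (Idn (tgt f)) g) (act k (Tens f (Idn (src g))) x)"
    by (rule act_comp) (use assms in auto)
  also have "\<dots> \<approx> act k (Tens (Idn (tgt f)) g) (act k f x)"
    by (intro act_cong act_tens_idR) (use assms in auto)
  also have "\<dots> \<approx> act (k + tgt f) g (act k f x)"
    by (rule act_tens_idL)
  finally show ?thesis .
qed

text \<open>With \<open>d\<close> idle strands in between, the two sides are the two orders of
  evaluating \<open>(f \<otimes> id) \<otimes> g\<close>. Applying \<open>f\<close> first changes
  the number of strands left of \<open>g\<close>, whence the new position
  \<open>l + tgt f - src f\<close>.\<close>

lemma act_far: assumes "k + src f \<le> l" "l + src g \<le> tgt x"
  shows "act k f (act l g x) \<approx> act (l + tgt f - src f) g (act k f x)"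
proof -
  define d where "d = l - k - src f"
  have l: "l = k + src f + d" using assms by (simp add: d_def)
  have "act k (Tens (Tens f (Idn d)) g) x \<approx> act k (Tens f (Idn d)) (act (k + src f + d) g x)"
    using act_tens1[of k "Tens f (Idn d)" g x] assms l by (simp add: add.assoc)
  also have "\<dots> \<approx> act k f (act l g x)"
    unfolding l by (rule act_tens_idR) (use assms l in auto)
  finally have 1: "act k (Tens (Tens f (Idn d)) g) x \<approx> act k f (act l g x)" .
  have "act k (Tens (Tens f (Idn d)) g) x \<approx> act (k + tgt f + d) g (act k (Tens f (Idn d)) x)"
    using act_tens2[of k "Tens f (Idn d)" g x] assms l by (simp add: add.assoc)
  also have "\<dots> \<approx> act (k + tgt f + d) g (act k f x)"
    by (intro act_cong act_tens_idR) (use assms l in auto)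
  finally have 2: "act k (Tens (Tens f (Idn d)) g) x \<approx> act (k + tgt f + d) g (act k f x)" .
  have "k + tgt f + d = l + tgt f - src f" using l by simp
  then show ?thesis using 1 2 eqv_sym eqv_trans by metis
qed

section \<open>Moves of crossings, cups and caps\<close>

abbreviation "sw k \<equiv> act k sS"
abbreviation "cu k \<equiv> act k bBs"
abbreviation "ca k \<equiv> act k bB"

lemma sw_sw: "k + 2 \<le> tgt x \<Longrightarrow> sw k (sw k x) \<approx> x"
  by (rule eqv_trans[OF eqv_sym[OF act_comp] eqv_trans[OF act_congL[OF red_fwd[OF b_R1a]] act_id]]) auto

text \<open>Two layers that idle on opposite outer strands are the shape of the zigzags in (R2) and
  of the sliding relation in (R3). This lemma turns them into successive actions at neighbouring
  positions.\<close>

lemma act_mixed: 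
  assumes "k + src g + 1 \<le> tgt x" "Suc (src f) = Suc (tgt g)"
  shows "act k (Comp (Tens one f) (Tens g one)) x \<approx> act (Suc k) f (act k g x)"
    "act k (Comp (Tens f one) (Tens one g)) x \<approx> act k f (act (Suc k) g x)"
proof -
  have "act k (Comp (Tens one f) (Tens g one)) x \<approx> act k (Tens one f) (act k (Tens g one) x)"
    by (rule act_comp) (use assms in auto)
  also have "\<dots> \<approx> act k (Tens one f) (act k g x)"
    by (intro act_cong act_tens_idR) (use assms in auto)
  also have "\<dots> \<approx> act (k+1) f (act k g x)" by (rule act_tens_idL)
  finally show "act k (Comp (Tens one f) (Tens g one)) x \<approx> act (Suc k) f (act k g x)" by simp
  have "act k (Comp (Tens f one) (Tens one g)) x \<approx> act k (Tens f one) (act k (Tens one g) x)"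
    by (rule act_comp) (use assms in auto)
  also have "\<dots> \<approx> act k (Tens f one) (act (k+1) g x)"
    by (intro act_cong act_tens_idL) 
  also have "\<dots> \<approx> act k f (act (k+1) g x)" by (rule act_tens_idR) (use assms in auto)
  finally show "act k (Comp (Tens f one) (Tens one g)) x \<approx> act k f (act (Suc k) g x)" by simp
qed

lemma sw_cu_slide: "k + 1 \<le> tgt x \<Longrightarrow> sw (Suc k) (cu k x) \<approx> sw k (cu (Suc k) x)"
  by (rule eqv_trans[OF eqv_sym[OF act_mixed(1)] eqv_trans[OF act_congL[OF red_fwd[OF b_R3a]] act_mixed(2)]]) auto

lemma ca_cu_right: "k + 1 \<le> tgt x \<Longrightarrow> ca k (cu (Suc k) x) \<approx> x"
  by (rule eqv_trans[OF eqv_sym[OF act_mixed(2)] eqv_trans[OF act_congL[OF red_fwd[OF b_R2a]] act_id]]) auto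

lemma ca_cu_left: "k + 1 \<le> tgt x \<Longrightarrow> ca (Suc k) (cu k x) \<approx> x"
  by (rule eqv_trans[OF eqv_sym[OF act_mixed(1)] eqv_trans[OF act_congL[OF red_fwd[OF b_R2b]] act_id]]) auto

lemma sw_cu: "k \<le> tgt x \<Longrightarrow> sw k (cu k x) \<approx> cu k x"
  by (rule eqv_trans[OF eqv_sym[OF act_comp] act_congL[OF red_fwd[OF b_R3b]]]) auto

lemma braid: assumes "k + 3 \<le> tgt x"
  shows "sw k (sw (Suc k) (sw k x)) \<approx> sw (Suc k) (sw k (sw (Suc k) x))"
proof -
  have "act k (Comp (Comp (Tens sS one) (Tens one sS)) (Tens sS one)) x
     \<approx> act k (Comp (Tens sS one) (Tens one sS)) (act k (Tens sS one) x)"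
    by (rule act_comp) (use assms in auto)
  also have "\<dots> \<approx> act k (Comp (Tens sS one) (Tens one sS)) (sw k x)"
    by (intro act_cong act_tens_idR) (use assms in auto)
  also have "\<dots> \<approx> sw k (sw (Suc k) (sw k x))" by (rule act_mixed) (use assms in auto)
  finally have 1: "act k (Comp (Comp (Tens sS one) (Tens one sS)) (Tens sS one)) x \<approx> sw k (sw (Suc k) (sw k x))" .
  have "act k (Comp (Comp (Tens one sS) (Tens sS one)) (Tens one sS)) x
     \<approx> act k (Comp (Tens one sS) (Tens sS one)) (act k (Tens one sS) x)"
    by (rule act_comp) (use assms in auto)
  also have "\<dots> \<approx> act k (Comp (Tens one sS) (Tens sS one)) (sw (k+1) x)"
    by (intro act_cong act_tens_idL)
  also have "\<dots> \<approx> sw (Suc k) (sw k (sw (k+1) x))" by (rule act_mixed) (use assms in auto)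
  finally have 2: "act k (Comp (Comp (Tens one sS) (Tens sS one)) (Tens one sS)) x \<approx> sw (Suc k) (sw k (sw (Suc k) x))" 
    by simp
  show ?thesis
    by (rule eqv_trans[OF eqv_sym[OF 1] eqv_trans[OF act_congL[OF red_fwd[OF b_R1b]] 2]])
qed

lemma sw_far: "k + 2 \<le> l \<Longrightarrow> l + 2 \<le> tgt x \<Longrightarrow> sw k (sw l x) \<approx> sw l (sw k x)"
  using act_far[of k sS l sS x] by simp
lemma sw_cu_above: "k \<le> i \<Longrightarrow> i + 2 \<le> tgt x \<Longrightarrow> sw (Suc (Suc i)) (cu k x) \<approx> cu k (sw i x)"
  using eqv_sym[OF act_far[of k bBs i sS x]] by (simp add: eval_nat_numeral)
lemma cu_cu: "j \<le> k \<Longrightarrow> k \<le> tgt x \<Longrightarrow> cu (Suc (Suc k)) (cu j x) \<approx> cu j (cu k x)"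
  using eqv_sym[OF act_far[of j bBs k bBs x]] by (simp add: eval_nat_numeral)
lemma ca_sw_above: "k \<le> i \<Longrightarrow> i + 4 \<le> tgt x \<Longrightarrow> ca k (sw (Suc (Suc i)) x) \<approx> sw i (ca k x)"
  using act_far[of k bB "i+2" sS x] by (simp add: eval_nat_numeral)

lemma ca_ca: "k \<le> i \<Longrightarrow> i + 4 \<le> tgt x \<Longrightarrow> ca k (ca (Suc (Suc i)) x) \<approx> ca i (ca k x)"
  using act_far[of k bB "i+2" bB x] by (simp add: eval_nat_numeral)
lemma sw_ca_below: "i + 2 \<le> k \<Longrightarrow> k + 2 \<le> tgt x \<Longrightarrow> sw i (ca k x) \<approx> ca k (sw i x)"
  using act_far[of i sS k bB x] by simp

text \<open>The cap version of (R3), obtained by inserting a zigzag on strand \<open>k\<close> and sliding along its cup.\<close>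

lemma ca_sw_slide: assumes "k + 3 \<le> tgt x"
  shows "ca (Suc k) (sw k x) \<approx> ca k (sw (Suc k) x)"
proof -
  let ?z = "cu (Suc k) x" and ?y = "cu (Suc (Suc k)) x"
  have "ca (Suc k) (sw k x) \<approx> ca (Suc k) (sw k (ca k ?z))"
    by (intro act_cong eqv_sym[OF ca_cu_right]) (use assms in auto)
  also have "\<dots> \<approx> ca (Suc k) (ca k (sw (Suc (Suc k)) ?z))"
    by (intro act_cong eqv_sym[OF ca_sw_above]) (use assms in auto)
  also have "\<dots> \<approx> ca k (ca (Suc (Suc (Suc k))) (sw (Suc (Suc k)) ?z))"
    by (rule eqv_sym[OF ca_ca]) (use assms in auto)
  also have "\<dots> \<approx> ca k (ca (Suc (Suc (Suc k))) (sw (Suc k) ?y))"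
    by (intro act_cong sw_cu_slide) (use assms in auto)
  also have "\<dots> \<approx> ca k (sw (Suc k) (ca (Suc (Suc (Suc k))) ?y))"
    by (intro act_cong eqv_sym[OF sw_ca_below]) (use assms in auto)
  also have "\<dots> \<approx> ca k (sw (Suc k) x)"
    by (intro act_cong ca_cu_left) (use assms in auto)
  finally show ?thesis .
qed

text \<open>The cap version of \<open>s b* = - b*\<close>. A zigzag inserted on strand
  \<open>k\<close> carries the crossing over to the new cup, which absorbs it, and is then
  straightened.\<close>

lemma ca_sw: assumes "k + 2 \<le> tgt x"
  shows "ca k (sw k x) \<approx> ca k x"
proof -
  let ?z = "cu (Suc k) x" and ?y = "cu (Suc (Suc k)) x"
  have "ca k (sw k x) \<approx> ca k (sw k (ca k ?z))"
    by (intro act_cong eqv_sym[OF ca_cu_right]) (use assms in auto)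
  also have "\<dots> \<approx> ca k (ca k (sw (Suc (Suc k)) ?z))"
    by (intro act_cong eqv_sym[OF ca_sw_above]) (use assms in auto)
  also have "\<dots> \<approx> ca k (ca (Suc (Suc k)) (sw (Suc (Suc k)) ?z))"
    by (rule eqv_sym[OF ca_ca]) (use assms in auto)
  also have "\<dots> \<approx> ca k (ca (Suc (Suc k)) (sw (Suc k) ?y))"
    by (intro act_cong sw_cu_slide) (use assms in auto)
  also have "\<dots> \<approx> ca k (ca (Suc k) (sw (Suc (Suc k)) ?y))"
    by (intro act_cong ca_sw_slide) (use assms in auto)
  also have "\<dots> \<approx> ca k (ca (Suc k) ?y)"
    by (intro act_cong sw_cu) (use assms in auto)
  also have "\<dots> \<approx> ca k x"
    by (intro act_cong ca_cu_right) (use assms in auto)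
  finally show ?thesis .
qed

text \<open>With \<open>cu_Suc\<close>, this trades one step in the position of a cap or cup for two
  crossings, so that \<open>ca_cups\<close> and \<open>cu_cups\<close> treat only position
  \<open>0\<close> by hand.\<close>

lemma ca_Suc: assumes "k + 3 \<le> tgt x"
  shows "ca (Suc k) x \<approx> ca k (sw (Suc k) (sw k x))"
proof -
  have "ca (Suc k) x \<approx> ca (Suc k) (sw k (sw k x))"
    by (intro act_cong eqv_sym[OF sw_sw]) (use assms in auto)
  also have "\<dots> \<approx> ca k (sw (Suc k) (sw k x))"
    by (rule ca_sw_slide) (use assms in auto)
  finally show ?thesis .
qed

lemma cu_Suc: assumes "k + 1 \<le> tgt x"
  shows "cu (Suc k) x \<approx> sw k (sw (Suc k) (cu k x))"
proof -
  have "cu (Suc k) x \<approx> sw k (sw k (cu (Suc k) x))"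
    by (rule eqv_sym[OF sw_sw]) (use assms in auto)
  also have "\<dots> \<approx> sw k (sw (Suc k) (cu k x))"
    by (intro act_cong eqv_sym[OF sw_cu_slide]) (use assms in auto)
  finally show ?thesis .
qed

section \<open>Standard morphisms\<close>

text \<open>Inserts a cup with legs at positions \<open>0\<close> and \<open>j + 1\<close>.\<close>

fun lcup :: "nat \<Rightarrow> mor \<Rightarrow> mor" where
  "lcup 0 x = cu 0 x"
| "lcup (Suc j) x = sw (Suc j) (lcup j x)"

lemma lcup_type[simp]: "j \<le> tgt x \<Longrightarrow> tgt (lcup j x) = Suc (Suc (tgt x))"
  "src (lcup j x) = src x"
  by (induction j) auto

lemma lcup_wt[simp]: "j \<le> tgt x \<Longrightarrow> wt (lcup j x) = wt x"
  by (induction j) auto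

lemma lcup_cong: "red l x y \<Longrightarrow> red l (lcup j x) (lcup j y)"
  by (induction j) (auto intro: act_cong)

lemma sw_lcup_above: "j \<le> i \<Longrightarrow> i + 2 \<le> tgt x \<Longrightarrow> sw (Suc (Suc i)) (lcup j x) \<approx> lcup j (sw i x)"
proof (induction j)
  case 0 then show ?case by (simp add: sw_cu_above)
next
  case (Suc j)
  have "sw (Suc (Suc i)) (lcup (Suc j) x) \<approx> sw (Suc j) (sw (Suc (Suc i)) (lcup j x))"
    using Suc.prems by (simp add: eqv_sym[OF sw_far])
  also have "\<dots> \<approx> sw (Suc j) (lcup j (sw i x))"
    by (intro act_cong Suc.IH) (use Suc.prems in auto)
  finally show ?case by simp
qed

text \<open>Both crossed strands pass the right leg of the cup, so the crossing can be pushed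
  through that leg: by the braid relation when they are the last two strands passed, by induction
  otherwise.\<close>

lemma sw_lcup_below: "k < j \<Longrightarrow> Suc j \<le> tgt x \<Longrightarrow> sw (Suc k) (lcup (Suc j) x) \<approx> lcup (Suc j) (sw k x)"
proof (induction j)
  case (Suc j)
  show ?case
  proof (cases "k = j")
    case True
    have "sw (Suc k) (lcup (Suc (Suc j)) x) = sw (Suc j) (sw (Suc (Suc j)) (sw (Suc j) (lcup j x)))"
      using True by simp
    also have "\<dots> \<approx> sw (Suc (Suc j)) (sw (Suc j) (sw (Suc (Suc j)) (lcup j x)))"
      by (rule braid) (use Suc.prems in auto)
    also have "\<dots> \<approx> sw (Suc (Suc j)) (sw (Suc j) (lcup j (sw j x)))"
      by (intro act_cong sw_lcup_above) (use Suc.prems in auto)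
    finally show ?thesis using True by simp
  next
    case False
    have "sw (Suc k) (lcup (Suc (Suc j)) x) = sw (Suc k) (sw (Suc (Suc j)) (lcup (Suc j) x))" by simp
    also have "\<dots> \<approx> sw (Suc (Suc j)) (sw (Suc k) (lcup (Suc j) x))"
      by (rule sw_far) (use Suc.prems False in auto)
    also have "\<dots> \<approx> sw (Suc (Suc j)) (lcup (Suc j) (sw k x))"
      by (intro act_cong Suc.IH) (use Suc.prems False in auto)
    finally show ?thesis by simp
  qed
qed simp

text \<open>A cup standing immediately inside the left leg of another one can be created first. The
  outer cup then has two more strands to pass.\<close>

lemma cu_1_lcup: "i \<le> tgt y \<Longrightarrow> cu (Suc 0) (lcup i y) \<approx> lcup (Suc (Suc i)) (cu 0 y)"
proof (induction i)
  case 0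
  have "cu (Suc 0) (cu 0 y) \<approx> sw (Suc (Suc 0)) (sw (Suc (Suc 0)) (cu (Suc 0) (cu 0 y)))"
    by (rule eqv_sym[OF sw_sw]) auto
  also have "\<dots> \<approx> sw (Suc (Suc 0)) (sw (Suc 0) (cu (Suc (Suc 0)) (cu 0 y)))"
    by (intro act_cong sw_cu_slide) auto
  also have "\<dots> \<approx> sw (Suc (Suc 0)) (sw (Suc 0) (cu 0 (cu 0 y)))"
    by (intro act_cong cu_cu) auto
  finally show ?case by simp
next
  case (Suc i)
  have "cu (Suc 0) (lcup (Suc i) y) = cu (Suc 0) (sw (Suc i) (lcup i y))" by simp
  also have "\<dots> \<approx> sw (Suc (Suc (Suc i))) (cu (Suc 0) (lcup i y))"
    by (rule eqv_sym[OF sw_cu_above]) (use Suc.prems in auto)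
  also have "\<dots> \<approx> sw (Suc (Suc (Suc i))) (lcup (Suc (Suc i)) (cu 0 y))"
    by (intro act_cong Suc.IH) (use Suc.prems in auto)
  finally show ?case by simp
qed

text \<open>The crossing exchanges two left legs, so on the right the cups are inserted in the
  opposite order. For \<open>j \<le> i\<close> the cup that was inserted first now passes both legs
  of the other one, while that one no longer passes its left leg; this gives \<open>i + 2\<close>
  and \<open>j\<close>.\<close>

lemma sw_0_lcup_lcup: "j \<le> i \<Longrightarrow> i \<le> tgt y \<Longrightarrow> sw 0 (lcup (Suc j) (lcup i y)) \<approx> lcup (Suc (Suc i)) (lcup j y)"
proof (induction j)
  case 0
  have "sw 0 (lcup (Suc 0) (lcup i y)) = sw 0 (sw (Suc 0) (cu 0 (lcup i y)))" by simp
  also have "\<dots> \<approx> cu (Suc 0) (lcup i y)"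
    by (rule eqv_sym[OF cu_Suc]) (use 0 in auto)
  also have "\<dots> \<approx> lcup (Suc (Suc i)) (cu 0 y)" by (rule cu_1_lcup) (use 0 in auto)
  finally show ?case by simp
next
  case (Suc j)
  have "sw 0 (lcup (Suc (Suc j)) (lcup i y)) = sw 0 (sw (Suc (Suc j)) (lcup (Suc j) (lcup i y)))" by simp
  also have "\<dots> \<approx> sw (Suc (Suc j)) (sw 0 (lcup (Suc j) (lcup i y)))"
    by (rule sw_far) (use Suc.prems in auto)
  also have "\<dots> \<approx> sw (Suc (Suc j)) (lcup (Suc (Suc i)) (lcup j y))"
    by (intro act_cong Suc.IH) (use Suc.prems in auto)
  also have "\<dots> \<approx> lcup (Suc (Suc i)) (sw (Suc j) (lcup j y))"
    by (rule sw_lcup_below) (use Suc.prems in auto)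
  finally show ?case by simp
qed

lemma sw_0_lcup_lcup': assumes "i < j" "j \<le> Suc (tgt y)"
  shows "sw 0 (lcup (Suc j) (lcup i y)) \<approx> lcup (Suc i) (lcup (j - 1) y)"
proof -
  obtain J where J: "j = Suc J" using assms by (cases j) auto
  have "sw 0 (lcup (Suc j) (lcup i y)) \<approx> sw 0 (sw 0 (lcup (Suc i) (lcup J y)))" unfolding J
    by (intro act_cong eqv_sym[OF sw_0_lcup_lcup]) (use assms J in auto)
  also have "\<dots> \<approx> lcup (Suc i) (lcup J y)" by (rule sw_sw) (use assms J in auto)
  finally show ?thesis using J by simp
qed

section \<open>Codes of standard morphisms and their closure under the generators\<close>

fun cups :: "nat list \<Rightarrow> mor" where
  "cups [] = Idn 0"
| "cups (j # js) = lcup j (cups js)"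

fun codes :: "nat \<Rightarrow> nat list set" where
  "codes 0 = {[]}"
| "codes (Suc m) = {j # js | j js. j \<le> 2 * m \<and> js \<in> codes m}"

lemma cups_type[simp]: "js \<in> codes m \<Longrightarrow> tgt (cups js) = 2 * m" 
  "src (cups js) = 0"
   by (induction m arbitrary: js; auto)
     (induction js; auto)

lemma cups_wt: "js \<in> codes m \<Longrightarrow> wt (cups js)"
  by (induction m arbitrary: js) auto

text \<open>The cup inserted last has its legs at \<open>0\<close> and \<open>j + 1\<close>, and the
  cases are the positions of the crossing relative to them. A crossing of both legs is absorbed, one
  at the right leg shortens or lengthens the path of that leg, and one away from both legs passes to
  the remaining cups. At \<open>0\<close> with \<open>j > 0\<close>, the neighbouring strand is
  always the left leg of the next cup, so two cups are exchanged.\<close>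

lemma sw_cups: "js \<in> codes m \<Longrightarrow> k + 2 \<le> 2 * m \<Longrightarrow> \<exists>js'\<in>codes m. sw k (cups js) \<approx> cups js'"
proof (induction m arbitrary: k js)
  case (Suc m)
  from Suc.prems obtain j us where js: "js = j # us" "j \<le> 2 * m" "us \<in> codes m" by auto
  let ?x = "cups us"
  have tx: "tgt ?x = 2 * m" using js by simp
  consider "k = 0" "j = 0" | j' where "k = 0" "j = Suc j'" | "k = j" "k \<noteq> 0" | "k = Suc j" 
    | k' j' where "k = Suc k'" "j = Suc j'" "k' < j'" | i where "k = Suc (Suc i)" "j \<le> i"
  proof (cases k)
    case 0
    then show ?thesis using that(1,2) by (cases j) auto
  next
    case (Suc k')
    consider "k < j" | "k = j" | "k = Suc j" | "Suc j < k" by linarith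
    then show ?thesis
    proof cases
      case 1
      then obtain j' where "j = Suc j'" by (cases j) auto
      then show ?thesis using 1 Suc that(5) by auto
    next
      case 4
      then obtain i where "k = Suc (Suc i)" using Suc by (cases k') auto
      then show ?thesis using 4 that(6) by auto
    qed (use that(3,4) Suc in auto)
  qed
  then show ?case
  proof cases
    case 1
    then have "sw k (cups js) \<approx> cups js" using js by (simp add: sw_cu)
    then show ?thesis using Suc.prems by blast
  next
    case 2
    obtain m' where m: "m = Suc m'" using 2 js by (cases m) auto
    obtain i ls where il: "us = i # ls" "i \<le> 2 * m'" "ls \<in> codes m'" using js m by auto
    have t: "tgt (cups ls) = 2 * m'" using il by simp
    have e: "cups js = lcup (Suc j') (lcup i (cups ls))" "j' \<le> Suc (tgt (cups ls))"
      using js il m t 2 by simp_all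
    show ?thesis
    proof (cases "j' \<le> i")
      case True
      have "sw k (cups js) \<approx> cups (Suc (Suc i) # j' # ls)"
        unfolding e(1) 2(1) cups.simps by (rule sw_0_lcup_lcup[OF True]) (use il t in simp)
      moreover have "Suc (Suc i) # j' # ls \<in> codes (Suc m)"
        unfolding m using il True by simp
      ultimately show ?thesis by blast
    next
      case False
      have "sw k (cups js) \<approx> cups (Suc i # (j' - 1) # ls)"
        unfolding e(1) 2(1) cups.simps by (rule sw_0_lcup_lcup') (use False e in simp_all)
      moreover have "Suc i # (j' - 1) # ls \<in> codes (Suc m)"
        using il False 2(2) js(2) unfolding m by simp
      ultimately show ?thesis by blast
    qed
  next
    case 3
    obtain j' where j': "j = Suc j'" using 3 by (metis not0_implies_Suc)
    have "sw k (cups js) = sw (Suc j') (sw (Suc j') (lcup j' ?x))" using 3 js j' by simp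
    also have "\<dots> \<approx> cups (j' # us)" unfolding cups.simps
      by (rule sw_sw) (use js tx j' in simp)
    finally have "sw k (cups js) \<approx> cups (j' # us)" .
    moreover have "j' # us \<in> codes (Suc m)" using js j' by simp
    ultimately show ?thesis by blast
  next
    case 4
    have "sw k (cups js) = cups (Suc j # us)" using 4 js by simp
    moreover have "Suc j # us \<in> codes (Suc m)" using js 4 Suc.prems by simp
    ultimately show ?thesis by (metis eqv_refl(1))
  next
    case 5
    have "sw k (cups js) \<approx> lcup j (sw k' ?x)" using sw_lcup_below[of k' j' ?x] 5 js tx by simp
    moreover obtain js' where "js' \<in> codes m" "sw k' ?x \<approx> cups js'"
      using Suc.IH[OF js(3), of k'] 5 js by auto
    ultimately have "sw k (cups js) \<approx> cups (j # js')" "j # js' \<in> codes (Suc m)"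
      using js eqv_trans[OF _ lcup_cong] by auto
    then show ?thesis by blast
  next
    case 6
    have "sw k (cups js) \<approx> lcup j (sw i ?x)" using sw_lcup_above[of j i ?x] 6 js tx Suc.prems by simp
    moreover obtain js' where "js' \<in> codes m" "sw i ?x \<approx> cups js'"
      using Suc.IH[OF js(3), of i] 6 js Suc.prems by auto
    ultimately have "sw k (cups js) \<approx> cups (j # js')" "j # js' \<in> codes (Suc m)"
      using js eqv_trans[OF _ lcup_cong] by auto
    then show ?thesis by blast
  qed
qed simp

lemma cu_cups: "js \<in> codes m \<Longrightarrow> k \<le> 2 * m \<Longrightarrow> \<exists>js'\<in>codes (Suc m). cu k (cups js) \<approx> cups js'"
proof (induction k)
  case 0
  then have "cu 0 (cups js) = cups (0 # js)" "0 # js \<in> codes (Suc m)" by auto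
  then show ?case by (metis eqv_refl(1))
next
  case (Suc k)
  then obtain j1 where j1: "j1 \<in> codes (Suc m)" "cu k (cups js) \<approx> cups j1" by auto
  obtain j2 where j2: "j2 \<in> codes (Suc m)" "sw (Suc k) (cups j1) \<approx> cups j2"
    using sw_cups[OF j1(1), of "Suc k"] Suc.prems by auto
  obtain j3 where j3: "j3 \<in> codes (Suc m)" "sw k (cups j2) \<approx> cups j3"
    using sw_cups[OF j2(1), of "k"] Suc.prems by auto
  have "cu (Suc k) (cups js) \<approx> sw k (sw (Suc k) (cu k (cups js)))"
    by (rule cu_Suc) (use Suc.prems in auto)
  also have "\<dots> \<approx> sw k (sw (Suc k) (cups j1))" by (intro act_cong j1)
  also have "\<dots> \<approx> sw k (cups j2)" by (intro act_cong j2)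
  also have "\<dots> \<approx> cups j3" by (rule j3)
  finally show ?case using j3 by blast
qed

text \<open>The cap joins the left leg to the first strand passed by the right leg. If this is the
  only one, a zigzag with a crossing results and straightens; otherwise the last crossing lies clear
  of the cap and slides past it.\<close>

lemma ca_0_lcup: assumes "Suc j \<le> tgt x" "2 \<le> tgt x"
  shows "ca 0 (lcup (Suc j) x) \<approx> x \<or> (\<exists>i. Suc (Suc i) \<le> tgt x \<and> j = Suc i \<and> ca 0 (lcup (Suc j) x) \<approx> sw i (ca 0 (lcup j x)))"
proof (cases j)
  case 0
  have "ca 0 (lcup (Suc 0) x) = ca 0 (sw (Suc 0) (cu 0 x))" by simp
  also have "\<dots> \<approx> ca 0 (sw 0 (cu (Suc 0) x))"
    by (intro act_cong sw_cu_slide) (use assms in auto)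
  also have "\<dots> \<approx> ca 0 (cu (Suc 0) x)" by (rule ca_sw) (use assms in auto)
  also have "\<dots> \<approx> x" by (rule ca_cu_right) (use assms in auto)
  finally show ?thesis using 0 by simp
next
  case (Suc i)
  have "ca 0 (lcup (Suc j) x) \<approx> sw i (ca 0 (lcup j x))"
    using ca_sw_above[of 0 i "lcup j x"] assms Suc by simp
  then show ?thesis using Suc assms by auto
qed

lemma ca_0_lcup_cups: "js \<in> codes m \<Longrightarrow> j \<le> 2 * m \<Longrightarrow> \<exists>js'\<in>codes m. ca 0 (lcup j (cups js)) \<leadsto> cups js'"
proof (induction j)
  case 0
  let ?x = "cups js"
  have "ca 0 (lcup 0 ?x) \<approx> act 0 (Comp bB bBs) ?x"
    by (simp, rule eqv_sym, rule act_comp) auto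
  \<comment> \<open>Cap and cup have closed up to a loop. This is the one place that forces
    \<open>\<leadsto>\<close> instead of \<open>\<approx>\<close>.\<close>
  also have "\<dots> \<leadsto> act 0 (Idn 0) ?x"
    unfolding act_def wh_def by (simp add: red_compR red_tensL red_tensR red_loop)
  also have "\<dots> \<approx> ?x" by (rule act_id) simp
  finally show ?case using 0 by blast
next
  case (Suc j)
  then obtain js1 where js1: "js1 \<in> codes m" "ca 0 (lcup j (cups js)) \<leadsto> cups js1" by auto
  have t: "tgt (cups js) = 2 * m" using Suc.prems by simp
  consider "ca 0 (lcup (Suc j) (cups js)) \<approx> cups js" | 
     i where "Suc (Suc i) \<le> 2 * m" "ca 0 (lcup (Suc j) (cups js)) \<approx> sw i (ca 0 (lcup j (cups js)))"
    using ca_0_lcup[of j "cups js"] Suc.prems t by (cases m) auto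
  then show ?case
  proof cases
    case 1 then show ?thesis using Suc.prems eqv_reds by blast
  next
    case 2
    obtain js2 where js2: "js2 \<in> codes m" "sw i (cups js1) \<approx> cups js2"
      using sw_cups[OF js1(1), of i] 2 by auto
    have "ca 0 (lcup (Suc j) (cups js)) \<leadsto> sw i (ca 0 (lcup j (cups js)))" using 2 eqv_reds by blast
    also have "\<dots> \<leadsto> sw i (cups js1)" by (intro act_cong js1)
    also have "\<dots> \<approx> cups js2" by (rule js2)
    finally show ?thesis using js2 by blast
  qed
qed

lemma ca_cups: "js \<in> codes (Suc m) \<Longrightarrow> k \<le> 2 * m \<Longrightarrow> \<exists>js'\<in>codes m. ca k (cups js) \<leadsto> cups js'"
proof (induction k arbitrary: js)
  case 0
  then show ?case using ca_0_lcup_cups by force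
next
  case (Suc k)
  obtain j1 where j1: "j1 \<in> codes (Suc m)" "sw k (cups js) \<approx> cups j1"
    using sw_cups[OF Suc.prems(1), of k] Suc.prems by auto
  obtain j2 where j2: "j2 \<in> codes (Suc m)" "sw (Suc k) (cups j1) \<approx> cups j2"
    using sw_cups[OF j1(1), of "Suc k"] Suc.prems by auto
  obtain j3 where j3: "j3 \<in> codes m" "ca k (cups j2) \<leadsto> cups j3"
    using Suc.IH[OF j2(1)] Suc.prems by auto
  have "ca (Suc k) (cups js) \<approx> ca k (sw (Suc k) (sw k (cups js)))"
    by (rule ca_Suc) (use Suc.prems cups_type(1)[OF Suc.prems(1)] in auto)
  also have "\<dots> \<approx> ca k (sw (Suc k) (cups j1))" by (intro act_cong j1)
  also have "\<dots> \<approx> ca k (cups j2)" by (intro act_cong j2)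
  also have "\<dots> \<leadsto> cups j3" by (rule j3)
  finally show ?case using j3 by blast
qed

text \<open>The induction runs over raw terms, so no morphism has to be brought into layered form
  first. Strands are counted by an equation of sums because subtraction would truncate.\<close>

lemma act_cups: "wt f \<Longrightarrow> js \<in> codes m \<Longrightarrow> k + src f \<le> 2 * m \<Longrightarrow>
   \<exists>m' js'. js' \<in> codes m' \<and> 2 * m' + src f = 2 * m + tgt f \<and> act k f (cups js) \<leadsto> cups js'"
proof (induction f arbitrary: k m js)
  case (Gen g)
  show ?case
  proof (cases g)
    case GS
    then show ?thesis using sw_cups[OF Gen.prems(2), of k] Gen.prems eqv_reds by fastforce
  next
    case GB
    then obtain m' where "m = Suc m'" using Gen.prems by (cases m) auto
    then show ?thesis using ca_cups[of js m' k] Gen.prems GB by fastforce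
  next
    case GBs
    then show ?thesis using cu_cups[OF Gen.prems(2), of k] Gen.prems eqv_reds by fastforce
  qed
next
  case (Idn n)
  then show ?case using act_id[of k n "cups js"] eqv_reds by fastforce
next
  case (Comp f g)
  obtain m1 j1 where 1: "j1 \<in> codes m1" "2 * m1 + src g = 2 * m + tgt g" "act k g (cups js) \<leadsto> cups j1"
    using Comp.IH(2)[of js m k] Comp.prems by auto
  obtain m2 j2 where 2: "j2 \<in> codes m2" "2 * m2 + src f = 2 * m1 + tgt f" "act k f (cups j1) \<leadsto> cups j2"
    using Comp.IH(1)[of j1 m1 k] Comp.prems 1 by auto
  have "act k (Comp f g) (cups js) \<approx> act k f (act k g (cups js))"
    by (rule act_comp) (use Comp.prems in auto)
  also have "\<dots> \<leadsto> act k f (cups j1)" by (intro act_cong 1)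
  also have "\<dots> \<leadsto> cups j2" by (rule 2)
  finally have "act k (Comp f g) (cups js) \<leadsto> cups j2" .
  moreover have "2 * m2 + src (Comp f g) = 2 * m + tgt (Comp f g)" using 1 2 Comp.prems by simp
  ultimately show ?case using 2 by blast
next
  case (Tens f g)
  obtain m1 j1 where 1: "j1 \<in> codes m1" "2 * m1 + src g = 2 * m + tgt g" "act (k + src f) g (cups js) \<leadsto> cups j1"
    using Tens.IH(2)[of js m "k + src f"] Tens.prems by auto
  obtain m2 j2 where 2: "j2 \<in> codes m2" "2 * m2 + src f = 2 * m1 + tgt f" "act k f (cups j1) \<leadsto> cups j2"
    using Tens.IH(1)[of j1 m1 k] Tens.prems 1 by auto
  have "act k (Tens f g) (cups js) \<approx> act k f (act (k + src f) g (cups js))"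
    by (rule act_tens1) (use Tens.prems in auto)
  also have "\<dots> \<leadsto> act k f (cups j1)" by (intro act_cong 1)
  also have "\<dots> \<leadsto> cups j2" by (rule 2)
  finally have "act k (Tens f g) (cups js) \<leadsto> cups j2" .
  moreover have "2 * m2 + src (Tens f g) = 2 * m + tgt (Tens f g)" using 1 2 Tens.prems by simp
  ultimately show ?case using 2 by blast
qed

section \<open>Bending inputs into outputs\<close>

definition unbend :: "mor \<Rightarrow> mor" where
  "unbend x = Comp (Tens bB (Idn (tgt x - 1))) (Tens one x)"

lemma unbend_cong: "red l x y \<Longrightarrow> red l (unbend x) (unbend y)"
  unfolding unbend_def by (metis red_compL red_tensL red_type)

fun std :: "nat \<Rightarrow> nat list \<Rightarrow> mor" where
  "std 0 js = cups js"
| "std (Suc a) js = unbend (std a js)"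

lemma unbend_type: "src (unbend x) = Suc (src x)" "tgt (unbend x) = tgt x - 1"
  "tgt x > 0 \<Longrightarrow> wt (unbend x) = wt x"
  by (auto simp: unbend_def)

lemma std_type: "js \<in> codes m \<Longrightarrow> a + b = 2 * m \<Longrightarrow> src (std a js) = a \<and> tgt (std a js) = b \<and> wt (std a js)"
proof (induction a arbitrary: b)
  case (Suc a)
  have "src (std a js) = a \<and> tgt (std a js) = Suc b \<and> wt (std a js)"
    by (rule Suc.IH) (use Suc.prems in auto)
  then show ?case by (simp add: unbend_type)
qed (simp add: cups_wt)

text \<open>Induction on the number of inputs. In the step, \<open>h\<close> is \<open>f\<close>
  with its first input bent up to a first output, and the zigzag in (R2) shows that
  \<open>unbend h\<close> gives \<open>f\<close> back. Without inputs, \<open>f\<close> acts on the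
  empty composite \<open>cups []\<close>.\<close>

lemma red_std: "wt f \<Longrightarrow> src f = a \<Longrightarrow> \<exists>m js. js \<in> codes m \<and> 2 * m = a + tgt f \<and> f \<leadsto> std a js"
proof (induction a arbitrary: f)
  case 0
  have "wh 0 f 0 \<approx> Tens f (Idn 0)" unfolding wh_def by (rule red_fwd, rule b_tunitl)
  also have "\<dots> \<approx> f" by (rule red_fwd, rule b_tunitr)
  finally have "Comp (wh 0 f 0) (Idn 0) \<approx> Comp f (Idn 0)" by (rule red_compR)
  also have "\<dots> \<approx> f" by (rule eqv_idr) (use 0 in simp)
  finally have 1: "f \<approx> act 0 f (cups [])" using eqv_sym 0 by (simp add: act_def)
  obtain m' js where "js \<in> codes m'" "2 * m' + src f = 2 * 0 + tgt f" "act 0 f (cups []) \<leadsto> cups js"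
    using act_cups[of f "[]" 0 0] 0 by auto
  then show ?case using 0 1 eqv_reds_trans(1)[OF 1] by auto
next
  case (Suc a)
  define h where "h = Comp (Tens one f) (Tens bBs (Idn a))"
  have h: "wt h" "src h = a" "tgt h = Suc (tgt f)" using Suc.prems by (auto simp: h_def)
  obtain m js where mjs: "js \<in> codes m" "2 * m = a + tgt h" "h \<leadsto> std a js" using Suc.IH[OF h(1,2)] by auto
  let ?I = "Idn (Suc a)"
  have "unbend h = Comp (Tens bB (Idn (tgt f))) (Tens one h)" by (simp add: unbend_def h)
  also have "\<dots> \<approx> Comp (Tens bB (Idn (tgt f))) (Comp (Tens one (Tens one f)) (Tens one (Tens bBs (Idn a))))"
  proof (rule red_compL)
    have "Comp (Tens one (Tens one f)) (Tens one (Tens bBs (Idn a))) \<approx> Tens (Comp one one) h"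
      unfolding h_def by (rule eqv_inter) (use Suc.prems in auto)
    also have "\<dots> \<approx> Tens one h" by (intro red_tensR eqv_idl) simp
    finally show "Tens one h \<approx> Comp (Tens one (Tens one f)) (Tens one (Tens bBs (Idn a)))" by (rule eqv_sym)
  qed
  also have "\<dots> \<approx> Comp (Comp (Tens bB (Idn (tgt f))) (Tens one (Tens one f))) (Tens one (Tens bBs (Idn a)))"
    by (rule eqv_sym, rule eqv_assoc)
  \<comment> \<open>The cap and \<open>f\<close> occupy disjoint strands, so the cap can be moved
    below \<open>f\<close>, where it meets the cup.\<close>
  also have "\<dots> \<approx> Comp (Comp f (Tens bB ?I)) (Tens one (Tens bBs (Idn a)))"
  proof (rule red_compR)
    have "Comp (Tens bB (Idn (tgt f))) (Tens one (Tens one f)) \<approx> Comp (Tens bB (Idn (tgt f))) (Tens (Idn 2) f)"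
      using eqv_trans[OF eqv_sym[OF eqv_tassoc] red_tensR[OF eqv_tid]] 
      by (metis nat_1_add_1 red_compL)
    also have "\<dots> \<approx> Comp (Tens bB (Idn (tgt f))) (Tens (Idn (src bB)) f)" by simp
    also have "\<dots> \<approx> Tens bB f" by (rule eqv_sym, rule tens_split1)
    also have "\<dots> \<approx> Comp (Tens (Idn (tgt bB)) f) (Tens bB (Idn (src f)))" by (rule tens_split2)
    also have "\<dots> \<approx> Comp f (Tens bB (Idn (src f)))" by (simp add: red_compR red_fwd b_tunitl)
    finally show "Comp (Tens bB (Idn (tgt f))) (Tens one (Tens one f)) \<approx> Comp f (Tens bB ?I)"
      using Suc.prems by simp
  qed
  also have "\<dots> \<approx> Comp f (Comp (Tens bB ?I) (Tens one (Tens bBs (Idn a))))" by (rule eqv_assoc)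
  also have "\<dots> \<approx> Comp f (Tens (Comp (Tens bB one) (Tens one bBs)) (Idn a))"
  proof (rule red_compL)
    have "Comp (Tens bB ?I) (Tens one (Tens bBs (Idn a))) \<approx> Comp (Tens bB (Tens one (Idn a))) (Tens (Tens one bBs) (Idn a))"
      by (intro eqv_comp eqv_tens eqv_refl eqv_sym[OF eqv_tassoc]) (use eqv_sym[OF eqv_tid[of 1 a]] in simp)
    also have "\<dots> \<approx> Comp (Tens (Tens bB one) (Idn a)) (Tens (Tens one bBs) (Idn a))"
      by (intro red_compR eqv_sym[OF eqv_tassoc])
    also have "\<dots> \<approx> Tens (Comp (Tens bB one) (Tens one bBs)) (Comp (Idn a) (Idn a))"
      by (rule eqv_inter) auto
    also have "\<dots> \<approx> Tens (Comp (Tens bB one) (Tens one bBs)) (Idn a)"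
      by (intro red_tensL eqv_idl) simp
    finally show "Comp (Tens bB ?I) (Tens one (Tens bBs (Idn a))) \<approx> Tens (Comp (Tens bB one) (Tens one bBs)) (Idn a)" .
  qed
  also have "\<dots> \<approx> Comp f (Tens one (Idn a))"
    by (intro red_compL red_tensR red_fwd b_R2a)
  also have "\<dots> \<approx> Comp f ?I" using eqv_tid[of 1 a] by (simp add: red_compL)
  also have "\<dots> \<approx> f" by (rule eqv_idr) (use Suc.prems in simp)
  finally have "f \<approx> unbend h" by (rule eqv_sym)
  also have "\<dots> \<leadsto> unbend (std a js)" by (rule unbend_cong, rule mjs)
  finally show ?case using mjs h Suc.prems by auto
qed


lemma card_codes: "finite (codes m) \<and> card (codes m) = dfact (2 * m - 1)"
proof (induction m)
  case (Suc m)
  have eq: "codes (Suc m) = (\<lambda>(j, js). j # js) ` ({..2 * m} \<times> codes m)" by auto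
  have "inj_on (\<lambda>(j, js). j # js) ({..2 * m} \<times> codes m)" by (auto simp: inj_on_def)
  then have "card (codes (Suc m)) = Suc (2 * m) * dfact (2 * m - 1)"
    unfolding eq by (subst card_image) (auto simp: card_cartesian_product Suc)
  \<comment> \<open>The case \<open>m = 0\<close> is separate because \<open>2 * m - 1\<close>
    truncates to \<open>0\<close> there.\<close>
  also have "\<dots> = dfact (2 * Suc m - 1)" by (cases m) auto
  finally show ?case using Suc eq by simp
qed simp

section \<open>The representation on superspaces\<close>

text \<open>A letter \<open>(p, i)\<close> is the basis vector \<open>i\<close> of parity \<open>p\<close>; the odd form pairs \<open>(p, i)\<close> with \<open>(\<not> p, i)\<close>.\<close>

type_synonym letter = "bool \<times> nat"
type_synonym word = "letter list"

definition flip :: "letter \<Rightarrow> letter" where "flip x = (\<not> fst x, snd x)"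

lemma flip_simps[simp]: "fst (flip x) = (\<not> fst x)" "snd (flip x) = snd x" "flip (flip x) = x"
  by (auto simp: flip_def)

lemma flip_eq: "flip x = y \<longleftrightarrow> x = flip y" by auto

definition letters :: "nat \<Rightarrow> letter set" where "letters N = UNIV \<times> {..<N}"

lemma letters_iff: "x \<in> letters N \<longleftrightarrow> snd x < N" by (cases x) (auto simp: letters_def)
lemma finite_letters[simp]: "finite (letters N)" by (simp add: letters_def)
lemma flip_letters[simp]: "flip x \<in> letters N \<longleftrightarrow> x \<in> letters N" by (simp add: letters_iff)

definition words :: "nat \<Rightarrow> nat \<Rightarrow> word set" where
  "words N n = {w. set w \<subseteq> letters N \<and> length w = n}"

lemma finite_words[simp]: "finite (words N n)"
  unfolding words_def by (rule finite_lists_length_eq) simp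

lemma words_append: "length v = m \<Longrightarrow> v @ w \<in> words N (m + n) \<longleftrightarrow> v \<in> words N m \<and> w \<in> words N n"
  by (auto simp: words_def)

lemma words_splitE:
  assumes "w \<in> words N (m + n)"
  obtains u v where "w = u @ v" "u \<in> words N m" "v \<in> words N n" "length u = m" "length v = n"
proof
  show "w = take m w @ drop m w" by simp
  show "take m w \<in> words N m" "drop m w \<in> words N n" "length (take m w) = m" "length (drop m w) = n"
    using assms by (auto simp: words_def dest: in_set_takeD in_set_dropD)
qed

lemma words_split: "w \<in> words N (m + n) \<Longrightarrow>
  \<exists>u v. w = u @ v \<and> u \<in> words N m \<and> v \<in> words N n \<and> length u = m \<and> length v = n"
  by (erule words_splitE) blast

lemma words_0[simp]: "w \<in> words N 0 \<longleftrightarrow> w = []" by (auto simp: words_def)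
lemma words_Suc: "w \<in> words N (Suc n) \<longleftrightarrow> (\<exists>x v. w = x # v \<and> x \<in> letters N \<and> v \<in> words N n)"
  by (cases w) (auto simp: words_def)
lemma words_2: "w \<in> words N 2 \<longleftrightarrow> (\<exists>x y. w = [x, y] \<and> x \<in> letters N \<and> y \<in> letters N)"
  by (auto simp: words_Suc eval_nat_numeral)

lemma sum_words_append:
  "(\<Sum>w\<in>words N (m + n). h w) = (\<Sum>u\<in>words N m. \<Sum>v\<in>words N n. h (u @ v) :: complex)"
proof -
  have "(\<Sum>u\<in>words N m. \<Sum>v\<in>words N n. h (u @ v)) = (\<Sum>(u, v)\<in>words N m \<times> words N n. h (u @ v))"
    by (rule sum.cartesian_product)
  also have "\<dots> = (\<Sum>w\<in>words N (m + n). h w)"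
    by (rule sum.reindex_bij_witness[where i = "\<lambda>w. (take m w, drop m w)" and j = "\<lambda>(u, v). u @ v"])
      (auto simp: words_def dest: in_set_takeD in_set_dropD)
  finally show ?thesis by simp
qed

section \<open>Signs and matrices\<close>

definition wpar :: "word \<Rightarrow> nat" where "wpar w = length (filter fst w)"

lemma wpar_simps[simp]: "wpar [] = 0" "wpar (x # w) = (if fst x then Suc (wpar w) else wpar w)"
  "wpar (u @ v) = wpar u + wpar v"
  by (auto simp: wpar_def)

text \<open>The Koszul sign of exchanging two letters.\<close>

definition sg :: "letter \<Rightarrow> letter \<Rightarrow> complex" where "sg x y = (if fst x \<and> fst y then -1 else 1)"

lemma sg_sq[simp]: "sg x y * sg y x = 1" by (auto simp: sg_def)
lemma sg_comm: "sg x y = sg y x" by (auto simp: sg_def)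

text \<open>The super flip, the odd form and its copairing; the first word is the input. The form
  takes the value \<open>1\<close> on both orders of a pair \<open>x\<close>, \<open>flip x\<close>,
  whereas the copairing changes sign with the order, as (R2) and \<open>s b* = - b*\<close>
  demand.\<close>

fun gmat :: "nat \<Rightarrow> gen \<Rightarrow> word \<Rightarrow> word \<Rightarrow> complex" where
  "gmat N GS [x, y] [x', y'] = (if x \<in> letters N \<and> y \<in> letters N \<and> x' = y \<and> y' = x then sg x y else 0)"
| "gmat N GB [x, y] [] = (if x \<in> letters N \<and> y = flip x then 1 else 0)"
| "gmat N GBs [] [x, y] = (if x \<in> letters N \<and> y = flip x then if fst x then -1 else 1 else 0)"
| "gmat N _ _ _ = 0"

text \<open>The sign in the tensor product is the Koszul sign of \<open>g\<close> moving past the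
  input of \<open>f\<close>, as in \<open>(f \<otimes> g)(u \<otimes> v) = (-1)^(|g||u|) f(u)
  \<otimes> g(v)\<close>.\<close>

fun mat :: "nat \<Rightarrow> mor \<Rightarrow> word \<Rightarrow> word \<Rightarrow> complex" where
  "mat N (Gen g) w w' = gmat N g w w'"
| "mat N (Idn n) w w' = (if w = w' \<and> w \<in> words N n then 1 else 0)"
| "mat N (Comp f g) w w' = (\<Sum>v\<in>words N (tgt g). mat N g w v * mat N f v w')"
| "mat N (Tens f g) w w' = (-1) ^ (par g * wpar (take (src f) w))
     * mat N f (take (src f) w) (take (tgt f) w') * mat N g (drop (src f) w) (drop (tgt f) w')"

lemma gmat_words: "gmat N g w w' \<noteq> 0 \<Longrightarrow> w \<in> words N (gsrc g) \<and> w' \<in> words N (gtgt g)"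
  by (induction N g w w' rule: gmat.induct) (auto simp: words_def split: if_splits)

lemma mat_words: "mat N f w w' \<noteq> 0 \<Longrightarrow> w \<in> words N (src f) \<and> w' \<in> words N (tgt f)"
proof (induction f arbitrary: w w')
  case (Gen g)
  then show ?case using gmat_words by simp
next
  case (Comp f g)
  then obtain v where "mat N g w v \<noteq> 0" "mat N f v w' \<noteq> 0"
    by (metis (no_types, lifting) mat.simps(3) mult_not_zero sum.neutral)
  then show ?case using Comp.IH by auto
next
  case (Tens f g)
  then have "take (src f) w \<in> words N (src f) \<and> take (tgt f) w' \<in> words N (tgt f)"
    "drop (src f) w \<in> words N (src g) \<and> drop (tgt f) w' \<in> words N (tgt g)"
    by auto
  then show ?case 
    using words_append[of "take (src f) w" "src f" "drop (src f) w" N "src g"]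
      words_append[of "take (tgt f) w'" "tgt f" "drop (tgt f) w'" N "tgt g"]
    by (auto simp: words_def)
qed (auto split: if_splits)

lemma gmat_par: "gmat N g w w' \<noteq> 0 \<Longrightarrow> even (wpar w + wpar w' + gpar g)"
  by (induction N g w w' rule: gmat.induct) (auto split: if_splits)

text \<open>Homogeneity of the matrices. It allows a sign that depends on an intermediate word to be
  expressed by the input, as super interchange requires, and a sign that depends on a term to be
  expressed by the boundary words.\<close>

lemma mat_par: "mat N f w w' \<noteq> 0 \<Longrightarrow> even (wpar w + wpar w' + par f)"
proof (induction f arbitrary: w w')
  case (Gen g)
  then show ?case using gmat_par by simp
next
  case (Comp f g)
  then obtain v where "mat N g w v \<noteq> 0" "mat N f v w' \<noteq> 0"
    by (metis (no_types, lifting) mat.simps(3) mult_not_zero sum.neutral)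
  then have "even (wpar w + wpar v + par g)" "even (wpar v + wpar w' + par f)" using Comp.IH by blast+
  then show ?case by simp presburger
next
  case (Tens f g)
  have "even (wpar (take (src f) w) + wpar (take (tgt f) w') + par f)"
    "even (wpar (drop (src f) w) + wpar (drop (tgt f) w') + par g)"
    using Tens by auto
  moreover have "wpar w = wpar (take (src f) w) + wpar (drop (src f) w)"
    "wpar w' = wpar (take (tgt f) w') + wpar (drop (tgt f) w')"
    by (metis append_take_drop_id wpar_simps(3))+
  ultimately show ?case by simp presburger
qed (auto split: if_splits)

lemma mat_tens: "length u = src f \<Longrightarrow> length u' = tgt f \<Longrightarrow>
   mat N (Tens f g) (u @ v) (u' @ v') = (-1) ^ (par g * wpar u) * mat N f u u' * mat N g v v'"
  by simp

text \<open>Entries vanish outside the words of the right lengths and letters, so there is nothing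
  to compare elsewhere.\<close>

lemma mat_eqI:
  assumes "src f = src g" "tgt f = tgt g"
    "\<And>w w'. w \<in> words N (src g) \<Longrightarrow> w' \<in> words N (tgt g) \<Longrightarrow> mat N f w w' = c * mat N g w w'"
  shows "mat N f w w' = c * mat N g w w'"
  using assms mat_words[of N f w w'] mat_words[of N g w w'] by fastforce

lemma sum_eq_single:
  assumes "finite B" "\<And>v. v \<in> B \<Longrightarrow> v \<noteq> a \<Longrightarrow> h v = 0" "a \<notin> B \<Longrightarrow> h a = (0::complex)"
  shows "sum h B = h a"
proof (cases "a \<in> B")
  case True
  have "sum h B = sum h {a}" by (rule sum.mono_neutral_right) (use assms True in auto)
  then show ?thesis by simp
next
  case False
  then show ?thesis using assms by (metis sum.neutral)
qed

lemma minus1_cong: "even (a + b) \<Longrightarrow> (-1 :: complex) ^ a = (-1) ^ b"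
  by (metis even_add minus_one_power_iff)

lemma mat_interchange:
  assumes "tgt h = src f" "tgt k = src g"
  shows "mat N (Comp (Tens f g) (Tens h k)) w w' = (-1) ^ (par g * par h) * mat N (Tens (Comp f h) (Comp g k)) w w'"
proof (rule mat_eqI)
  fix w w' assume w: "w \<in> words N (src (Tens (Comp f h) (Comp g k)))" and w': "w' \<in> words N (tgt (Tens (Comp f h) (Comp g k)))"
  have "w \<in> words N (src h + src k)" using w by simp
  then obtain w1 w2 where w12: "w = w1 @ w2" "length w1 = src h" "length w2 = src k"
    by (rule words_splitE)
  have "w' \<in> words N (tgt f + tgt g)" using w' by simp
  then obtain w1' w2' where w12': "w' = w1' @ w2'" "length w1' = tgt f" "length w2' = tgt g"
    by (rule words_splitE)
  let ?s = "(-1 :: complex) ^ (par g * par h) * (-1) ^ (((par g + par k) mod 2) * wpar w1)"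
  have "mat N (Comp (Tens f g) (Tens h k)) w w' =
    (\<Sum>u\<in>words N (tgt h). \<Sum>v\<in>words N (tgt k). mat N (Tens h k) (w1 @ w2) (u @ v) * mat N (Tens f g) (u @ v) (w1' @ w2'))"
    by (simp only: mat.simps(3) tgt.simps sum_words_append w12 w12')
  also have "\<dots> = (\<Sum>u\<in>words N (tgt h). \<Sum>v\<in>words N (tgt k).
     ?s * ((mat N h w1 u * mat N f u w1') * (mat N k w2 v * mat N g v w2')))"
  proof (intro sum.cong refl)
    fix u v assume "u \<in> words N (tgt h)" "v \<in> words N (tgt k)"
    then have l: "length u = tgt h" "length v = tgt k" by (auto simp: words_def)
    show "mat N (Tens h k) (w1 @ w2) (u @ v) * mat N (Tens f g) (u @ v) (w1' @ w2') =
      ?s * ((mat N h w1 u * mat N f u w1') * (mat N k w2 v * mat N g v w2'))"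
    proof (cases "mat N h w1 u = 0")
      \<comment> \<open>A nonzero entry of \<open>h\<close> means that \<open>wpar u\<close> and
        \<open>wpar w1 + par h\<close> agree modulo 2. The summand \<open>par h\<close> is the
        source of the sign \<open>(-1) ^ (par g * par h)\<close>.\<close>
      case False
      then have "even (wpar w1 + wpar u + par h)" by (rule mat_par)
      then have "even ((par k * wpar w1 + par g * wpar u) + (par g * par h + ((par g + par k) mod 2) * wpar w1))"
        by (auto simp: algebra_simps) 
      then have "(-1 :: complex) ^ (par k * wpar w1) * (-1) ^ (par g * wpar u) = ?s"
        unfolding power_add[symmetric] by (rule minus1_cong)
      then show ?thesis using l w12 w12' assms by (simp add: mat_tens ac_simps del: mat.simps(4))
    qed (use l w12 w12' assms in \<open>simp add: mat_tens del: mat.simps(4)\<close>)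
  qed
  also have "\<dots> = ?s * ((\<Sum>u\<in>words N (tgt h). mat N h w1 u * mat N f u w1') * (\<Sum>v\<in>words N (tgt k). mat N k w2 v * mat N g v w2'))"
    by (subst sum_product) (simp only: sum_distrib_left)
  also have "\<dots> = (-1) ^ (par g * par h) * mat N (Tens (Comp f h) (Comp g k)) w w'"
    using w12 w12' by (simp add: mult.assoc)
  finally show "mat N (Comp (Tens f g) (Tens h k)) w w' = (-1) ^ (par g * par h) * mat N (Tens (Comp f h) (Comp g k)) w w'" .
qed (use assms in auto)

lemma mat_tens_assoc: "mat N (Tens (Tens f g) h) w w' = mat N (Tens f (Tens g h)) w w'"
proof -
  have "mat N (Tens (Tens f g) h) w w' = 1 * mat N (Tens f (Tens g h)) w w'"
  proof (rule mat_eqI)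
    fix w w' assume w: "w \<in> words N (src (Tens f (Tens g h)))" and w': "w' \<in> words N (tgt (Tens f (Tens g h)))"
    have wa: "w \<in> words N (src f + (src g + src h))" using w by simp
    obtain w1 w23 where 1: "w = w1 @ w23" "length w1 = src f" "w23 \<in> words N (src g + src h)"
      using words_split[OF wa] by blast
    obtain w2 w3 where 2: "w23 = w2 @ w3" "length w2 = src g" "length w3 = src h"
      using words_split[OF 1(3)] by blast
    have wb: "w' \<in> words N (tgt f + (tgt g + tgt h))" using w' by simp
    obtain w1' w23' where q1: "w' = w1' @ w23'" "length w1' = tgt f" "w23' \<in> words N (tgt g + tgt h)"
      using words_split[OF wb] by blast
    obtain w2' w3' where q2: "w23' = w2' @ w3'" "length w2' = tgt g" "length w3' = tgt h"
      using words_split[OF q1(3)] by blast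
    have "even ((par h * (wpar w1 + wpar w2) + par g * wpar w1) + (((par g + par h) mod 2) * wpar w1 + par h * wpar w2))"
      by auto
    then have s: "(-1 :: complex) ^ (par h * (wpar w1 + wpar w2)) * (-1) ^ (par g * wpar w1)
      = (-1) ^ (((par g + par h) mod 2) * wpar w1) * (-1) ^ (par h * wpar w2)"
      unfolding power_add[symmetric] by (rule minus1_cong)
    show "mat N (Tens (Tens f g) h) w w' = 1 * mat N (Tens f (Tens g h)) w w'"
    proof -
      have "mat N (Tens (Tens f g) h) ((w1 @ w2) @ w3) ((w1' @ w2') @ w3') =
         (-1) ^ (par h * wpar (w1 @ w2)) * mat N (Tens f g) (w1 @ w2) (w1' @ w2') * mat N h w3 w3'"
        by (rule mat_tens) (simp_all add: 1 2 q1 q2)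
      also have "mat N (Tens f g) (w1 @ w2) (w1' @ w2') = (-1) ^ (par g * wpar w1) * mat N f w1 w1' * mat N g w2 w2'"
        by (rule mat_tens) (simp_all add: 1 2 q1 q2)
      finally have l: "mat N (Tens (Tens f g) h) w w' = (-1) ^ (par h * wpar (w1 @ w2)) *
          ((-1) ^ (par g * wpar w1) * mat N f w1 w1' * mat N g w2 w2') * mat N h w3 w3'"
        by (simp only: 1(1) 2(1) q1(1) q2(1) append_assoc)
      have "mat N (Tens f (Tens g h)) (w1 @ (w2 @ w3)) (w1' @ (w2' @ w3')) =
         (-1) ^ (par (Tens g h) * wpar w1) * mat N f w1 w1' * mat N (Tens g h) (w2 @ w3) (w2' @ w3')"
        by (rule mat_tens) (simp_all add: 1 2 q1 q2)
      also have "mat N (Tens g h) (w2 @ w3) (w2' @ w3') = (-1) ^ (par h * wpar w2) * mat N g w2 w2' * mat N h w3 w3'"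
        by (rule mat_tens) (simp_all add: 1 2 q1 q2)
      finally have r: "mat N (Tens f (Tens g h)) w w' = (-1) ^ (((par g + par h) mod 2) * wpar w1) * mat N f w1 w1' *
           ((-1) ^ (par h * wpar w2) * mat N g w2 w2' * mat N h w3 w3')"
        by (simp only: 1(1) 2(1) q1(1) q2(1) par.simps)
      have "a * b = c * d \<Longrightarrow> a * (b * F * G) * H = 1 * (c * F * (d * G * H))" for a b c d F G H :: complex
        by algebra
      from this[OF s] show ?thesis unfolding l r wpar_simps .
    qed
  qed auto
  then show ?thesis by simp
qed

lemma mat_tens_unit: "mat N (Tens (Idn 0) f) w w' = mat N f w w'" "mat N (Tens f (Idn 0)) w w' = mat N f w w'"
proof -
  show "mat N (Tens (Idn 0) f) w w' = mat N f w w'" by simp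
  have "mat N (Tens f (Idn 0)) w w' = 1 * mat N f w w'"
    by (rule mat_eqI) (auto simp: words_def)
  then show "mat N (Tens f (Idn 0)) w w' = mat N f w w'" by simp
qed

lemma mat_tens_id: "mat N (Tens (Idn m) (Idn n)) w w' = mat N (Idn (m + n)) w w'"
proof -
  have "mat N (Tens (Idn m) (Idn n)) w w' = 1 * mat N (Idn (m + n)) w w'"
  proof (rule mat_eqI)
    fix w w' assume w: "w \<in> words N (src (Idn (m + n)))" and w': "w' \<in> words N (tgt (Idn (m + n)))"
    have w: "w \<in> words N (m + n)" and w': "w' \<in> words N (m + n)" using w w' by simp_all
    obtain w1 w2 where 1: "w = w1 @ w2" "length w1 = m" "w1 \<in> words N m" "w2 \<in> words N n"
      using words_split[OF w] by blast
    obtain w1' w2' where q1: "w' = w1' @ w2'" "length w1' = m"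
      using words_split[OF w'] by blast
    show "mat N (Tens (Idn m) (Idn n)) w w' = 1 * mat N (Idn (m + n)) w w'"
      using 1 q1 w by auto
  qed auto
  then show ?thesis by simp
qed

lemma mat_comp_id: "mat N (Comp (Idn (tgt f)) f) w w' = mat N f w w'" "mat N (Comp f (Idn (src f))) w w' = mat N f w w'"
proof -
  have "(\<Sum>v\<in>words N (tgt f). mat N f w v * mat N (Idn (tgt f)) v w') = mat N f w w' * mat N (Idn (tgt f)) w' w'"
    by (rule sum_eq_single) auto
  then show "mat N (Comp (Idn (tgt f)) f) w w' = mat N f w w'" using mat_words[of N f w w'] by auto
  have "(\<Sum>v\<in>words N (src f). mat N (Idn (src f)) w v * mat N f v w') = mat N (Idn (src f)) w w * mat N f w w'"
    by (rule sum_eq_single) auto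
  then show "mat N (Comp f (Idn (src f))) w w' = mat N f w w'" using mat_words[of N f w w'] by auto
qed

lemma mat_comp_assoc: 
  "mat N (Comp (Comp f g) h) w w' = mat N (Comp f (Comp g h)) w w'"
proof -
  have "mat N (Comp (Comp f g) h) w w' = (\<Sum>v\<in>words N (tgt h). \<Sum>u\<in>words N (tgt g). mat N h w v * mat N g v u * mat N f u w')"
    by (simp add: sum_distrib_left mult.assoc)
  also have "\<dots> = (\<Sum>u\<in>words N (tgt g). \<Sum>v\<in>words N (tgt h). mat N h w v * mat N g v u * mat N f u w')"
    by (rule sum.swap)
  also have "\<dots> = mat N (Comp f (Comp g h)) w w'"
    by (simp add: sum_distrib_right)
  finally show ?thesis .
qed

lemma gmat_GS:
  "gmat N GS [x, y] v = (if x \<in> letters N \<and> y \<in> letters N \<and> v = [y, x] then sg x y else 0)"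
  "gmat N GS v [x, y] = (if x \<in> letters N \<and> y \<in> letters N \<and> v = [y, x] then sg x y else 0)"
proof -
  have "v = [] \<or> (\<exists>p. v = [p]) \<or> (\<exists>p q. v = [p, q]) \<or> (\<exists>p q r u. v = p # q # r # u)"
    by (cases v rule: list.exhaust; cases "tl v"; cases "tl (tl v)") auto
  then show "gmat N GS [x, y] v = (if x \<in> letters N \<and> y \<in> letters N \<and> v = [y, x] then sg x y else 0)"
  "gmat N GS v [x, y] = (if x \<in> letters N \<and> y \<in> letters N \<and> v = [y, x] then sg x y else 0)"
    by (auto simp: sg_comm split: if_splits)
qed

lemma mat_comp_S:
  assumes "x \<in> letters N" "y \<in> letters N"
  shows "mat N (Comp f sS) [x, y] w' = sg x y * mat N f [y, x] w'"
proof -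
  have "(\<Sum>v\<in>words N 2. gmat N GS [x, y] v * mat N f v w') = gmat N GS [x, y] [y, x] * mat N f [y, x] w'"
    by (rule sum_eq_single) (use assms in \<open>auto simp: words_2 gmat_GS\<close>)
  then show ?thesis using assms by (simp add: gmat_GS(1))
qed

lemma mat_S_comp:
  assumes "x \<in> letters N" "y \<in> letters N" "tgt f = 2"
  shows "mat N (Comp sS f) w [x, y] = sg x y * mat N f w [y, x]"
proof -
  have "(\<Sum>v\<in>words N 2. mat N f w v * gmat N GS v [x, y]) = mat N f w [y, x] * gmat N GS [y, x] [x, y]"
    by (rule sum_eq_single) (use assms in \<open>auto simp: words_2 gmat_GS\<close>)
  then show ?thesis using assms by (simp add: gmat_GS(2))
qed

lemma words_3: "w \<in> words N 3 \<longleftrightarrow> (\<exists>x y z. w = [x, y, z] \<and> x \<in> letters N \<and> y \<in> letters N \<and> z \<in> letters N)"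
  by (auto simp: words_Suc eval_nat_numeral)
lemma words_1: "w \<in> words N (Suc 0) \<longleftrightarrow> (\<exists>x. w = [x] \<and> x \<in> letters N)"
  by (auto simp: words_Suc)

lemma mat_S1: "mat N (Tens sS one) [x, y, z] [x', y', z'] = 
   (if x \<in> letters N \<and> y \<in> letters N \<and> z \<in> letters N \<and> x' = y \<and> y' = x \<and> z' = z then sg x y else 0)"
  by (auto simp: eval_nat_numeral words_Suc)
lemma mat_1S: "mat N (Tens one sS) [x, y, z] [x', y', z'] = 
   (if x \<in> letters N \<and> y \<in> letters N \<and> z \<in> letters N \<and> x' = x \<and> y' = z \<and> z' = y then sg y z else 0)"
  by (auto simp: eval_nat_numeral words_Suc)

lemma mat_cups: 
  "mat N (Tens one bBs) [x] [p, q, r] = (if x \<in> letters N \<and> q \<in> letters N \<and> p = x \<and> r = flip q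
     then (if fst x then -1 else 1) * (if fst q then -1 else 1) else 0)"
  "mat N (Tens bBs one) [x] [p, q, r] = (if x \<in> letters N \<and> p \<in> letters N \<and> q = flip p \<and> r = x
     then (if fst p then -1 else 1) else 0)"
  by (auto simp: eval_nat_numeral words_Suc)
lemma mat_caps: 
  "mat N (Tens bB one) [p, q, r] [t] = (if p \<in> letters N \<and> r \<in> letters N \<and> q = flip p \<and> t = r then 1 else 0)"
  "mat N (Tens one bB) [p, q, r] [t] = (if p \<in> letters N \<and> q \<in> letters N \<and> r = flip q \<and> t = p
      then (if fst p then -1 else 1) else 0)"
  by (auto simp: eval_nat_numeral words_Suc)

lemma mat_comp_S1: assumes "x \<in> letters N" "y \<in> letters N" "z \<in> letters N"
  shows "mat N (Comp f (Tens sS one)) [x, y, z] w' = sg x y * mat N f [y, x, z] w'"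
    "mat N (Comp f (Tens one sS)) [x, y, z] w' = sg y z * mat N f [x, z, y] w'"
proof -
  have "(\<Sum>v\<in>words N 3. mat N (Tens sS one) [x, y, z] v * mat N f v w') = mat N (Tens sS one) [x, y, z] [y, x, z] * mat N f [y, x, z] w'"
    by (rule sum_eq_single) (use assms in \<open>auto simp: words_3 mat_S1 simp del: mat.simps(4) One_nat_def split: if_splits\<close>)
  then show "mat N (Comp f (Tens sS one)) [x, y, z] w' = sg x y * mat N f [y, x, z] w'"
    using assms by (simp add: mat_S1 del: mat.simps(4) One_nat_def)
  have "(\<Sum>v\<in>words N 3. mat N (Tens one sS) [x, y, z] v * mat N f v w') = mat N (Tens one sS) [x, y, z] [x, z, y] * mat N f [x, z, y] w'"
    by (rule sum_eq_single) (use assms in \<open>auto simp: words_3 mat_1S simp del: mat.simps(4) One_nat_def split: if_splits\<close>)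
  then show "mat N (Comp f (Tens one sS)) [x, y, z] w' = sg y z * mat N f [x, z, y] w'"
    using assms by (simp add: mat_1S del: mat.simps(4) One_nat_def)
qed

lemma mat_S1_comp: assumes "x \<in> letters N" "y \<in> letters N" "z \<in> letters N" "tgt f = 3"
  shows "mat N (Comp (Tens sS one) f) w [x, y, z] = sg x y * mat N f w [y, x, z]"
    "mat N (Comp (Tens one sS) f) w [x, y, z] = sg y z * mat N f w [x, z, y]"
proof -
  have "(\<Sum>v\<in>words N 3. mat N f w v * mat N (Tens sS one) v [x, y, z]) = mat N f w [y, x, z] * mat N (Tens sS one) [y, x, z] [x, y, z]"
    by (rule sum_eq_single) (use assms in \<open>auto simp: words_3 mat_S1 simp del: mat.simps(4) One_nat_def split: if_splits\<close>)
  then show "mat N (Comp (Tens sS one) f) w [x, y, z] = sg x y * mat N f w [y, x, z]"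
    using assms by (simp add: mat_S1 sg_comm del: mat.simps(4) One_nat_def)
  have "(\<Sum>v\<in>words N 3. mat N f w v * mat N (Tens one sS) v [x, y, z]) = mat N f w [x, z, y] * mat N (Tens one sS) [x, z, y] [x, y, z]"
    by (rule sum_eq_single) (use assms in \<open>auto simp: words_3 mat_1S simp del: mat.simps(4) One_nat_def split: if_splits\<close>)
  then show "mat N (Comp (Tens one sS) f) w [x, y, z] = sg y z * mat N f w [x, z, y]"
    using assms by (simp add: mat_1S sg_comm del: mat.simps(4) One_nat_def)
qed

lemma mat_basic: "basic_rel f c g \<Longrightarrow> mat N f w w' = c * mat N g w w'"
proof (induction rule: basic_rel.induct)
  case R1a
  show ?case
  proof (rule mat_eqI)
    fix w w' assume "w \<in> words N (src (Idn 2))" "w' \<in> words N (tgt (Idn 2))"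
    then obtain x y x' y' where w: "w = [x, y]" "w' = [x', y']"
      "x \<in> letters N" "y \<in> letters N" "x' \<in> letters N" "y' \<in> letters N"
      by (auto simp: words_2)
    show "mat N (Comp sS sS) w w' = 1 * mat N (Idn 2) w w'"
      unfolding w(1) mat_comp_S[OF w(3,4)] using w by (auto simp: words_2)
  qed auto
next
  case R1b
  show ?case
  proof (rule mat_eqI)
    fix w w' assume "w \<in> words N (src (Comp (Comp (Tens one sS) (Tens sS one)) (Tens one sS)))" "w' \<in> words N (tgt (Comp (Comp (Tens one sS) (Tens sS one)) (Tens one sS)))"
    then have "w \<in> words N 3" "w' \<in> words N 3" by (simp_all del: One_nat_def)
    then obtain x y z x' y' z' where w: "w = [x, y, z]" "w' = [x', y', z']"
      "x \<in> letters N" "y \<in> letters N" "z \<in> letters N" "x' \<in> letters N" "y' \<in> letters N" "z' \<in> letters N"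
      unfolding words_3 by blast
    show "mat N (Comp (Comp (Tens sS one) (Tens one sS)) (Tens sS one)) w w' =
      1 * mat N (Comp (Comp (Tens one sS) (Tens sS one)) (Tens one sS)) w w'"
      using w(3-) unfolding w(1,2)
      by (simp add: mat_comp_S1 mat_S1 mat_1S del: mat.simps One_nat_def)
  qed auto
next
  case R2a
  show ?case
  proof (rule mat_eqI)
    fix w w' assume "w \<in> words N (src one)" "w' \<in> words N (tgt one)"
    then obtain x t where w: "w = [x]" "w' = [t]" "x \<in> letters N" "t \<in> letters N" by (auto simp: words_1)
    \<comment> \<open>Only the word \<open>[x, flip x, x]\<close> contributes. It carries one sign
      from the Koszul rule, for \<open>x\<close>, and one from the copairing, for
      \<open>flip x\<close>; exactly one of these letters is odd, so the product is
      \<open>-1\<close>.\<close>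
    have "(\<Sum>v\<in>words N 3. mat N (Tens one bBs) [x] v * mat N (Tens bB one) v [t]) = 
       mat N (Tens one bBs) [x] [x, flip x, x] * mat N (Tens bB one) [x, flip x, x] [t]"
      by (rule sum_eq_single) (use w in \<open>auto simp: words_3 mat_cups mat_caps simp del: mat.simps(4) One_nat_def split: if_splits\<close>)
    then show "mat N (Comp (Tens bB one) (Tens one bBs)) w w' = - 1 * mat N one w w'"
      using w by (auto simp: mat_cups mat_caps words_def simp del: mat.simps(4) One_nat_def)
  qed auto
next
  case R2b
  show ?case
  proof (rule mat_eqI)
    fix w w' assume "w \<in> words N (src one)" "w' \<in> words N (tgt one)"
    then obtain x t where w: "w = [x]" "w' = [t]" "x \<in> letters N" "t \<in> letters N" by (auto simp: words_1)
    \<comment> \<open>Again only \<open>[x, flip x, x]\<close> contributes, but now both signs are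
      governed by the parity of \<open>x\<close> and cancel.\<close>
    have "(\<Sum>v\<in>words N 3. mat N (Tens bBs one) [x] v * mat N (Tens one bB) v [t]) = 
       mat N (Tens bBs one) [x] [x, flip x, x] * mat N (Tens one bB) [x, flip x, x] [t]"
      by (rule sum_eq_single) (use w in \<open>auto simp: words_3 mat_cups mat_caps simp del: mat.simps(4) One_nat_def split: if_splits\<close>)
    then show "mat N (Comp (Tens one bB) (Tens bBs one)) w w' = 1 * mat N one w w'"
      using w by (auto simp: mat_cups mat_caps words_def simp del: mat.simps(4) One_nat_def)
  qed auto
next
  case R3a
  show ?case
  proof (rule mat_eqI)
    fix w w' assume "w \<in> words N (src (Comp (Tens sS one) (Tens one bBs)))" "w' \<in> words N (tgt (Comp (Tens sS one) (Tens one bBs)))"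
    then have "w \<in> words N (Suc 0)" "w' \<in> words N 3" by simp_all
    then obtain x x' y' z' where w: "w = [x]" "w' = [x', y', z']"
      "x \<in> letters N" "x' \<in> letters N" "y' \<in> letters N" "z' \<in> letters N"
      unfolding words_3 words_1 by blast
    have 1: "mat N (Comp (Tens one sS) (Tens bBs one)) w w' = sg y' z' * mat N (Tens bBs one) [x] [x', z', y']"
      unfolding w(1,2) by (rule mat_S1_comp) (use w in auto)
    have 2: "mat N (Comp (Tens sS one) (Tens one bBs)) w w' = sg x' y' * mat N (Tens one bBs) [x] [y', x', z']"
      unfolding w(1,2) by (rule mat_S1_comp) (use w in auto)
    show "mat N (Comp (Tens one sS) (Tens bBs one)) w w' =
      1 * mat N (Comp (Tens sS one) (Tens one bBs)) w w'"
      unfolding 1 2 using w by (auto simp: mat_cups sg_def simp del: mat.simps(4) One_nat_def)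
  qed auto
next
  case R3b
  show ?case
  proof (rule mat_eqI)
    fix w w' assume "w \<in> words N (src bBs)" "w' \<in> words N (tgt bBs)"
    then obtain x y where w: "w = []" "w' = [x, y]" "x \<in> letters N" "y \<in> letters N" by (auto simp: words_2)
    have "mat N (Comp sS bBs) w w' = sg x y * mat N bBs [] [y, x]"
      unfolding w(1,2) by (rule mat_S_comp) (use w in auto)
    then show "mat N (Comp sS bBs) w w' = - 1 * mat N bBs w w'"
      using w by (auto simp: sg_def flip_eq)
  qed auto
qed (simp_all only: mat_comp_assoc mat_comp_id mat_tens_assoc mat_tens_unit mat_tens_id mat_interchange mult_1)

section \<open>The relations act by zero\<close>

definition ev :: "nat \<Rightarrow> vec \<Rightarrow> word \<Rightarrow> word \<Rightarrow> complex" where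
  "ev N x w w' = (\<Sum>m | x m \<noteq> 0. x m * mat N m w w')"

lemma ev_eq: "finite B \<Longrightarrow> {m. x m \<noteq> 0} \<subseteq> B \<Longrightarrow> ev N x w w' = (\<Sum>m\<in>B. x m * mat N m w w')"
  unfolding ev_def by (rule sum.mono_neutral_left) auto

text \<open>Carried through the induction in \<open>ideal_ev\<close>, so that \<open>ev\<close> is a
  finite sum over terms of one common type.\<close>

definition tame :: "nat \<Rightarrow> nat \<Rightarrow> vec \<Rightarrow> bool" where
  "tame a b x \<longleftrightarrow> finite {m. x m \<noteq> 0} \<and> (\<forall>m. x m \<noteq> 0 \<longrightarrow> src m = a \<and> tgt m = b)"

lemma compL_nz: "compL f x m \<noteq> 0 \<longleftrightarrow> (\<exists>g. m = Comp f g \<and> x g \<noteq> 0)"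
  and compR_nz: "compR x f m \<noteq> 0 \<longleftrightarrow> (\<exists>g. m = Comp g f \<and> x g \<noteq> 0)"
  and tensL_nz: "tensL f x m \<noteq> 0 \<longleftrightarrow> (\<exists>g. m = Tens f g \<and> x g \<noteq> 0)"
  and tensR_nz: "tensR x f m \<noteq> 0 \<longleftrightarrow> (\<exists>g. m = Tens g f \<and> x g \<noteq> 0)"
  by (cases m; auto simp: compL_def compR_def tensL_def tensR_def)+

lemma ctx_supp:
  "{m. compL f x m \<noteq> 0} = Comp f ` {m. x m \<noteq> 0}"
  "{m. compR x f m \<noteq> 0} = (\<lambda>g. Comp g f) ` {m. x m \<noteq> 0}"
  "{m. tensL f x m \<noteq> 0} = Tens f ` {m. x m \<noteq> 0}"
  "{m. tensR x f m \<noteq> 0} = (\<lambda>g. Tens g f) ` {m. x m \<noteq> 0}"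
  unfolding compL_nz compR_nz tensL_nz tensR_nz by auto

lemma ev_supp:
  "ev N (compL f x) w w' = (\<Sum>m | x m \<noteq> 0. x m * mat N (Comp f m) w w')"
  "ev N (compR x f) w w' = (\<Sum>m | x m \<noteq> 0. x m * mat N (Comp m f) w w')"
  "ev N (tensL f x) w w' = (\<Sum>m | x m \<noteq> 0. x m * mat N (Tens f m) w w')"
  "ev N (tensR x f) w w' = (\<Sum>m | x m \<noteq> 0. x m * mat N (Tens m f) w w')"
  unfolding ev_def ctx_supp
  by (subst sum.reindex; simp add: inj_on_def compL_def compR_def tensL_def tensR_def)+

lemma tame_ctx:
  "tame a b x \<Longrightarrow> src f = b \<Longrightarrow> tame a (tgt f) (compL f x)"
  "tame a b x \<Longrightarrow> tgt f = a \<Longrightarrow> tame (src f) b (compR x f)"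
  "tame a b x \<Longrightarrow> tame (src f + a) (tgt f + b) (tensL f x)"
  "tame a b x \<Longrightarrow> tame (a + src f) (b + tgt f) (tensR x f)"
  unfolding tame_def ctx_supp compL_nz compR_nz tensL_nz tensR_nz by auto

lemma basic_type: "basic_rel f c g \<Longrightarrow> src f = src g \<and> tgt f = tgt g \<and> wt f \<and> wt g \<and> c \<noteq> 0"
  by (induction rule: basic_rel.induct) auto

lemma ideal_ev: "rel_ideal a b x \<Longrightarrow> tame a b x \<and> (\<forall>w w'. ev N x w w' = 0)"
proof (induction rule: rel_ideal.induct)
  case (ri_zero a b)
  then show ?case by (simp add: tame_def ev_def)
next
  case (ri_add a b x y)
  let ?B = "{m. x m \<noteq> 0} \<union> {m. y m \<noteq> 0}"
  have fin: "finite ?B" using ri_add by (auto simp: tame_def)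
  have "ev N (\<lambda>m. x m + y m) w w' = ev N x w w' + ev N y w w'" for w w'
    by (subst (1 2 3) ev_eq[OF fin]) (auto simp: sum.distrib algebra_simps)
  moreover have "tame a b (\<lambda>m. x m + y m)"
  proof -
    have nz: "x m \<noteq> 0 \<or> y m \<noteq> 0" if "x m + y m \<noteq> 0" for m using that by auto
    then have "{m. x m + y m \<noteq> 0} \<subseteq> ?B" by blast
    from finite_subset[OF this fin] nz show ?thesis using ri_add unfolding tame_def by blast
  qed
  ultimately show ?case using ri_add by simp
next
  case (ri_smult a b x c)
  have fin: "finite {m. x m \<noteq> 0}" using ri_smult by (auto simp: tame_def)
  have "ev N (\<lambda>m. c * x m) w w' = c * ev N x w w'" for w w'
    by (subst (1 2) ev_eq[OF fin]) (auto simp: sum_distrib_left algebra_simps)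
  moreover have "tame a b (\<lambda>m. c * x m)"
    using ri_smult by (auto simp: tame_def)
  ultimately show ?case using ri_smult by simp
next
  case (ri_basic f c g)
  have sup: "{m. delta f m - c * delta g m \<noteq> 0} \<subseteq> {f, g}" by (auto simp: delta_def)
  have "tame (src f) (tgt f) (\<lambda>m. delta f m - c * delta g m)"
    using basic_type[OF ri_basic] finite_subset[OF sup] by (auto simp: tame_def delta_def split: if_splits)
  moreover have "ev N (\<lambda>m. delta f m - c * delta g m) w w' = 0" for w w'
    using mat_basic[OF ri_basic, of N w w'] 
    by (subst ev_eq[of "{f, g}"]) (cases "f = g"; auto simp: delta_def algebra_simps)+
  ultimately show ?case by blast
next
  case (ri_compL a b x f)
  have "ev N (compL f x) w w' = 0" for w w'
  proof -
    have "ev N (compL f x) w w' = (\<Sum>m | x m \<noteq> 0. \<Sum>v\<in>words N b. mat N f v w' * (x m * mat N m w v))"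
      unfolding ev_supp using ri_compL by (intro sum.cong) (auto simp: tame_def sum_distrib_left algebra_simps)
    also have "\<dots> = (\<Sum>v\<in>words N b. \<Sum>m | x m \<noteq> 0. mat N f v w' * (x m * mat N m w v))"
      by (rule sum.swap)
    also have "\<dots> = (\<Sum>v\<in>words N b. mat N f v w' * ev N x w v)"
      by (simp add: ev_def sum_distrib_left)
    finally show ?thesis using ri_compL by simp
  qed
  then show ?case using ri_compL tame_ctx by auto
next
  case (ri_compR a b x f)
  have "ev N (compR x f) w w' = 0" for w w'
  proof -
    have "ev N (compR x f) w w' = (\<Sum>m | x m \<noteq> 0. \<Sum>v\<in>words N a. mat N f w v * (x m * mat N m v w'))"
      unfolding ev_supp using ri_compR by (intro sum.cong) (auto simp: tame_def sum_distrib_left algebra_simps)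
    also have "\<dots> = (\<Sum>v\<in>words N a. \<Sum>m | x m \<noteq> 0. mat N f w v * (x m * mat N m v w'))"
      by (rule sum.swap)
    also have "\<dots> = (\<Sum>v\<in>words N a. mat N f w v * ev N x v w')"
      by (simp add: ev_def sum_distrib_left)
    finally show ?thesis using ri_compR by simp
  qed
  then show ?case using ri_compR tame_ctx by auto
next
  case (ri_tensL a b x f)
  have "ev N (tensL f x) w w' = 0" for w w'
  proof -
    let ?u = "take (src f) w" and ?v = "drop (src f) w" and ?v' = "drop (tgt f) w'" and ?u' = "take (tgt f) w'"
    \<comment> \<open>The Koszul sign of \<open>Tens f m\<close> involves \<open>par m\<close>,
      which could vary with \<open>m\<close>. By homogeneity it is determined by \<open>?v\<close>
      and \<open>?v'\<close>, so it can be taken out of the sum.\<close>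
    let ?c = "(-1) ^ ((wpar ?v + wpar ?v') * wpar ?u) * mat N f ?u ?u'"
    have e: "x m * mat N (Tens f m) w w' = ?c * (x m * mat N m ?v ?v')" for m
    proof (cases "mat N m ?v ?v' = 0")
      case False
      then have "even (wpar ?v + wpar ?v' + par m)" by (rule mat_par)
      then have "even (par m * wpar ?u + (wpar ?v + wpar ?v') * wpar ?u)" by auto
      then have "(-1 :: complex) ^ (par m * wpar ?u) = (-1) ^ ((wpar ?v + wpar ?v') * wpar ?u)"
        by (rule minus1_cong)
      then show ?thesis by simp
    qed simp
    have "ev N (tensL f x) w w' = ?c * ev N x ?v ?v'"
      unfolding ev_supp e by (simp only: ev_def sum_distrib_left)
    then show ?thesis using ri_tensL by simp
  qed
  then show ?case using ri_tensL tame_ctx by auto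
next
  case (ri_tensR a b x f)
  have "ev N (tensR x f) w w' = 0" for w w'
  proof -
    let ?u = "take a w" and ?v = "drop a w" and ?v' = "drop b w'" and ?u' = "take b w'"
    let ?c = "(-1) ^ (par f * wpar ?u) * mat N f ?v ?v'"
    have "x m * mat N (Tens m f) w w' = ?c * (x m * mat N m ?u ?u')" if "x m \<noteq> 0" for m
      using that ri_tensR by (auto simp: tame_def)
    then have "ev N (tensR x f) w w' = (\<Sum>m | x m \<noteq> 0. ?c * (x m * mat N m ?u ?u'))"
      unfolding ev_supp by (intro sum.cong) auto
    then have "ev N (tensR x f) w w' = ?c * ev N x ?u ?u'"
      by (simp add: ev_def sum_distrib_left)
    then show ?thesis using ri_tensR by simp
  qed
  then show ?case using ri_tensR tame_ctx by auto
qed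

section \<open>Equality of morphisms up to a scalar\<close>

definition homeq :: "mor \<Rightarrow> complex \<Rightarrow> mor \<Rightarrow> bool" where
  "homeq f c g \<longleftrightarrow> rel_ideal (src f) (tgt f) (\<lambda>m. delta f m - c * delta g m)"

lemma homeq_mat: "homeq f c g \<Longrightarrow> mat N f w w' = c * mat N g w w'"
proof -
  assume "homeq f c g"
  then have "ev N (\<lambda>m. delta f m - c * delta g m) w w' = 0" 
    using ideal_ev unfolding homeq_def by blast
  moreover have "ev N (\<lambda>m. delta f m - c * delta g m) w w' = mat N f w w' - c * mat N g w w'"
    by (subst ev_eq[of "{f, g}"]) (cases "f = g"; auto simp: delta_def algebra_simps)+
  ultimately show ?thesis by simp
qed

lemma homeq_refl: "homeq f 1 f"
  unfolding homeq_def by (simp add: ri_zero)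

lemma homeq_trans:
  assumes "homeq f c g" "homeq g d h" "src f = src g" "tgt f = tgt g"
  shows "homeq f (c * d) h"
proof -
  have "rel_ideal (src f) (tgt f) (\<lambda>m. (delta f m - c * delta g m) + c * (delta g m - d * delta h m))"
    by (intro ri_add ri_smult) (use assms in \<open>auto simp: homeq_def\<close>)
  then show ?thesis by (simp add: homeq_def algebra_simps)
qed

lemma homeq_sym:
  assumes "homeq f c g" "c \<noteq> 0" "src f = src g" "tgt f = tgt g"
  shows "homeq g (inverse c) f"
proof -
  have "rel_ideal (src g) (tgt g) (\<lambda>m. (- inverse c) * (delta f m - c * delta g m))"
    by (intro ri_smult) (use assms in \<open>auto simp: homeq_def\<close>)
  moreover have "(\<lambda>m. (- inverse c) * (delta f m - c * delta g m)) = (\<lambda>m. delta g m - inverse c * delta f m)"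
    using assms(2) by (simp add: algebra_simps fun_eq_iff)
  ultimately show ?thesis by (simp add: homeq_def)
qed

lemma delta_ctx:
  "compL f (\<lambda>m. delta g m - c * delta h m) = (\<lambda>m. delta (Comp f g) m - c * delta (Comp f h) m)"
  "compR (\<lambda>m. delta g m - c * delta h m) f = (\<lambda>m. delta (Comp g f) m - c * delta (Comp h f) m)"
  "tensL f (\<lambda>m. delta g m - c * delta h m) = (\<lambda>m. delta (Tens f g) m - c * delta (Tens f h) m)"
  "tensR (\<lambda>m. delta g m - c * delta h m) f = (\<lambda>m. delta (Tens g f) m - c * delta (Tens h f) m)"
  unfolding compL_def compR_def tensL_def tensR_def by (rule ext; auto simp: delta_def split: mor.splits)+

lemma homeq_ctx:
  "homeq g c h \<Longrightarrow> wt (Comp f g) \<Longrightarrow> homeq (Comp f g) c (Comp f h)"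
  "homeq g c h \<Longrightarrow> wt (Comp g f) \<Longrightarrow> homeq (Comp g f) c (Comp h f)"
  "homeq g c h \<Longrightarrow> wt (Tens f g) \<Longrightarrow> homeq (Tens f g) c (Tens f h)"
  "homeq g c h \<Longrightarrow> wt (Tens g f) \<Longrightarrow> homeq (Tens g f) c (Tens h f)"
  unfolding homeq_def delta_ctx[symmetric] src.simps tgt.simps wt.simps
  by (auto intro: ri_compL ri_compR ri_tensL ri_tensR)

lemma basic_homeq: "basic_rel f c g \<Longrightarrow> homeq f c g"
  unfolding homeq_def by (rule ri_basic)

lemma brel_basic: "brel f g \<Longrightarrow> wt f \<Longrightarrow> \<exists>c. basic_rel f c g"
  by (induction rule: brel.induct) (auto intro: basic_rel.intros basic_rel.intros[unfolded One_nat_def])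

text \<open>The vanishing of the loop is an assumption here because its proof already uses the
  instance \<open>l = False\<close>, for which the assumption is vacuous.\<close>

lemma red_homeq_gen:
  assumes "l \<Longrightarrow> rel_ideal 0 0 (delta (Comp bB bBs))"
  shows "red l f g \<Longrightarrow> wt f \<Longrightarrow> \<exists>c. homeq f c g"
proof (induction rule: red.induct)
  case (red_fwd f g)
  then show ?case using brel_basic basic_homeq by blast
next
  case (red_bwd f g)
  then have t: "src f = src g" "tgt f = tgt g" "wt f" using brel_type by blast+
  then obtain c where c: "basic_rel f c g" using brel_basic red_bwd by blast
  then show ?case using homeq_sym[OF basic_homeq[OF c]] t basic_type[OF c] by blast
next
  case red_loop
  then have "homeq (Comp bB bBs) 0 (Idn 0)" using assms by (simp add: homeq_def)
  then show ?case by blast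
next
  case (red_refl f)
  then show ?case using homeq_refl by blast
next
  case (red_trans f g h)
  then show ?case using homeq_trans red_type by metis
next
  case (red_compL m m' f)
  then show ?case using homeq_ctx(1) by (metis wt.simps(3))
next
  case (red_compR m m' f)
  then show ?case using homeq_ctx(2) by (metis wt.simps(3))
next
  case (red_tensL m m' f)
  then show ?case using homeq_ctx(3) by (metis wt.simps(4))
next
  case (red_tensR m m' f)
  then show ?case using homeq_ctx(4) by (metis wt.simps(4))
qed

lemma act_0_Idn: "act 0 f (Idn (src f)) \<approx> f"
proof -
  have "wh 0 f 0 \<approx> Tens f (Idn 0)" unfolding wh_def by (rule red_fwd, rule b_tunitl)
  also have "\<dots> \<approx> f" by (rule red_fwd, rule b_tunitr)
  finally have "Comp (wh 0 f 0) (Idn (src f)) \<approx> Comp f (Idn (src f))" by (rule red_compR)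
  also have "\<dots> \<approx> f" by (rule eqv_idr) simp
  finally show ?thesis by (simp add: act_def)
qed

lemma cap_swap: "Comp bB sS \<approx> bB"
proof -
  have "Comp bB sS \<approx> act 0 (Comp bB sS) (Idn 2)" using eqv_sym[OF act_0_Idn[of "Comp bB sS"]] by simp
  also have "\<dots> \<approx> ca 0 (sw 0 (Idn 2))" by (rule act_comp) auto
  also have "\<dots> \<approx> ca 0 (Idn 2)" by (rule ca_sw) auto
  also have "\<dots> \<approx> bB" using act_0_Idn[of bB] by simp
  finally show ?thesis .
qed

text \<open>Evaluating \<open>b s b*\<close> by \<open>b s = b\<close> and by
  \<open>s b* = - b*\<close> gives \<open>b b*\<close> and its negative. The first equation is known
  only up to a scalar \<open>c\<close>; comparing a single matrix entry for \<open>N = 1\<close>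
  shows that \<open>c = 1\<close>.\<close>

lemma loop_zero: "rel_ideal 0 0 (delta (Comp bB bBs))"
proof -
  obtain c where c: "homeq (Comp bB sS) c bB"
    using red_homeq_gen[of False, OF _ cap_swap] by auto
  let ?x = "(False, 0) :: letter"
  have x: "?x \<in> letters 1" "flip ?x \<in> letters 1" by (auto simp: letters_iff)
  have "mat 1 (Comp bB sS) [?x, flip ?x] [] = c * mat 1 bB [?x, flip ?x] []"
    using c by (rule homeq_mat)
  then have "c = 1" unfolding mat_comp_S[OF x] using x by (simp add: sg_def letters_iff)
  then have 1: "homeq (Comp (Comp bB sS) bBs) 1 (Comp bB bBs)"
    using homeq_ctx(2)[OF c, of bBs] by simp
  have "homeq (Comp (Comp bB sS) bBs) 1 (Comp bB (Comp sS bBs))"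
    by (intro basic_homeq cat_assoc) auto
  moreover have "homeq (Comp bB (Comp sS bBs)) (-1) (Comp bB bBs)"
    by (intro homeq_ctx(1) basic_homeq R3b) auto
  ultimately have 2: "homeq (Comp (Comp bB sS) bBs) (1 * -1) (Comp bB bBs)"
    by (rule homeq_trans) auto
  let ?y = "delta (Comp (Comp bB sS) bBs)" and ?z = "delta (Comp bB bBs)"
  have "rel_ideal 0 0 (\<lambda>m. (1/2) * ((?y m - (1 * -1) * ?z m) + (-1) * (?y m - 1 * ?z m)))"
    by (intro ri_smult ri_add) (use 1 2 in \<open>auto simp: homeq_def\<close>)
  moreover have "(\<lambda>m. (1/2) * ((?y m - (1 * -1) * ?z m) + (-1) * (?y m - 1 * ?z m))) = ?z"
    by (simp add: fun_eq_iff)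
  ultimately show ?thesis by simp
qed

lemma red_homeq: "f \<leadsto> g \<Longrightarrow> wt f \<Longrightarrow> \<exists>c. homeq f c g"
  using red_homeq_gen[OF loop_zero] by blast

text \<open>\<open>phi\<close> may take the same value at several indices. The coefficient of a term
  is then itself a sum, and two sums have to be exchanged.\<close>

lemma ev_sum_delta:
  assumes "finite I" "\<And>i. i \<in> I \<Longrightarrow> src (phi i) = a \<and> tgt (phi i) = b"
  shows "ev N (\<lambda>m. \<Sum>i\<in>I. coef i * delta (phi i) m) w w' = (\<Sum>i\<in>I. coef i * mat N (phi i) w w')"
proof -
  have "{m. (\<Sum>i\<in>I. coef i * delta (phi i) m) \<noteq> 0} \<subseteq> phi ` I"
  proof
    fix m assume "m \<in> {m. (\<Sum>i\<in>I. coef i * delta (phi i) m) \<noteq> 0}"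
    then obtain i where "i \<in> I" "coef i * delta (phi i) m \<noteq> 0" by (metis (mono_tags, lifting) mem_Collect_eq sum.neutral)
    then show "m \<in> phi ` I" by (auto simp: delta_def split: if_splits)
  qed
  then have "ev N (\<lambda>m. \<Sum>i\<in>I. coef i * delta (phi i) m) w w' =
    (\<Sum>m\<in>phi ` I. (\<Sum>i\<in>I. coef i * delta (phi i) m) * mat N m w w')"
    using assms by (intro ev_eq) auto
  also have "\<dots> = (\<Sum>i\<in>I. \<Sum>m\<in>phi ` I. coef i * delta (phi i) m * mat N m w w')"
    unfolding sum_distrib_right by (rule sum.swap)
  also have "\<dots> = (\<Sum>i\<in>I. coef i * mat N (phi i) w w')"
  proof (rule sum.cong[OF refl])
    fix i assume i: "i \<in> I"
    have "(\<Sum>m\<in>phi ` I. coef i * delta (phi i) m * mat N m w w') = coef i * delta (phi i) (phi i) * mat N (phi i) w w'"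
      by (rule sum_eq_single) (use assms i in \<open>auto simp: delta_def\<close>)
    then show "(\<Sum>m\<in>phi ` I. coef i * delta (phi i) m * mat N m w w') = coef i * mat N (phi i) w w'"
      by (simp add: delta_def)
  qed
  finally show ?thesis .
qed

text \<open>Letters are pairs; splitting them would hide the witnesses needed below.\<close>

declare split_paired_Ex [simp del] split_paired_All [simp del]

section \<open>Labellings of diagrams\<close>

text \<open>The support of the matrices if no cancellation occurred: pairs of words that extend to a labelling.\<close>

fun rel :: "nat \<Rightarrow> mor \<Rightarrow> (word \<times> word) set" where
  "rel N (Gen GS) = {([x, y], [y, x]) | x y. x \<in> letters N \<and> y \<in> letters N}"
| "rel N (Gen GB) = {([x, flip x], []) | x. x \<in> letters N}"
| "rel N (Gen GBs) = {([], [x, flip x]) | x. x \<in> letters N}"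
| "rel N (Idn n) = {(w, w) | w. w \<in> words N n}"
| "rel N (Comp f g) = rel N g O rel N f"
| "rel N (Tens f g) = {(u @ v, u' @ v') | u u' v v'. (u, u') \<in> rel N f \<and> (v, v') \<in> rel N g}"

lemma rel_words: "(w, w') \<in> rel N f \<Longrightarrow> w \<in> words N (src f) \<and> w' \<in> words N (tgt f)"
proof (induction f arbitrary: w w')
  case (Gen g)
  then show ?case by (cases g) (auto simp: words_def)
next
  case (Tens f g)
  then show ?case by (fastforce simp: words_def)
qed auto

lemma rel_compI: "(u, v) \<in> rel N g \<Longrightarrow> (v, w) \<in> rel N f \<Longrightarrow> (u, w) \<in> rel N (Comp f g)"
  by auto

lemma rel_compE:
  assumes "(u, w) \<in> rel N (Comp f g)"
  obtains v where "(u, v) \<in> rel N g" "(v, w) \<in> rel N f"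
  using assms by auto

lemma gmat_rel: "gmat N g w w' \<noteq> 0 \<Longrightarrow> (w, w') \<in> rel N (Gen g)"
  by (induction N g w w' rule: gmat.induct) (auto split: if_splits)

lemma mat_rel: "mat N f w w' \<noteq> 0 \<Longrightarrow> (w, w') \<in> rel N f"
proof (induction f arbitrary: w w')
  case (Gen g)
  then show ?case using gmat_rel by simp
next
  case (Comp f g)
  then obtain v where "mat N g w v \<noteq> 0" "mat N f v w' \<noteq> 0"
    by (metis (no_types, lifting) mat.simps(3) mult_not_zero sum.neutral)
  then show ?case using Comp.IH rel_compI by blast
next
  case (Tens f g)
  then have 1: "(take (src f) w, take (tgt f) w') \<in> rel N f" "(drop (src f) w, drop (tgt f) w') \<in> rel N g"
    by auto
  have "(take (src f) w @ drop (src f) w, take (tgt f) w' @ drop (tgt f) w') \<in> rel N (Tens f g)"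
    unfolding rel.simps using 1 by blast
  then show ?case by simp
qed (auto split: if_splits)

lemma rel_len: "(w, w') \<in> rel N f \<Longrightarrow> length w = src f \<and> length w' = tgt f"
  using rel_words by (auto simp: words_def)

lemma rel_tensI: "(u, u') \<in> rel N f \<Longrightarrow> (v, v') \<in> rel N g \<Longrightarrow> (u @ v, u' @ v') \<in> rel N (Tens f g)"
  by auto

lemma rel_tensE:
  assumes "(w, w') \<in> rel N (Tens f g)"
  obtains u v u' v' where "w = u @ v" "w' = u' @ v'" "(u, u') \<in> rel N f" "(v, v') \<in> rel N g"
    "length u = src f" "length v = src g" "length u' = tgt f" "length v' = tgt g"
  using assms rel_len by fastforce

lemma rel_interchange:
  assumes "tgt h = src f" "tgt k = src g"
  shows "rel N (Comp (Tens f g) (Tens h k)) = rel N (Tens (Comp f h) (Comp g k))" (is "?L = ?R")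
proof (intro equalityI subrelI)
  fix w w' assume "(w, w') \<in> ?L"
  then obtain v where v: "(w, v) \<in> rel N (Tens h k)" "(v, w') \<in> rel N (Tens f g)" by (rule rel_compE)
  from v(1) obtain w1 w2 v1 v2 where 1: "w = w1 @ w2" "v = v1 @ v2" "(w1, v1) \<in> rel N h" "(w2, v2) \<in> rel N k"
     "length v1 = tgt h" "length v2 = tgt k" by (rule rel_tensE)
  from v(2) obtain u1 u2 w1' w2' where 
    2: "v = u1 @ u2" "w' = w1' @ w2'" "(u1, w1') \<in> rel N f" "(u2, w2') \<in> rel N g" "length u1 = src f"
    by (rule rel_tensE)
  have "u1 = v1 \<and> u2 = v2" using 1 2 assms by auto
  then have "(w1, w1') \<in> rel N (Comp f h)" "(w2, w2') \<in> rel N (Comp g k)"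
    using 1 2 rel_compI by blast+
  then show "(w, w') \<in> ?R" unfolding 1(1) 2(2) by (rule rel_tensI)
next
  fix w w' assume "(w, w') \<in> ?R"
  then obtain u v u' v' where 1: "w = u @ v" "w' = u' @ v'" "(u, u') \<in> rel N (Comp f h)" "(v, v') \<in> rel N (Comp g k)"
    by (rule rel_tensE)
  obtain x where x: "(u, x) \<in> rel N h" "(x, u') \<in> rel N f" using 1(3) by (rule rel_compE)
  obtain y where y: "(v, y) \<in> rel N k" "(y, v') \<in> rel N g" using 1(4) by (rule rel_compE)
  show "(w, w') \<in> ?L" unfolding 1(1,2)
    by (rule rel_compI[OF rel_tensI[OF x(1) y(1)] rel_tensI[OF x(2) y(2)]])
qed

lemma rel_tens_one: "rel N (Tens f one) = {(u @ [x], u' @ [x]) | u u' x. (u, u') \<in> rel N f \<and> x \<in> letters N}"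
  "rel N (Tens one f) = {(x # u, x # u') | u u' x. (u, u') \<in> rel N f \<and> x \<in> letters N}"
  by (auto simp: words_1) (metis append_Cons append_Nil)+

lemma rel_three:
  "rel N (Tens sS one) = {([x, y, z], [y, x, z]) | x y z. x \<in> letters N \<and> y \<in> letters N \<and> z \<in> letters N}"
  "rel N (Tens one sS) = {([x, y, z], [x, z, y]) | x y z. x \<in> letters N \<and> y \<in> letters N \<and> z \<in> letters N}"
  "rel N (Tens bB one) = {([x, flip x, z], [z]) | x z. x \<in> letters N \<and> z \<in> letters N}"
  "rel N (Tens one bB) = {([z, x, flip x], [z]) | x z. x \<in> letters N \<and> z \<in> letters N}"
  "rel N (Tens bBs one) = {([z], [x, flip x, z]) | x z. x \<in> letters N \<and> z \<in> letters N}"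
  "rel N (Tens one bBs) = {([z], [z, x, flip x]) | x z. x \<in> letters N \<and> z \<in> letters N}"
  unfolding rel_tens_one by force+

lemma rel_S1: "([x, y, z], w) \<in> rel N (Tens sS one) \<longleftrightarrow> w = [y, x, z] \<and> [x, y, z] \<in> words N 3"
  "([x, y, z], w) \<in> rel N (Tens one sS) \<longleftrightarrow> w = [x, z, y] \<and> [x, y, z] \<in> words N 3"
  "(w, [x, y, z]) \<in> rel N (Tens sS one) \<longleftrightarrow> w = [y, x, z] \<and> [x, y, z] \<in> words N 3"
  "(w, [x, y, z]) \<in> rel N (Tens one sS) \<longleftrightarrow> w = [x, z, y] \<and> [x, y, z] \<in> words N 3"
  unfolding rel_three by (auto simp: words_def)

lemma rel_comp_S1:
  "([x, y, z], w) \<in> rel N (Comp f (Tens sS one)) \<longleftrightarrow> ([y, x, z], w) \<in> rel N f \<and> [x, y, z] \<in> words N 3"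
  "([x, y, z], w) \<in> rel N (Comp f (Tens one sS)) \<longleftrightarrow> ([x, z, y], w) \<in> rel N f \<and> [x, y, z] \<in> words N 3"
  "(w, [x, y, z]) \<in> rel N (Comp (Tens sS one) f) \<longleftrightarrow> (w, [y, x, z]) \<in> rel N f \<and> [x, y, z] \<in> words N 3"
  "(w, [x, y, z]) \<in> rel N (Comp (Tens one sS) f) \<longleftrightarrow> (w, [x, z, y]) \<in> rel N f \<and> [x, y, z] \<in> words N 3"
  unfolding rel.simps(5) relcomp_unfold by (auto simp: rel_S1 simp del: rel.simps One_nat_def)

lemma rel_eqI: 
  assumes "\<And>w w'. w \<in> words N (src f) \<Longrightarrow> w' \<in> words N (tgt f) \<Longrightarrow> (w, w') \<in> rel N f \<longleftrightarrow> (w, w') \<in> rel N g"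
    "src f = src g" "tgt f = tgt g"
  shows "rel N f = rel N g"
proof (intro equalityI subrelI)
  fix w w' assume "(w, w') \<in> rel N f"
  then show "(w, w') \<in> rel N g" using assms(1) rel_words by blast
next
  fix w w' assume *: "(w, w') \<in> rel N g"
  then have "w \<in> words N (src f)" "w' \<in> words N (tgt f)" using rel_words[OF *] assms by simp_all
  then show "(w, w') \<in> rel N f" using assms(1) * by blast
qed

text \<open>Forgetting signs turns the representation into one by binary relations, in which each
  defining relation becomes an equality.\<close>

lemma rel_brel: "brel f g \<Longrightarrow> rel N f = rel N g"
proof (induction rule: brel.induct)
  case (b_idl f) then show ?case using rel_words by fastforce
next
  case (b_idr f) then show ?case using rel_words by fastforce
next
  case (b_tassoc f g h)
  show ?case
  proof (intro equalityI subrelI)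
    fix w w' assume "(w, w') \<in> rel N (Tens (Tens f g) h)"
    then obtain a b c a' b' c' where "w = (a @ b) @ c" "w' = (a' @ b') @ c'"
      "(a, a') \<in> rel N f" "(b, b') \<in> rel N g" "(c, c') \<in> rel N h" by auto
    then have "w = a @ (b @ c)" "w' = a' @ (b' @ c')" "(b @ c, b' @ c') \<in> rel N (Tens g h)" by auto
    then show "(w, w') \<in> rel N (Tens f (Tens g h))" using \<open>(a, a') \<in> rel N f\<close> rel_tensI by metis
  next
    fix w w' assume "(w, w') \<in> rel N (Tens f (Tens g h))"
    then obtain a b c a' b' c' where "w = a @ (b @ c)" "w' = a' @ (b' @ c')"
      "(a, a') \<in> rel N f" "(b, b') \<in> rel N g" "(c, c') \<in> rel N h" by auto
    then have "w = (a @ b) @ c" "w' = (a' @ b') @ c'" "(a @ b, a' @ b') \<in> rel N (Tens f g)" by auto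
    then show "(w, w') \<in> rel N (Tens (Tens f g) h)" using \<open>(c, c') \<in> rel N h\<close> rel_tensI by metis
  qed
next
  case (b_tid m n)
  show ?case
  proof (intro equalityI subrelI)
    fix w w' assume "(w, w') \<in> rel N (Tens (Idn m) (Idn n))"
    then show "(w, w') \<in> rel N (Idn (m + n))" by (auto simp: words_def)
  next
    fix w w' assume "(w, w') \<in> rel N (Idn (m + n))"
    then have "w' = w" "w \<in> words N (m + n)" by auto
    moreover obtain u v where "w = u @ v" "u \<in> words N m" "v \<in> words N n"
      using words_split[OF calculation(2)] by blast
    ultimately show "(w, w') \<in> rel N (Tens (Idn m) (Idn n))" by auto
  qed
next
  case (b_inter h f k g)
  then show ?case by (rule rel_interchange)
next
  case b_R1a
  show ?case by (auto simp: words_2)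
next
  case b_R1b
  show ?case
  proof (rule rel_eqI)
    fix w w' assume "w \<in> words N (src (Comp (Comp (Tens sS one) (Tens one sS)) (Tens sS one)))"
    then have "w \<in> words N 3" by (simp del: One_nat_def)
    then obtain x y z where w: "w = [x, y, z]" "x \<in> letters N" "y \<in> letters N" "z \<in> letters N" by (auto simp: words_3)
    show "((w, w') \<in> rel N (Comp (Comp (Tens sS one) (Tens one sS)) (Tens sS one))) =
       ((w, w') \<in> rel N (Comp (Comp (Tens one sS) (Tens sS one)) (Tens one sS)))"
      unfolding w(1) rel_comp_S1 rel_S1 using w(2-) by (auto simp: words_3)
  qed auto
next
  case b_R2a
  have c: "([z], [z, x, flip x]) \<in> rel N (Tens one bBs)" "([x, flip x, z], [z]) \<in> rel N (Tens bB one)"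
    if "x \<in> letters N" "z \<in> letters N" for x z
    using that unfolding rel_three by blast+
  have "([z], [z, flip z, z]) \<in> rel N (Tens one bBs)" "([z, flip z, z], [z]) \<in> rel N (Tens bB one)" if "z \<in> letters N" for z
    using c(1)[of "flip z" z] c(2)[of "z" z] that by simp_all
  then have "([z], [z]) \<in> rel N (Comp (Tens bB one) (Tens one bBs))" if "z \<in> letters N" for z
    using that by (blast intro: rel_compI)
  moreover have "w = w' \<and> w \<in> words N (Suc 0)" if "(w, v) \<in> rel N (Tens one bBs)" "(v, w') \<in> rel N (Tens bB one)" for w v w'
    using that unfolding rel_three by (elim CollectE exE conjE) (simp add: words_1)
  then have "w = w' \<and> w \<in> words N (Suc 0)" if "(w, w') \<in> rel N (Comp (Tens bB one) (Tens one bBs))" for w w'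
    using that by (blast elim: rel_compE)
  ultimately show ?case
  proof (intro equalityI subrelI)
    fix w w' assume "(w, w') \<in> rel N (Comp (Tens bB one) (Tens one bBs))"
    then have "w = w' \<and> w \<in> words N (Suc 0)"
      using \<open>\<And>w w'. (w, w') \<in> rel N (Comp (Tens bB one) (Tens one bBs)) \<Longrightarrow> w = w' \<and> w \<in> words N (Suc 0)\<close> by blast
    then show "(w, w') \<in> rel N one" by auto
  next
    fix w w' assume "(w, w') \<in> rel N one"
    then obtain z where "w = [z]" "w' = [z]" "z \<in> letters N" by (auto simp: words_1)
    then show "(w, w') \<in> rel N (Comp (Tens bB one) (Tens one bBs))"
      using \<open>\<And>z. z \<in> letters N \<Longrightarrow> ([z], [z]) \<in> rel N (Comp (Tens bB one) (Tens one bBs))\<close> by blast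
  qed
next
  case b_R2b
  have c: "([z], [x, flip x, z]) \<in> rel N (Tens bBs one)" "([z, x, flip x], [z]) \<in> rel N (Tens one bB)"
    if "x \<in> letters N" "z \<in> letters N" for x z
    using that unfolding rel_three by blast+
  have "([z], [z, flip z, z]) \<in> rel N (Tens bBs one)" "([z, flip z, z], [z]) \<in> rel N (Tens one bB)" if "z \<in> letters N" for z
    using c(1)[of "z" z] c(2)[of "flip z" z] that by simp_all
  then have "([z], [z]) \<in> rel N (Comp (Tens one bB) (Tens bBs one))" if "z \<in> letters N" for z
    using that by (blast intro: rel_compI)
  moreover have "w = w' \<and> w \<in> words N (Suc 0)" if "(w, v) \<in> rel N (Tens bBs one)" "(v, w') \<in> rel N (Tens one bB)" for w v w'
    using that unfolding rel_three by (elim CollectE exE conjE) (simp add: words_1)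
  then have "w = w' \<and> w \<in> words N (Suc 0)" if "(w, w') \<in> rel N (Comp (Tens one bB) (Tens bBs one))" for w w'
    using that by (blast elim: rel_compE)
  ultimately show ?case
  proof (intro equalityI subrelI)
    fix w w' assume "(w, w') \<in> rel N (Comp (Tens one bB) (Tens bBs one))"
    then have "w = w' \<and> w \<in> words N (Suc 0)"
      using \<open>\<And>w w'. (w, w') \<in> rel N (Comp (Tens one bB) (Tens bBs one)) \<Longrightarrow> w = w' \<and> w \<in> words N (Suc 0)\<close> by blast
    then show "(w, w') \<in> rel N one" by auto
  next
    fix w w' assume "(w, w') \<in> rel N one"
    then obtain z where "w = [z]" "w' = [z]" "z \<in> letters N" by (auto simp: words_1)
    then show "(w, w') \<in> rel N (Comp (Tens one bB) (Tens bBs one))"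
      using \<open>\<And>z. z \<in> letters N \<Longrightarrow> ([z], [z]) \<in> rel N (Comp (Tens one bB) (Tens bBs one))\<close> by blast
  qed
next
  case b_R3a
  show ?case
  proof (rule rel_eqI)
    fix w w' assume w': "w' \<in> words N (tgt (Comp (Tens one sS) (Tens bBs one)))" 
    then have "w' \<in> words N 3" by (simp del: One_nat_def)
    then obtain x y z where w: "w' = [x, y, z]" "x \<in> letters N" "y \<in> letters N" "z \<in> letters N" by (auto simp: words_3)
    show "((w, w') \<in> rel N (Comp (Tens one sS) (Tens bBs one))) =
       ((w, w') \<in> rel N (Comp (Tens sS one) (Tens one bBs)))"
      unfolding w(1) rel_comp_S1 rel_three using w(2-) by (auto simp: words_3)
  qed auto
next
  case b_R3b
  have c: "([], [y, flip y]) \<in> rel N bBs" "([flip y, y], [y, flip y]) \<in> rel N sS" if "y \<in> letters N" for y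
    using that flip_letters[of y N] unfolding rel.simps by blast+
  have e: "([], [x, flip x]) \<in> rel N (Comp sS bBs)" if "x \<in> letters N" for x
    by (rule rel_compI[of _ "[flip x, x]"]) (use c(1)[of "flip x"] c(2)[of x] that in simp_all)
  have d: "\<exists>x. w = [] \<and> w' = [x, flip x] \<and> x \<in> letters N" if ww: "(w, w') \<in> rel N (Comp sS bBs)" for w w'
  proof -
    obtain v where v: "(w, v) \<in> rel N bBs" "(v, w') \<in> rel N sS" using ww by (rule rel_compE)
    obtain x where x: "w = []" "v = [x, flip x]" "x \<in> letters N" using v(1) unfolding rel.simps by blast
    have "w' = [flip x, flip (flip x)]" using v(2) x unfolding rel.simps by auto
    then show ?thesis using x flip_letters[of x N] by blast
  qed
  show ?case unfolding rel.simps(3)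
  proof (intro equalityI subrelI)
    fix w w' assume "(w, w') \<in> rel N (Comp sS bBs)"
    from d[OF this] show "(w, w') \<in> {([], [x, flip x]) | x. x \<in> letters N}" by blast
  next
    fix w w' :: word assume "(w, w') \<in> {([], [x, flip x]) | x. x \<in> letters N}"
    then show "(w, w') \<in> rel N (Comp sS bBs)" using e by blast
  qed
qed auto

text \<open>A loop can carry any letter, so for \<open>N > 0\<close> its removal imposes nothing on
  the boundary. The signed count of its labellings is zero, but \<open>rel\<close> does not see the
  cancellation.\<close>

lemma rel_red: "red l f g \<Longrightarrow> N > 0 \<Longrightarrow> rel N f = rel N g"
proof (induction rule: red.induct)
  case red_loop
  have l: "(False, 0) \<in> letters N" using red_loop by (simp add: letters_iff)
  have "([], []) \<in> rel N (Comp bB bBs)"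
    by (rule rel_compI[of _ "[(False, 0), flip (False, 0)]"]) (use l in \<open>unfold rel.simps, blast+\<close>)
  moreover have "w = [] \<and> w' = []" if "(w, w') \<in> rel N (Comp bB bBs)" for w w'
    using rel_words[OF that] by simp
  ultimately show ?case by (auto simp del: rel.simps(5))
qed (simp_all add: rel_brel)

lemma rel_act:
  assumes "(w, p @ q @ r) \<in> rel N x" "(q, q') \<in> rel N g" "length p = k"
  shows "(w, p @ q' @ r) \<in> rel N (act k g x)"
proof -
  have l: "p @ q @ r \<in> words N (tgt x)" "length q = src g" using rel_words assms(1) rel_len[OF assms(2)] by auto
  then have "p \<in> words N k" "r \<in> words N (tgt x - k - src g)" using assms(3) by (auto simp: words_def)
  then have "(p @ q @ r, p @ q' @ r) \<in> rel N (wh k g (tgt x - k - src g))"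
    unfolding wh_def using assms(2) by (intro rel_tensI) auto
  then show ?thesis unfolding act_def using assms(1) by auto
qed

lemma rel_lcup:
  assumes "(w, z) \<in> rel N x" "j \<le> tgt x" "i < N"
  shows "\<exists>a p r. z = p @ r \<and> length p = j \<and> (w, (False, i) # p @ (True, i) # r) \<in> rel N (lcup j x)"
  using assms(2)
proof (induction j)
  case 0
  have "(w, [] @ [(False, i), flip (False, i)] @ z) \<in> rel N (cu 0 x)"
    by (rule rel_act[of _ _ "[]"]) (use assms in \<open>auto simp: letters_iff\<close>)
  then show ?case by (auto simp: flip_def)
next
  case (Suc j)
  then obtain p r where pr: "z = p @ r" "length p = j" "(w, (False, i) # p @ (True, i) # r) \<in> rel N (lcup j x)" by auto
  have "length z = tgt x" using rel_len assms by blast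
  then obtain c r' where r: "r = c # r'" using Suc.prems pr by (cases r) auto
  have c: "c \<in> letters N" using rel_words[OF pr(3)] r by (auto simp: words_def)
  have "(w, ((False, i) # p) @ [c, (True, i)] @ r') \<in> rel N (sw (Suc j) (lcup j x))"
    by (rule rel_act[of _ _ "[(True, i), c]"]) (use pr r c assms in \<open>auto simp: letters_iff\<close>)
  then have "(w, (False, i) # (p @ [c]) @ (True, i) # r') \<in> rel N (lcup (Suc j) x)" by simp
  moreover have "z = (p @ [c]) @ r'" "length (p @ [c]) = Suc j" using pr r by auto
  ultimately show ?case by blast
qed

text \<open>Labelling the cup added at stage \<open>m\<close> by the fresh index \<open>m\<close>
  gives every cup an index of its own, and crossings only permute letters.\<close>

lemma rel_cups:
  "js \<in> codes m \<Longrightarrow> m \<le> N \<Longrightarrow> \<exists>z. ([], z) \<in> rel N (cups js) \<and> (\<forall>i. count (mset (map snd z)) i = (if i < m then 2 else 0))"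
proof (induction m arbitrary: js)
  case (Suc m)
  then obtain j js' where js: "js = j # js'" "js' \<in> codes m" "j \<le> 2 * m" by auto
  then obtain z where z: "([], z) \<in> rel N (cups js')" "\<forall>i. count (mset (map snd z)) i = (if i < m then 2 else 0)"
    using Suc by auto
  obtain p r where "z = p @ r" "([], (False, m) # p @ (True, m) # r) \<in> rel N (lcup j (cups js'))"
    using rel_lcup[OF z(1), of j m] js Suc.prems by auto
  then show ?case using z(2) js by (intro exI[of _ "(False, m) # p @ (True, m) # r"]) (auto simp: less_Suc_eq)
qed auto

lemma rel_unbend: "(w, flip u # w') \<in> rel N x \<Longrightarrow> (u # w, w') \<in> rel N (unbend x)"
proof -
  assume a: "(w, flip u # w') \<in> rel N x"
  then have l: "flip u # w' \<in> words N (tgt x)" using rel_words by blast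
  then have u: "u \<in> letters N" "w' \<in> words N (tgt x - 1)" by (auto simp: words_def letters_iff)
  have "([u] @ w, [u] @ flip u # w') \<in> rel N (Tens one x)"
    by (rule rel_tensI) (use a u in \<open>auto simp: words_1\<close>)
  then have 1: "(u # w, u # flip u # w') \<in> rel N (Tens one x)" by (simp del: rel.simps)
  have "([u, flip u] @ w', [] @ w') \<in> rel N (Tens bB (Idn (tgt x - 1)))"
    by (rule rel_tensI) (use u in auto)
  then have 2: "(u # flip u # w', w') \<in> rel N (Tens bB (Idn (tgt x - 1)))" by (simp del: rel.simps)
  show ?thesis unfolding unbend_def by (rule rel_compI[OF 1 2])
qed

text \<open>Bending moves the first output letter to the input and flips only its parity, so the
  multiset of indices remains that of \<open>rel_cups\<close>.\<close>

lemma rel_std: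
  assumes "js \<in> codes m" "a + b = 2 * m" "m \<le> N"
  shows "\<exists>w w'. (w, w') \<in> rel N (std a js) \<and> (\<forall>i. count (mset (map snd (w @ w'))) i \<le> 2)"
  using assms(2)
proof (induction a arbitrary: b)
  case 0
  obtain z where "([], z) \<in> rel N (cups js)" "\<forall>i. count (mset (map snd z)) i = (if i < m then 2 else 0)"
    using rel_cups assms by blast
  then show ?case by (intro exI[of _ "[]"] exI[of _ z]) auto
next
  case (Suc a)
  then obtain w w' where 1: "(w, w') \<in> rel N (std a js)" "\<forall>i. count (mset (map snd (w @ w'))) i \<le> 2"
    using Suc.IH[of "Suc b"] by auto
  have "length w' = Suc b" using std_type[OF assms(1), of a "Suc b"] rel_len[OF 1(1)] Suc.prems by simp
  then obtain u v where w': "w' = u # v" by (cases w') auto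
  have "(flip u # w, v) \<in> rel N (std (Suc a) js)"
    unfolding std.simps by (rule rel_unbend) (use 1 w' in simp)
  moreover have "mset (map snd ((flip u # w) @ v)) = mset (map snd (w @ w'))" using w' by simp
  ultimately show ?case using 1(2) by metis
qed

text \<open>Polymorphic in the labels because it serves twice: with \<open>t = flip\<close> for the
  letters of the representation, and with the identity for the string labels from which normal
  diagrams are built.\<close>

fun lrel :: "('l \<Rightarrow> 'l) \<Rightarrow> layer \<Rightarrow> 'l list \<Rightarrow> 'l list \<Rightarrow> bool" where
  "lrel t [] v v' \<longleftrightarrow> v = [] \<and> v' = []"
| "lrel t (I1 # L) v v' \<longleftrightarrow> (\<exists>x u u'. v = x # u \<and> v' = x # u' \<and> lrel t L u u')"
| "lrel t (Sx # L) v v' \<longleftrightarrow> (\<exists>x y u u'. v = x # y # u \<and> v' = y # x # u' \<and> lrel t L u u')"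
| "lrel t (Cap # L) v v' \<longleftrightarrow> (\<exists>x u. v = x # t x # u \<and> lrel t L u v')"
| "lrel t (Cup # L) v v' \<longleftrightarrow> (\<exists>x u'. v' = x # t x # u' \<and> lrel t L v u')"

lemma lrel_length: "lrel t L v v' \<Longrightarrow> length v = lsrc L \<and> length v' = ltgt L"
  by (induction t L v v' rule: lrel.induct) (auto simp: lsrc_def ltgt_def)

lemma rel_layer_Cons: "rel N (layer_mor (x # L)) = rel N (Tens (item_mor x) (layer_mor L))"
  by (cases L) auto

lemma mat_layer_Cons: "mat N (layer_mor (x # L)) w w' = mat N (Tens (item_mor x) (layer_mor L)) w w'"
  by (cases L) (simp_all only: layer_mor.simps mat_tens_unit)

lemma rel_tens_item:
  "(v, v') \<in> rel N (Tens one f) \<longleftrightarrow> (\<exists>x u u'. v = x # u \<and> v' = x # u' \<and> x \<in> letters N \<and> (u, u') \<in> rel N f)"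
  "(v, v') \<in> rel N (Tens sS f) \<longleftrightarrow> (\<exists>x y u u'. v = x # y # u \<and> v' = y # x # u' \<and> x \<in> letters N \<and> y \<in> letters N \<and> (u, u') \<in> rel N f)"
  "(v, v') \<in> rel N (Tens bB f) \<longleftrightarrow> (\<exists>x u. v = x # flip x # u \<and> x \<in> letters N \<and> (u, v') \<in> rel N f)"
  "(v, v') \<in> rel N (Tens bBs f) \<longleftrightarrow> (\<exists>x u'. v' = x # flip x # u' \<and> x \<in> letters N \<and> (v, u') \<in> rel N f)"
proof -
  have 1: "(x # u, x # u') \<in> rel N (Tens one f)" if "x \<in> letters N" "(u, u') \<in> rel N f" for x u u'
    using rel_tensI[of "[x]" "[x]" N one u u' f] that by (simp add: words_1 del: rel.simps(6))
  have 2: "(x # y # u, y # x # u') \<in> rel N (Tens sS f)" if "x \<in> letters N" "y \<in> letters N" "(u, u') \<in> rel N f" for x y u u'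
    using rel_tensI[of "[x, y]" "[y, x]" N sS u u' f] that by (simp del: rel.simps(6))
  have 3: "(x # flip x # u, u') \<in> rel N (Tens bB f)" if "x \<in> letters N" "(u, u') \<in> rel N f" for x u u'
    using rel_tensI[of "[x, flip x]" "[]" N bB u u' f] that by (simp del: rel.simps(6))
  have 4: "(u, x # flip x # u') \<in> rel N (Tens bBs f)" if "x \<in> letters N" "(u, u') \<in> rel N f" for x u u'
    using rel_tensI[of "[]" "[x, flip x]" N bBs u u' f] that by (simp del: rel.simps(6))
  show "(v, v') \<in> rel N (Tens one f) \<longleftrightarrow> (\<exists>x u u'. v = x # u \<and> v' = x # u' \<and> x \<in> letters N \<and> (u, u') \<in> rel N f)"
    using 1 by (auto simp: words_1 elim!: rel_tensE simp del: rel.simps(6))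
  show "(v, v') \<in> rel N (Tens sS f) \<longleftrightarrow> (\<exists>x y u u'. v = x # y # u \<and> v' = y # x # u' \<and> x \<in> letters N \<and> y \<in> letters N \<and> (u, u') \<in> rel N f)"
    using 2 by (auto elim!: rel_tensE simp del: rel.simps(6))
  show "(v, v') \<in> rel N (Tens bB f) \<longleftrightarrow> (\<exists>x u. v = x # flip x # u \<and> x \<in> letters N \<and> (u, v') \<in> rel N f)"
    using 3 by (auto elim!: rel_tensE simp del: rel.simps(6))
  show "(v, v') \<in> rel N (Tens bBs f) \<longleftrightarrow> (\<exists>x u'. v' = x # flip x # u' \<and> x \<in> letters N \<and> (v, u') \<in> rel N f)"
    using 4 by (auto elim!: rel_tensE simp del: rel.simps(6))
qed

lemma rel_layer: "(v, v') \<in> rel N (layer_mor L) \<longleftrightarrow> lrel flip L v v' \<and> set v \<subseteq> letters N \<and> set v' \<subseteq> letters N"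
proof (induction L arbitrary: v v')
  case (Cons x L)
  show ?case unfolding rel_layer_Cons
    by (cases x; simp only: item_mor.simps rel_tens_item Cons.IH lrel.simps; fastforce)
qed auto

text \<open>A single layer involves no summation, so nothing can cancel.\<close>

lemma mat_layer: "(v, v') \<in> rel N (layer_mor L) \<Longrightarrow> mat N (layer_mor L) v v' \<noteq> 0"
proof (induction L arbitrary: v v')
  case (Cons x L)
  obtain u w u' w' where 1: "v = u @ w" "v' = u' @ w'" "(u, u') \<in> rel N (item_mor x)" "(w, w') \<in> rel N (layer_mor L)"
    "length u = src (item_mor x)" "length u' = tgt (item_mor x)"
    using Cons.prems[unfolded rel_layer_Cons] by (rule rel_tensE)
  have "mat N (item_mor x) u u' \<noteq> 0" using 1(3) by (cases x) (auto simp: sg_def split: if_splits)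
  then show ?case unfolding mat_layer_Cons 1(1,2) using mat_tens[OF 1(5,6)] Cons.IH[OF 1(4)] by simp
qed auto

section \<open>Connectedness and labels\<close>

definition path :: "('l \<Rightarrow> 'l) \<Rightarrow> diagram \<Rightarrow> 'l list list \<Rightarrow> bool" where
  "path t D W \<longleftrightarrow> length W = Suc (length D) \<and> (\<forall>i < length D. lrel t (D ! i) (W ! i) (W ! Suc i))"

lemma path_snoc: "length W = Suc (length D) \<Longrightarrow> path t (D @ [L]) (W @ [w]) \<longleftrightarrow> path t D W \<and> lrel t L (W ! length D) w"
proof -
  assume l: "length W = Suc (length D)"
  have "(\<forall>i<length D. lrel t ((D @ [L]) ! i) ((W @ [w]) ! i) ((W @ [w]) ! Suc i)) \<longleftrightarrow>
    (\<forall>i<length D. lrel t (D ! i) (W ! i) (W ! Suc i))"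
    by (rule all_cong) (simp add: nth_append l)
  moreover have "(D @ [L]) ! length D = L" "(W @ [w]) ! length D = W ! length D" "(W @ [w]) ! Suc (length D) = w"
    using l by (simp_all add: nth_append)
  ultimately show ?thesis unfolding path_def using l by (simp only: length_append_singleton All_less_Suc) auto
qed

lemma diag_snoc: "D \<noteq> [] \<Longrightarrow> diag_mor (D @ [L]) = Comp (layer_mor L) (diag_mor D)"
  by (cases D) auto

definition lpath :: "nat \<Rightarrow> diagram \<Rightarrow> word list \<Rightarrow> bool" where
  "lpath N D W \<longleftrightarrow> path flip D W \<and> (\<forall>v\<in>set W. set v \<subseteq> letters N)"

lemma lpath_nth: "lpath N D W \<Longrightarrow> i \<le> length D \<Longrightarrow> set (W ! i) \<subseteq> letters N"
  unfolding lpath_def path_def by (metis le_imp_less_Suc nth_mem)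

lemma lpath_length: "lpath N D W \<Longrightarrow> length W = Suc (length D)"
  by (simp add: lpath_def path_def)

lemma lpath_snoc: "length W = Suc (length D) \<Longrightarrow>
   lpath N (D @ [L]) (W @ [w]) \<longleftrightarrow> lpath N D W \<and> lrel flip L (W ! length D) w \<and> set w \<subseteq> letters N"
  unfolding lpath_def by (simp add: path_snoc) blast

lemma butlast_decomp:
  assumes "length W = Suc (Suc n)"
  shows "W = butlast W @ [W ! Suc n]" "length (butlast W) = Suc n" "i \<le> n \<Longrightarrow> butlast W ! i = W ! i"
proof -
  have "W \<noteq> []" using assms by auto
  then show "W = butlast W @ [W ! Suc n]" using assms
    by (metis append_butlast_last_id diff_Suc_1 last_conv_nth)
  show "length (butlast W) = Suc n" using assms by simp
  then show "i \<le> n \<Longrightarrow> butlast W ! i = W ! i" by (simp add: nth_butlast)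
qed

lemma lpath_snocE:
  assumes "lpath N (D @ [L]) W"
  obtains U where "lpath N D U" "U ! 0 = W ! 0" "lrel flip L (U ! length D) (W ! Suc (length D))"
    "set (W ! Suc (length D)) \<subseteq> letters N" "W = U @ [W ! Suc (length D)]"
proof -
  have l: "length W = Suc (Suc (length D))" using lpath_length[OF assms] by simp
  note d = butlast_decomp[OF l]
  have "lpath N (D @ [L]) (butlast W @ [W ! Suc (length D)])" using assms d(1) by simp
  then have "lpath N D (butlast W)" "lrel flip L (butlast W ! length D) (W ! Suc (length D))"
    "set (W ! Suc (length D)) \<subseteq> letters N" using lpath_snoc[OF d(2)] by blast+
  then show ?thesis using that[of "butlast W"] d(1) d(3)[of 0] by simp
qed

lemma lpath_snocI:
  assumes "lpath N D U" "lrel flip L (U ! length D) w" "set w \<subseteq> letters N"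
  shows "lpath N (D @ [L]) (U @ [w])" "(U @ [w]) ! 0 = U ! 0" "(U @ [w]) ! length (D @ [L]) = w"
  using assms lpath_length[OF assms(1)] lpath_snoc[OF lpath_length[OF assms(1)]] by (simp_all add: nth_append)

lemma rel_diag:
  "D \<noteq> [] \<Longrightarrow> (w, w') \<in> rel N (diag_mor D) \<longleftrightarrow> (\<exists>W. lpath N D W \<and> W ! 0 = w \<and> W ! length D = w')"
proof (induction D arbitrary: w' rule: rev_induct)
  case (snoc L D)
  show ?case
  proof (cases "D = []")
    case True
    have 1: "lpath N [L] [w, w']" if "(w, w') \<in> rel N (layer_mor L)"
      using that[unfolded rel_layer] by (simp add: lpath_def path_def)
    have 2: "(W ! 0, W ! Suc 0) \<in> rel N (layer_mor L)" if "lpath N [L] W" for W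
      using that lpath_nth[OF that, of 0] lpath_nth[OF that, of 1] unfolding rel_layer by (simp add: lpath_def path_def)
    show ?thesis
    proof
      assume "(w, w') \<in> rel N (diag_mor (D @ [L]))"
      then have "lpath N [L] [w, w']" using 1 True by simp
      then show "\<exists>W. lpath N (D @ [L]) W \<and> W ! 0 = w \<and> W ! length (D @ [L]) = w'"
        using True by (intro exI[of _ "[w, w']"]) simp
    next
      assume "\<exists>W. lpath N (D @ [L]) W \<and> W ! 0 = w \<and> W ! length (D @ [L]) = w'"
      then show "(w, w') \<in> rel N (diag_mor (D @ [L]))" using 2 True by auto
    qed
  next
    case False
    show ?thesis
    proof
      assume "(w, w') \<in> rel N (diag_mor (D @ [L]))"
      then obtain v where v: "(w, v) \<in> rel N (diag_mor D)" "(v, w') \<in> rel N (layer_mor L)"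
        unfolding diag_snoc[OF False] by (rule rel_compE)
      obtain U where U: "lpath N D U" "U ! 0 = w" "U ! length D = v" using v(1) snoc.IH[OF False] by blast
      have "lrel flip L (U ! length D) w'" "set w' \<subseteq> letters N" using v(2) U unfolding rel_layer by auto
      from lpath_snocI[OF U(1) this] show "\<exists>W. lpath N (D @ [L]) W \<and> W ! 0 = w \<and> W ! length (D @ [L]) = w'"
        using U(2) by blast
    next
      assume "\<exists>W. lpath N (D @ [L]) W \<and> W ! 0 = w \<and> W ! length (D @ [L]) = w'"
      then obtain W where W: "lpath N (D @ [L]) W" "W ! 0 = w" "W ! Suc (length D) = w'" by auto
      obtain U where U: "lpath N D U" "U ! 0 = w" "lrel flip L (U ! length D) w'" "set w' \<subseteq> letters N"
        using lpath_snocE[OF W(1)] W(2,3) by metis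
      have "(w, U ! length D) \<in> rel N (diag_mor D)" using snoc.IH[OF False] U by blast
      moreover have "(U ! length D, w') \<in> rel N (layer_mor L)" 
        unfolding rel_layer using U lpath_nth[OF U(1), of "length D"] by blast
      ultimately show "(w, w') \<in> rel N (diag_mor (D @ [L]))" unfolding diag_snoc[OF False] by (rule rel_compI)
    qed
  qed
qed simp

text \<open>Induction on the layers from the top. Uniqueness of the labelling leaves one nonzero
  term in the sum over words below the top layer. The lower part inherits uniqueness, since each of
  its labellings that fits the top layer extends.\<close>

lemma mat_diag_unique:
  "D \<noteq> [] \<Longrightarrow> lpath N D W \<Longrightarrow> (\<And>W'. lpath N D W' \<Longrightarrow> W' ! 0 = W ! 0 \<Longrightarrow> W' ! length D = W ! length D \<Longrightarrow> W' = W)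
   \<Longrightarrow> mat N (diag_mor D) (W ! 0) (W ! length D) \<noteq> 0"
proof (induction D arbitrary: W rule: rev_induct)
  case (snoc L D)
  show ?case
  proof (cases "D = []")
    case True
    then have "(W ! 0, W ! Suc 0) \<in> rel N (diag_mor (D @ [L]))"
      using snoc.prems(2) rel_diag[of "D @ [L]"] by auto
    then show ?thesis using True mat_layer by simp
  next
    case False
    let ?w = "W ! 0" and ?w' = "W ! Suc (length D)"
    obtain U where U: "lpath N D U" "U ! 0 = ?w" "lrel flip L (U ! length D) ?w'" "set ?w' \<subseteq> letters N"
        "W = U @ [?w']"
      using snoc.prems(2) by (rule lpath_snocE)
    let ?v = "U ! length D"
    have ext: "T = U" if T: "lpath N D T" "T ! 0 = ?w" "lrel flip L (T ! length D) ?w'" for T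
    proof -
      note e = lpath_snocI[OF T(1,3) U(4)]
      have "T @ [?w'] = W" by (rule snoc.prems(3)[OF e(1)]) (use e T in simp_all)
      then show ?thesis using U(5) by (metis butlast_snoc)
    qed
    have IH: "mat N (diag_mor D) (U ! 0) ?v \<noteq> 0"
      by (rule snoc.IH[OF False U(1)]) (use ext U in metis)
    have "(?v, ?w') \<in> rel N (layer_mor L)"
      unfolding rel_layer using U lpath_nth[OF U(1), of "length D"] by blast
    then have nz: "mat N (layer_mor L) ?v ?w' \<noteq> 0" by (rule mat_layer)
    have "mat N (diag_mor (D @ [L])) ?w ?w' = (\<Sum>v\<in>words N (tgt (diag_mor D)). mat N (diag_mor D) ?w v * mat N (layer_mor L) v ?w')"
      unfolding diag_snoc[OF False] by simp
    also have "\<dots> = mat N (diag_mor D) ?w ?v * mat N (layer_mor L) ?v ?w'"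
    proof (rule sum_eq_single)
      fix v assume "v \<noteq> ?v"
      show "mat N (diag_mor D) ?w v * mat N (layer_mor L) v ?w' = 0"
      proof (rule ccontr)
        assume "mat N (diag_mor D) ?w v * mat N (layer_mor L) v ?w' \<noteq> 0"
        then have m: "(?w, v) \<in> rel N (diag_mor D)" "(v, ?w') \<in> rel N (layer_mor L)" using mat_rel by auto
        obtain T where "lpath N D T" "T ! 0 = ?w" "T ! length D = v"
          using m(1) rel_diag[OF False] by blast
        then show False using ext[of T] \<open>v \<noteq> ?v\<close> m(2) unfolding rel_layer by blast
      qed
    next
      assume "?v \<notin> words N (tgt (diag_mor D))"
      then show "mat N (diag_mor D) ?w ?v * mat N (layer_mor L) ?v ?w' = 0" using mat_words by fastforce
    qed simp
    finally show ?thesis using IH nz U(2) by simp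
  qed
qed simp

lemma lrel_Cons_drop: "lrel t (y # L) w w' \<Longrightarrow> lrel t L (drop (isrc y) w) (drop (itgt y) w')"
  by (cases y) auto

text \<open>The offsets \<open>ob\<close> and \<open>ot\<close> count the labels already dropped, so
  that the item of an occurrence stands at the head of the rest of the layer.\<close>

lemma occ_lrel:
  "lrel t L (drop ob v) (drop ot v') \<Longrightarrow> (x, p, q) \<in> layer_occs ob ot L \<Longrightarrow>
     \<exists>L'. lrel t (x # L') (drop p v) (drop q v')"
proof (induction L arbitrary: ob ot)
  case (Cons y L)
  show ?case
  proof (cases "(x, p, q) = (y, ob, ot)")
    case True
    then show ?thesis using Cons.prems by blast
  next
    case False
    then have "(x, p, q) \<in> layer_occs (ob + isrc y) (ot + itgt y) L" using Cons.prems by auto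
    moreover have "lrel t L (drop (ob + isrc y) v) (drop (ot + itgt y) v')"
      using lrel_Cons_drop[OF Cons.prems(1)] by (simp add: add.commute)
    ultimately show ?thesis using Cons.IH by blast
  qed
qed simp

lemma occ_cover:
  "lrel t L (drop ob v) v' \<Longrightarrow> ob \<le> p \<Longrightarrow> p < length v \<Longrightarrow>
     \<exists>x r q. (x, r, q) \<in> layer_occs ob ot L \<and> r \<le> p \<and> p < r + isrc x"
proof (induction L arbitrary: ob ot v')
  case (Cons y L)
  show ?case
  proof (cases "p < ob + isrc y")
    case True
    then show ?thesis using Cons.prems by auto
  next
    case False
    have "lrel t L (drop (ob + isrc y) v) (drop (itgt y) v')"
      using lrel_Cons_drop[OF Cons.prems(1)] by (simp add: add.commute)
    from Cons.IH[OF this _ Cons.prems(3), of "ot + itgt y"] False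
    show ?thesis by (auto simp del: split_paired_Ex)
  qed
qed auto

lemma drop_Cons_nth: "drop p v = a # r \<Longrightarrow> p < length v \<and> v ! p = a \<and> drop (Suc p) v = r"
  by (metis Cons_nth_drop_Suc drop_all linorder_not_less list.distinct(1) list.inject)

definition lab :: "'l list list \<Rightarrow> nat \<times> nat \<Rightarrow> 'l" where "lab W u = W ! fst u ! snd u"

definition vertex :: "'l list list \<Rightarrow> nat \<times> nat \<Rightarrow> bool" where
  "vertex W u \<longleftrightarrow> fst u < length W \<and> snd u < length (W ! fst u)"

lemma edge_occ:
  assumes "(u, v) \<in> edges D"
  obtains x i ob ot where "i < length D" "(x, ob, ot) \<in> layer_occs 0 0 (D ! i)" "(u, v) \<in> item_edges i ob ot x"
  using assms unfolding edges_def occs_def by blast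

lemma path_occ:
  assumes "path t D W" "i < length D" "(x, ob, ot) \<in> layer_occs 0 0 (D ! i)"
  shows "\<exists>L'. lrel t (x # L') (drop ob (W ! i)) (drop ot (W ! Suc i))"
  by (rule occ_lrel[OF _ assms(3)]) (use assms in \<open>simp add: path_def\<close>)

lemma path_edge:
  assumes "path t D W" "i < length D" "(x, ob, ot) \<in> layer_occs 0 0 (D ! i)" "(u, v) \<in> item_edges i ob ot x"
  shows "lab W v = (if x = Cap \<or> x = Cup then t (lab W u) else lab W u)" "vertex W u" "vertex W v"
proof -
  have l: "length W = Suc (length D)" using assms(1) by (simp add: path_def)
  obtain L' where L': "lrel t (x # L') (drop ob (W ! i)) (drop ot (W ! Suc i))" using path_occ[OF assms(1-3)] by blast
  then show "lab W v = (if x = Cap \<or> x = Cup then t (lab W u) else lab W u)" "vertex W u" "vertex W v"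
    using assms(2,4) l by (cases x; auto simp: lab_def vertex_def dest!: drop_Cons_nth)+
qed

text \<open>The disjunction stands outside the quantifiers over \<open>W\<close>: which rule applies
  depends on the edge alone. Two labellings therefore propagate along an edge by the same rule, as
  \<open>path_unique\<close> needs.\<close>

lemma edges_lab:
  assumes "(u, v) \<in> edges D"
  shows "(\<forall>W. path t D W \<longrightarrow> lab W v = lab W u) \<or> (\<forall>W. path t D W \<longrightarrow> lab W v = t (lab W u))"
proof -
  obtain x i ob ot where *: "i < length D" "(x, ob, ot) \<in> layer_occs 0 0 (D ! i)" "(u, v) \<in> item_edges i ob ot x"
    using assms by (rule edge_occ)
  show ?thesis using path_edge(1)[OF _ *] by (cases "x = Cap \<or> x = Cup") auto
qed

lemma edges_vertex:
  assumes "(u, v) \<in> edges D" "path t D W" shows "vertex W u" "vertex W v"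
proof -
  obtain x i ob ot where *: "i < length D" "(x, ob, ot) \<in> layer_occs 0 0 (D ! i)" "(u, v) \<in> item_edges i ob ot x"
    using assms(1) by (rule edge_occ)
  show "vertex W u" "vertex W v" using path_edge(2,3)[OF assms(2) *] by auto
qed

lemma vertex_edge:
  assumes "path t D W" "i < length D" "p < length (W ! i)"
  shows "\<exists>u v. (u, v) \<in> edges D \<and> (u = (i, p) \<or> v = (i, p))"
proof -
  have "lrel t (D ! i) (drop 0 (W ! i)) (W ! Suc i)" using assms by (simp add: path_def)
  then obtain x r q where x: "(x, r, q) \<in> layer_occs 0 0 (D ! i)" "r \<le> p" "p < r + isrc x"
    using occ_cover[OF _ le0 assms(3)] by blast
  then have "p = r \<or> p = Suc r \<and> (x = Sx \<or> x = Cap)" by (cases x) auto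
  then have "\<exists>u v. (u, v) \<in> item_edges i r q x \<and> (u = (i, p) \<or> v = (i, p))"
  proof (cases x)
    case I1
    then show ?thesis using x \<open>p = r \<or> _\<close> by (intro exI[of _ "(i, r)"] exI[of _ "(Suc i, q)"]) simp
  next
    case Sx
    then show ?thesis using \<open>p = r \<or> _\<close> by simp blast
  next
    case Cap
    then show ?thesis using \<open>p = r \<or> _\<close> by (intro exI[of _ "(i, r)"] exI[of _ "(i, Suc r)"]) auto
  next
    case Cup
    then show ?thesis using x by simp
  qed
  moreover have "item_edges i r q x \<subseteq> edges D" unfolding edges_def occs_def using x(1) assms(2) by blast
  ultimately show ?thesis by blast
qed

lemma conn_induct:
  assumes "conn D u v" "P u"
    "\<And>x y. (x, y) \<in> edges D \<Longrightarrow> P x = P y"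
  shows "P v"
  using assms(1) unfolding conn_def
proof (induction rule: rtrancl_induct)
  case base then show ?case using assms(2) .
next
  case (step y z) then show ?case using assms(3) by blast
qed

lemma conn_idx: 
  assumes "path flip D W" "conn D u v"
  shows "snd (lab W u) = snd (lab W v)"
proof -
  have "snd (lab W u) = snd (lab W x) \<longleftrightarrow> snd (lab W u) = snd (lab W y)" if "(x, y) \<in> edges D" for x y
    using edges_lab[OF that, of flip] assms(1) by auto
  from conn_induct[OF assms(2), of "\<lambda>x. snd (lab W u) = snd (lab W x)", OF refl this] show ?thesis .
qed

text \<open>Without loops every point is connected to the boundary. Along an edge the label is
  either kept or changed by the involution \<open>t\<close>, both injective, so agreement on the
  boundary spreads to all points.\<close>

lemma path_unique:
  assumes nl: "no_loops a b D" and W: "path t D W" and W': "path t D W'" and t: "\<And>x. t (t x) = x"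
    and e: "W ! 0 = W' ! 0" "W ! length D = W' ! length D"
  shows "W = W'"
proof (rule nth_equalityI)
  show "length W = length W'" using W W' by (simp add: path_def)
  fix i assume "i < length W"
  then have i: "i \<le> length D" using W by (simp add: path_def)
  show "W ! i = W' ! i"
  proof (cases "i = length D")
    case False
    then have i: "i < length D" using i by simp
    have inj: "t x = t y \<Longrightarrow> x = y" for x y using t by metis
    have ag: "lab W x = lab W' x \<longleftrightarrow> lab W y = lab W' y" if "(x, y) \<in> edges D" for x y
      using edges_lab[OF that, of t] W W' inj by metis
    show ?thesis
    proof (rule nth_equalityI)
      show "length (W ! i) = length (W' ! i)"
        using W W' i lrel_length unfolding path_def by metis
      fix p assume "p < length (W ! i)"
      then obtain u v where uv: "(u, v) \<in> edges D" "u = (i, p) \<or> v = (i, p)"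
        using vertex_edge[OF W i] by blast
      obtain x where x: "x \<in> pts a b" "conn D u (vtx D x)" using nl uv(1) unfolding no_loops_def by blast
      have "lab W (vtx D x) = lab W' (vtx D x)" using e by (cases x) (auto simp: lab_def)
      moreover have "conn D (vtx D x) u" using x(2) unfolding conn_def
        by (metis converse_Un converse_converse rtrancl_converseI sup_commute)
      ultimately have "lab W u = lab W' u"
        using conn_induct[of D "vtx D x" u "\<lambda>u. lab W u = lab W' u"] ag by blast
      then have "lab W (i, p) = lab W' (i, p)" using ag[OF uv(1)] uv(2) by blast
      then show "W ! i ! p = W' ! i ! p" by (simp add: lab_def)
    qed
  qed (use e in simp)
qed

lemma layer_type: "src (layer_mor L) = lsrc L \<and> tgt (layer_mor L) = ltgt L \<and> wt (layer_mor L)"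
proof (induction L rule: layer_mor.induct)
  case (2 x)
  then show ?case by (cases x) (auto simp: lsrc_def ltgt_def)
next
  case (3 x y L)
  then show ?case by (cases x) (auto simp: lsrc_def ltgt_def)
qed (auto simp: lsrc_def ltgt_def)

lemma diag_type: "is_diagram a b D \<Longrightarrow> wt (diag_mor D) \<and> src (diag_mor D) = a \<and> tgt (diag_mor D) = b"
proof (induction D arbitrary: b rule: rev_induct)
  case (snoc L D)
  show ?case
  proof (cases "D = []")
    case True
    then show ?thesis using snoc.prems layer_type[of L] by (simp add: is_diagram_def)
  next
    case False
    have c: "ltgt ((D @ [L]) ! i) = lsrc ((D @ [L]) ! Suc i)" if "Suc i < length (D @ [L])" for i
      using snoc.prems that unfolding is_diagram_def by blast
    have "ltgt (last D) = lsrc L"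
      using c[of "length D - 1"] False by (simp add: nth_append last_conv_nth)
    moreover have "is_diagram a (ltgt (last D)) D"
      unfolding is_diagram_def
    proof (intro conjI allI impI)
      fix i assume "Suc i < length D"
      then show "ltgt (D ! i) = lsrc (D ! Suc i)" using c[of i] by (simp add: nth_append)
    qed (use False snoc.prems in \<open>auto simp: is_diagram_def\<close>)
    ultimately show ?thesis using snoc.IH[of "ltgt (last D)"] snoc.prems layer_type[of L]
      unfolding diag_snoc[OF False] by (simp add: is_diagram_def)
  qed
qed (simp add: is_diagram_def)

section \<open>Separating diagrams by matrix entries\<close>

definition admissible :: "nat \<Rightarrow> nat \<Rightarrow> diagram \<Rightarrow> bool" where
  "admissible a b D \<longleftrightarrow> is_diagram a b D \<and> no_loops a b D \<and> connector a b D \<in> Conn a b"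

fun idx :: "word \<Rightarrow> word \<Rightarrow> pt \<Rightarrow> nat" where
  "idx w w' (Bot p) = snd (w ! p)"
| "idx w w' (Top q) = snd (w' ! q)"

lemma connector_idx:
  assumes "path flip D W" "e \<in> connector a b D"
  shows "\<exists>x y. e = {x, y} \<and> x \<noteq> y \<and> x \<in> pts a b \<and> y \<in> pts a b \<and>
     idx (W ! 0) (W ! length D) x = idx (W ! 0) (W ! length D) y"
proof -
  obtain x y where e: "e = {x, y}" "x \<in> pts a b" "y \<in> pts a b" "x \<noteq> y" "conn D (vtx D x) (vtx D y)"
    using assms(2) unfolding connector_def by blast
  have "snd (lab W (vtx D z)) = idx (W ! 0) (W ! length D) z" for z
    by (cases z) (auto simp: lab_def)
  then have "idx (W ! 0) (W ! length D) x = idx (W ! 0) (W ! length D) y"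
    using conn_idx[OF assms(1) e(5)] by simp
  then show ?thesis using e(1-4) by blast
qed

text \<open>\<open>pos\<close> numbers the boundary points by their places in \<open>w @ w'\<close>.
  Three points of the same index would be three occurrences of it in that word.\<close>

lemma idx_two:
  assumes len: "length w = a" "length w' = b" and c: "\<And>i. count (mset (map snd (w @ w'))) i \<le> 2"
    and p: "x \<in> pts a b" "y \<in> pts a b" "z \<in> pts a b" and i: "idx w w' x = idx w w' y" "idx w w' x = idx w w' z"
    and d: "x \<noteq> y" "x \<noteq> z"
  shows "y = z"
proof (rule ccontr)
  assume "y \<noteq> z"
  define pos where "pos = (\<lambda>x. case x of Bot p \<Rightarrow> p | Top q \<Rightarrow> a + q)"
  let ?l = "map snd (w @ w')"
  have pos: "pos u < length ?l" "?l ! pos u = idx w w' u" if "u \<in> pts a b" for u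
    using that len by (auto simp: pts_def pos_def nth_append)
  have inj: "inj_on pos (pts a b)" by (auto simp: inj_on_def pts_def pos_def)
  have "card {pos x, pos y, pos z} = 3"
    using inj p d \<open>y \<noteq> z\<close> by (auto simp: inj_on_eq_iff)
  moreover have "{pos x, pos y, pos z} \<subseteq> {k. k < length ?l \<and> idx w w' x = ?l ! k}"
    using pos(1)[OF p(1)] pos(1)[OF p(2)] pos(1)[OF p(3)] pos(2)[OF p(1)] pos(2)[OF p(2)] pos(2)[OF p(3)] i
    by (simp only: insert_subset empty_subsetI mem_Collect_eq simp_thms)
  ultimately have "3 \<le> card {k. k < length ?l \<and> idx w w' x = ?l ! k}"
    using card_mono[of "{k. k < length ?l \<and> idx w w' x = ?l ! k}" "{pos x, pos y, pos z}"] by simp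
  also have "\<dots> = count (mset ?l) (idx w w' x)"
    unfolding count_mset count_list_eq_length_filter length_filter_conv_card ..
  finally show False using c[of "idx w w' x"] by simp
qed

text \<open>If no value of \<open>f\<close> is taken at three points, the partner of a point can
  only be the other point with the same value, so \<open>f\<close> leaves no choice for the
  matching.\<close>

lemma Conn_eq:
  assumes c: "c \<in> Conn a b" "c' \<in> Conn a b"
    and f: "\<And>e. e \<in> c \<union> c' \<Longrightarrow> \<exists>x y. e = {x, y} \<and> x \<noteq> y \<and> x \<in> pts a b \<and> y \<in> pts a b \<and> f x = f y"
    and two: "\<And>x y z. x \<in> pts a b \<Longrightarrow> y \<in> pts a b \<Longrightarrow> z \<in> pts a b \<Longrightarrow> f x = f y \<Longrightarrow> f x = f z
       \<Longrightarrow> x \<noteq> y \<Longrightarrow> x \<noteq> z \<Longrightarrow> y = z"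
  shows "c = c'"
proof -
  have *: "e \<in> c2" if e: "e \<in> c1" "c1 \<union> c2 \<subseteq> c \<union> c'" and c2: "c2 \<in> Conn a b" for e c1 c2
  proof -
    have "e \<in> c \<union> c'" using e by blast
    from f[OF this] obtain x y where xy: "e = {x, y}" "x \<noteq> y" "x \<in> pts a b" "y \<in> pts a b" "f x = f y"
      by blast
    from c2 xy(3) obtain e' where e': "e' \<in> c2" "x \<in> e'" unfolding Conn_def by blast
    have "e' \<in> c \<union> c'" using e'(1) e(2) by blast
    from f[OF this] obtain p q where pq: "e' = {p, q}" "p \<noteq> q" "p \<in> pts a b" "q \<in> pts a b" "f p = f q"
      by blast
    have "\<exists>z. e' = {x, z} \<and> x \<noteq> z \<and> z \<in> pts a b \<and> f x = f z"
    proof (cases "x = p")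
      case True
      then show ?thesis using pq by (intro exI[of _ q]) simp
    next
      case False
      then have "x = q" using pq(1) e'(2) by simp
      then show ?thesis using pq by (intro exI[of _ p]) (simp add: insert_commute)
    qed
    then obtain z where z: "e' = {x, z}" "x \<noteq> z" "z \<in> pts a b" "f x = f z" by blast
    have "y = z" using two[of x y z] xy z by blast
    then show ?thesis using xy(1) z(1) e'(1) by simp
  qed
  have "c \<subseteq> c'" using *[of _ c c'] c by blast
  moreover have "c' \<subseteq> c" using *[of _ c' c] c by blast
  ultimately show ?thesis by blast
qed

lemma admissible_data:
  assumes D: "admissible a b D"
  shows "\<exists>m js w w' \<gamma>. js \<in> codes m \<and> 2 * m = a + b \<and> homeq (diag_mor D) \<gamma> (std a js) \<and> \<gamma> \<noteq> 0 \<and>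
     mat (Suc (a + b)) (diag_mor D) w w' \<noteq> 0 \<and>
     (\<forall>D'. admissible a b D' \<longrightarrow> mat (Suc (a + b)) (diag_mor D') w w' \<noteq> 0 \<longrightarrow> connector a b D' = connector a b D)"
proof -
  \<comment> \<open>Positive, as \<open>rel_red\<close> requires, and at least the number of cups,
    as \<open>rel_std\<close> requires.\<close>
  let ?N = "Suc (a + b)"
  have D': "is_diagram a b D" "no_loops a b D" "connector a b D \<in> Conn a b" "D \<noteq> []"
    using D by (auto simp: admissible_def is_diagram_def)
  have ty: "wt (diag_mor D)" "src (diag_mor D) = a" "tgt (diag_mor D) = b" using diag_type[OF D'(1)] by auto
  obtain m js where js: "js \<in> codes m" "2 * m = a + b" "diag_mor D \<leadsto> std a js"
    using red_std[OF ty(1,2)] ty(3) by auto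
  obtain \<gamma> where g: "homeq (diag_mor D) \<gamma> (std a js)" using red_homeq[OF js(3) ty(1)] by blast
  obtain w w' where w: "(w, w') \<in> rel ?N (std a js)" "\<And>i. count (mset (map snd (w @ w'))) i \<le> 2"
    using rel_std[OF js(1), of a b ?N] js(2) by auto
  have wD: "(w, w') \<in> rel ?N (diag_mor D)" using w(1) rel_red[OF js(3), of ?N] by simp
  have len: "length w = a" "length w' = b" using rel_len[OF wD] ty by auto
  obtain W where W: "lpath ?N D W" "W ! 0 = w" "W ! length D = w'" using wD rel_diag[OF D'(4)] by blast
  have P: "path flip D W" using W(1) by (simp add: lpath_def)
  have "mat ?N (diag_mor D) (W ! 0) (W ! length D) \<noteq> 0"
  proof (rule mat_diag_unique[OF D'(4) W(1)])
    fix W' assume "lpath ?N D W'" "W' ! 0 = W ! 0" "W' ! length D = W ! length D"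
    then show "W' = W" by (intro path_unique[OF D'(2) _ P]) (auto simp: lpath_def)
  qed
  then have nz: "mat ?N (diag_mor D) w w' \<noteq> 0" using W by simp
  \<comment> \<open>With \<open>\<gamma> = 0\<close>, every entry of \<open>diag_mor D\<close> would
    vanish.\<close>
  then have "\<gamma> \<noteq> 0" using homeq_mat[OF g, of ?N w w'] by auto
  moreover have "connector a b D' = connector a b D" if D': "admissible a b D'" "mat ?N (diag_mor D') w w' \<noteq> 0" for D'
  proof (rule Conn_eq[where f = "idx w w'"])
    show "connector a b D' \<in> Conn a b" "connector a b D \<in> Conn a b" using D D' by (auto simp: admissible_def)
    have ne: "D' \<noteq> []" using D' by (auto simp: admissible_def is_diagram_def)
    obtain V where V: "lpath ?N D' V" "V ! 0 = w" "V ! length D' = w'"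
      using mat_rel[OF D'(2)] rel_diag[OF ne] by blast
    then have PV: "path flip D' V" by (simp add: lpath_def)
    fix e assume "e \<in> connector a b D' \<union> connector a b D"
    then show "\<exists>x y. e = {x, y} \<and> x \<noteq> y \<and> x \<in> pts a b \<and> y \<in> pts a b \<and> idx w w' x = idx w w' y"
      using connector_idx[OF PV, of e a b, unfolded V(2,3)] connector_idx[OF P, of e a b, unfolded W(2,3)] by blast
  qed (rule idx_two[OF len w(2)])
  ultimately show ?thesis using js(1,2) g nz by blast
qed

section \<open>Counting matchings\<close>

definition matchings :: "'a set \<Rightarrow> 'a set set set" where
  "matchings X = {M. (\<forall>e\<in>M. e \<subseteq> X \<and> card e = 2) \<and> (\<forall>x\<in>X. \<exists>!e. e \<in> M \<and> x \<in> e)}"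

lemma matchings_insert:
  assumes "x \<in> X" "y \<in> X" "x \<noteq> y" "M \<in> matchings (X - {x, y})"
  shows "insert {x, y} M \<in> matchings X"
proof -
  have M: "\<And>e. e \<in> M \<Longrightarrow> e \<subseteq> X - {x, y} \<and> card e = 2"
    "\<And>z. z \<in> X - {x, y} \<Longrightarrow> \<exists>!e. e \<in> M \<and> z \<in> e" using assms(4) unfolding matchings_def by simp_all
  have "\<exists>!e. e \<in> insert {x, y} M \<and> z \<in> e" if "z \<in> X" for z
  proof (cases "z \<in> {x, y}")
    case True
    have "e \<in> insert {x, y} M \<and> z \<in> e \<longleftrightarrow> e = {x, y}" for e
      using True M(1)[of e] by auto
    then show ?thesis by simp
  next
    case False
    then have "\<exists>!e. e \<in> M \<and> z \<in> e" using M(2) that by simp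
    moreover have "e \<in> insert {x, y} M \<and> z \<in> e \<longleftrightarrow> e \<in> M \<and> z \<in> e" for e using False by blast
    ultimately show ?thesis by simp
  qed
  moreover have "card {x, y} = 2" using assms by simp
  then have "e \<subseteq> X \<and> card e = 2" if "e \<in> insert {x, y} M" for e
    using that M(1)[of e] assms(1,2) by auto
  ultimately show ?thesis unfolding matchings_def by simp
qed

lemma matchings_remove:
  assumes "M \<in> matchings X" "x \<in> X"
  obtains y M' where "y \<in> X - {x}" "M' \<in> matchings (X - {x, y})" "M = insert {x, y} M'"
proof -
  have M: "\<And>e. e \<in> M \<Longrightarrow> e \<subseteq> X \<and> card e = 2"
    "\<And>z. z \<in> X \<Longrightarrow> \<exists>!e. e \<in> M \<and> z \<in> e" using assms(1) unfolding matchings_def by simp_all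
  obtain e where e: "e \<in> M" "x \<in> e" using M(2)[OF assms(2)] by blast
  obtain p q where pq: "e = {p, q}" "p \<noteq> q" using M(1)[OF e(1)] card_2_iff[of e] by blast
  define y where "y = (if x = p then q else p)"
  have y: "e = {x, y}" "x \<noteq> y" using pq e(2) by (auto simp: y_def)
  have yX: "y \<in> X" using M(1)[OF e(1)] y by blast
  have dis: "e' = e" if "e' \<in> M" "z \<in> e'" "z \<in> {x, y}" for e' z
    using M(2)[of z] that e y yX assms(2) by blast
  have "M - {e} \<in> matchings (X - {x, y})"
    unfolding matchings_def
  proof (intro CollectI conjI ballI)
    fix e' assume e': "e' \<in> M - {e}"
    then show "e' \<subseteq> X - {x, y}" "card e' = 2" using M(1)[of e'] dis[of e'] by blast+
  next
    fix z assume z: "z \<in> X - {x, y}"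
    then have "\<exists>!e'. e' \<in> M \<and> z \<in> e'" using M(2) by simp
    moreover have "e' \<in> M - {e} \<and> z \<in> e' \<longleftrightarrow> e' \<in> M \<and> z \<in> e'" for e' using z y by blast
    ultimately show "\<exists>!e'. e' \<in> M - {e} \<and> z \<in> e'" by simp
  qed
  moreover have "M = insert {x, y} (M - {e})" using e(1) y(1) by blast
  moreover have "y \<in> X - {x}" using yX y(2) by blast
  ultimately show ?thesis using that by simp
qed

text \<open>A fixed point has \<open>n - 1\<close> possible partners, and each leaves a matching of
  the other \<open>n - 2\<close> points.\<close>

lemma card_matchings:
  "finite X \<Longrightarrow> card X = n \<Longrightarrow> finite (matchings X) \<and> card (matchings X) = (if even n then dfact (n - 1) else 0)"
proof (induction n arbitrary: X rule: less_induct)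
  case (less n)
  show ?case
  proof (cases "X = {}")
    case True
    have "matchings X = {{}}" unfolding matchings_def True by auto
    then show ?thesis using True less.prems by simp
  next
    case False
    then obtain x where x: "x \<in> X" by blast
    let ?f = "\<lambda>y. insert {x, y} ` matchings (X - {x, y})"
    have eq: "matchings X = (\<Union>y\<in>X - {x}. ?f y)"
    proof (intro equalityI subsetI)
      fix M assume "M \<in> matchings X"
      then obtain y M' where "y \<in> X - {x}" "M' \<in> matchings (X - {x, y})" "M = insert {x, y} M'"
        using x by (rule matchings_remove)
      then show "M \<in> (\<Union>y\<in>X - {x}. ?f y)" by blast
    next
      fix M assume "M \<in> (\<Union>y\<in>X - {x}. ?f y)"
      then obtain y M' where "y \<in> X - {x}" "M' \<in> matchings (X - {x, y})" "M = insert {x, y} M'" by blast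
      then show "M \<in> matchings X" using matchings_insert[OF x, of y M'] by auto
    qed
    have n: "n \<ge> 1" using less.prems False by (simp add: Suc_le_eq card_gt_0_iff flip: less.prems(2))
    have c: "card (X - {x, y}) = n - 2 \<and> n - 2 < n" if "y \<in> X - {x}" for y
    proof -
      have "card {x, y} = 2" "{x, y} \<subseteq> X" using that x by auto
      then show ?thesis using less.prems n card_Diff_subset[of "{x, y}" X] by simp
    qed
    have IH: "finite (matchings (X - {x, y}))" "card (matchings (X - {x, y})) = (if even (n - 2) then dfact (n - 2 - 1) else 0)"
      if "y \<in> X - {x}" for y
      using less.IH[of "n - 2" "X - {x, y}"] c[OF that] less.prems by auto
    have nin: "{x, y} \<notin> M" if "M \<in> matchings (X - {x, y})" for y M
      using that unfolding matchings_def by auto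
    have "inj_on (insert {x, y}) (matchings (X - {x, y}))" for y
    proof (rule inj_onI)
      fix M M' assume M: "M \<in> matchings (X - {x, y})" "M' \<in> matchings (X - {x, y})"
        and e: "insert {x, y} M = insert {x, y} M'"
      show "M = M'" using insert_ident[OF nin[OF M(1)] nin[OF M(2)]] e by simp
    qed
    then have cf: "card (?f y) = (if even (n - 2) then dfact (n - 2 - 1) else 0)" if "y \<in> X - {x}" for y
      using IH[OF that] by (simp add: card_image)
    have disj: "?f y \<inter> ?f z = {}" if yz: "y \<in> X - {x}" "z \<in> X - {x}" "y \<noteq> z" for y z
    proof (rule ccontr)
      assume "?f y \<inter> ?f z \<noteq> {}"
      then obtain M where M: "M \<in> ?f y" "M \<in> ?f z" by blast
      then have "M \<in> matchings X" unfolding eq using yz by blast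
      then have u: "\<exists>!e. e \<in> M \<and> x \<in> e" using x unfolding matchings_def by simp
      have "{x, y} \<in> M" using M(1) by blast
      moreover have "{x, z} \<in> M" using M(2) by blast
      ultimately have "{x, y} = {x, z}" using u by (metis insertI1)
      then show False using yz by (auto simp: doubleton_eq_iff)
    qed
    have "card (matchings X) = (\<Sum>y\<in>X - {x}. card (?f y))"
      unfolding eq
    proof (rule card_UN_disjoint)
      show "finite (X - {x})" using less.prems by simp
      show "\<forall>y\<in>X - {x}. finite (?f y)" using IH(1) by blast
      show "\<forall>y\<in>X - {x}. \<forall>z\<in>X - {x}. y \<noteq> z \<longrightarrow> ?f y \<inter> ?f z = {}" using disj by blast
    qed
    also have "\<dots> = (n - 1) * (if even (n - 2) then dfact (n - 2 - 1) else 0)"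
      using cf x less.prems by simp
    also have "\<dots> = (if even n then dfact (n - 1) else 0)"
    \<comment> \<open>Truncated subtraction makes these values special: for \<open>n = 1\<close> the
      first factor is \<open>0\<close>, and for \<open>n = 2\<close> both sides are
      \<open>1\<close>.\<close>
    proof (cases "n = 1 \<or> n = 2")
      case False
      then obtain k where "n = Suc (Suc (Suc k))" using n using that[of "n - 3"] by linarith
      then show ?thesis by simp
    qed auto
    finally have "card (matchings X) = (if even n then dfact (n - 1) else 0)" .
    moreover have "finite (matchings X)" unfolding eq using IH(1) less.prems by simp
    ultimately show ?thesis by blast
  qed
qed

lemma Conn_matchings: "Conn a b = matchings (pts a b)"
  unfolding Conn_def matchings_def ..

lemma card_pts: "finite (pts a b)" "card (pts a b) = a + b"
proof -
  show "finite (pts a b)" by (simp add: pts_def)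
  have "card (pts a b) = card (Bot ` {..<a}) + card (Top ` {..<b})"
    unfolding pts_def by (rule card_Un_disjoint) auto
  then show "card (pts a b) = a + b" by (simp add: card_image inj_on_def)
qed

lemma card_Conn: "finite (Conn a b)" "card (Conn a b) = (if even (a + b) then dfact (a + b - 1) else 0)"
  using card_matchings[OF card_pts] unfolding Conn_matchings by blast+

section \<open>From normal choices to bases\<close>

lemma span_of_homeq:
  assumes C: "finite C"
    and h: "\<And>m. wt m \<Longrightarrow> src m = a \<Longrightarrow> tgt m = b \<Longrightarrow> \<exists>c\<in>C. \<exists>\<kappa>. homeq m \<kappa> (phi c)"
    and x: "x \<in> V a b"
  shows "\<exists>coef. rel_ideal a b (\<lambda>m. x m - (\<Sum>i\<in>C. coef i * delta (phi i) m))"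
proof -
  have *: "finite B \<Longrightarrow> (\<forall>m\<in>B. wt m \<and> src m = a \<and> tgt m = b) \<Longrightarrow>
     \<exists>coef. rel_ideal a b (\<lambda>m. (\<Sum>s\<in>B. x s * delta s m) - (\<Sum>i\<in>C. coef i * delta (phi i) m))" for B
  proof (induction B rule: finite_induct)
    case empty
    show ?case by (intro exI[of _ "\<lambda>_. 0"]) (simp add: ri_zero)
  next
    case (insert s B)
    then obtain coef where co: "rel_ideal a b (\<lambda>m. (\<Sum>s\<in>B. x s * delta s m) - (\<Sum>i\<in>C. coef i * delta (phi i) m))"
      by auto
    obtain c \<kappa> where c: "c \<in> C" "homeq s \<kappa> (phi c)" using h[of s] insert.prems by auto
    then have r: "rel_ideal a b (\<lambda>m. delta s m - \<kappa> * delta (phi c) m)"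
      using insert.prems by (simp add: homeq_def)
    let ?co = "\<lambda>i. coef i + (if i = c then x s * \<kappa> else 0)"
    have sm: "(\<Sum>i\<in>C. ?co i * delta (phi i) m) = (\<Sum>i\<in>C. coef i * delta (phi i) m) + x s * \<kappa> * delta (phi c) m" for m
    proof -
      have "(\<Sum>i\<in>C. ?co i * delta (phi i) m) = (\<Sum>i\<in>C. coef i * delta (phi i) m + (if i = c then x s * \<kappa> * delta (phi i) m else 0))"
        by (intro sum.cong) (auto simp: algebra_simps)
      also have "\<dots> = (\<Sum>i\<in>C. coef i * delta (phi i) m) + x s * \<kappa> * delta (phi c) m"
        using C c(1) by (simp add: sum.distrib)
      finally show ?thesis .
    qed
    have "rel_ideal a b (\<lambda>m. ((\<Sum>s\<in>B. x s * delta s m) - (\<Sum>i\<in>C. coef i * delta (phi i) m)) +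
       x s * (delta s m - \<kappa> * delta (phi c) m))"
      by (intro ri_add ri_smult co r)
    moreover have "(\<lambda>m. ((\<Sum>s\<in>B. x s * delta s m) - (\<Sum>i\<in>C. coef i * delta (phi i) m)) +
       x s * (delta s m - \<kappa> * delta (phi c) m)) =
      (\<lambda>m. (\<Sum>s\<in>insert s B. x s * delta s m) - (\<Sum>i\<in>C. ?co i * delta (phi i) m))"
      unfolding sm using insert.hyps by (simp add: algebra_simps)
    ultimately have "rel_ideal a b (\<lambda>m. (\<Sum>s\<in>insert s B. x s * delta s m) - (\<Sum>i\<in>C. ?co i * delta (phi i) m))"
      by (simp only:)
    then show ?case by (rule exI[of _ ?co])
  qed
  let ?B = "{m. x m \<noteq> 0}"
  have B: "finite ?B" "\<forall>m\<in>?B. wt m \<and> src m = a \<and> tgt m = b" using x by (auto simp: V_def)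
  have "(\<Sum>s\<in>?B. x s * delta s m) = x m" for m
  proof -
    have "(\<Sum>s\<in>?B. x s * delta s m) = x m * delta m m"
      by (rule sum_eq_single) (use B in \<open>auto simp: delta_def\<close>)
    then show ?thesis by (simp add: delta_def)
  qed
  then show ?thesis using *[OF B] by simp
qed

text \<open>Two diagrams with the same code would be nonzero multiples of each other, contrary to
  the entry that separates them. So \<open>js\<close> is injective, hence bijective by cardinality,
  and dividing by \<open>\<gamma> c\<close> expresses the standard composites by the
  diagrams.\<close>

lemma normal_choice_basis:
  assumes d: "normal_choice a b d"
  shows "hom_basis a b (Conn a b) (\<lambda>c. diag_mor (d c))"
proof -
  let ?N = "Suc (a + b)" and ?C = "Conn a b" and ?phi = "\<lambda>c. diag_mor (d c)"
  have g: "admissible a b (d c)" "connector a b (d c) = c" if "c \<in> ?C" for c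
    using d that unfolding normal_choice_def admissible_def by auto
  have ty: "wt (?phi c) \<and> src (?phi c) = a \<and> tgt (?phi c) = b" if "c \<in> ?C" for c
    using diag_type g(1)[OF that] unfolding admissible_def by blast
  \<comment> \<open>One predicate for all five witnesses, so that they can be chosen as functions of
    \<open>c\<close> together.\<close>
  define Q where "Q c m js w w' \<gamma> \<longleftrightarrow> js \<in> codes m \<and> 2 * m = a + b \<and> homeq (?phi c) \<gamma> (std a js) \<and> \<gamma> \<noteq> 0 \<and>
     mat ?N (?phi c) w w' \<noteq> 0 \<and> (\<forall>c'\<in>?C. mat ?N (?phi c') w w' \<noteq> 0 \<longrightarrow> c' = c)" for c m js w w' \<gamma>
  have "\<forall>c\<in>?C. \<exists>m js w w' \<gamma>. Q c m js w w' \<gamma>"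
  proof
    fix c assume c: "c \<in> ?C"
    obtain m js w w' \<gamma> where 1: "js \<in> codes m" "2 * m = a + b" "homeq (?phi c) \<gamma> (std a js)" "\<gamma> \<noteq> 0"
      "mat ?N (?phi c) w w' \<noteq> 0"
      and 2: "\<And>D'. admissible a b D' \<Longrightarrow> mat ?N (diag_mor D') w w' \<noteq> 0 \<Longrightarrow> connector a b D' = connector a b (d c)"
      using admissible_data[OF g(1)[OF c]] by blast
    have "c' = c" if "c' \<in> ?C" "mat ?N (?phi c') w w' \<noteq> 0" for c'
      using 2[OF g(1)[OF that(1)] that(2)] g(2) c that(1) by simp
    then show "\<exists>m js w w' \<gamma>. Q c m js w w' \<gamma>" unfolding Q_def using 1 by blast
  qed
  then obtain m js w w' \<gamma> where QJ: "\<forall>c\<in>?C. Q c (m c) (js c) (w c) (w' c) (\<gamma> c)"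
    unfolding bchoice_iff by blast
  have J: "js c \<in> codes (m c) \<and> 2 * m c = a + b \<and>
      homeq (?phi c) (\<gamma> c) (std a (js c)) \<and> \<gamma> c \<noteq> 0 \<and>
     mat ?N (?phi c) (w c) (w' c) \<noteq> 0 \<and> (\<forall>c'\<in>?C. mat ?N (?phi c') (w c) (w' c) \<noteq> 0 \<longrightarrow> c' = c)" if "c \<in> ?C" for c
    using QJ that unfolding Q_def by blast
  have Jh: "homeq (?phi c) (\<gamma> c) (std a (js c))" and Jg: "\<gamma> c \<noteq> 0" and Jz: "mat ?N (?phi c) (w c) (w' c) \<noteq> 0"
    if "c \<in> ?C" for c
    using J[OF that] by blast+
  have Ju: "c' = c" if "c \<in> ?C" "c' \<in> ?C" "mat ?N (?phi c') (w c) (w' c) \<noteq> 0" for c c'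
    using J[OF that(1)] that(2,3) by blast
  have inj: "inj_on js ?C"
  proof (rule inj_onI)
    fix c c' assume c: "c \<in> ?C" "c' \<in> ?C" "js c = js c'"
    have 1: "mat ?N (?phi c) (w c) (w' c) = \<gamma> c * mat ?N (std a (js c)) (w c) (w' c)"
      by (rule homeq_mat) (rule Jh[OF c(1)])
    have 2: "mat ?N (std a (js c)) (w c) (w' c) \<noteq> 0" using 1 Jz[OF c(1)] by (metis mult_zero_right)
    have 3: "mat ?N (?phi c') (w c) (w' c) = \<gamma> c' * mat ?N (std a (js c')) (w c) (w' c)"
      by (rule homeq_mat) (rule Jh[OF c(2)])
    have "mat ?N (?phi c') (w c) (w' c) \<noteq> 0" unfolding 3 using 2 Jg[OF c(2)] c(3) by simp
    then show "c = c'" using Ju[OF c(1) c(2)] by simp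
  qed
  have onto: "js ` ?C = codes k" if k: "2 * k = a + b" for k
  proof (rule card_subset_eq)
    show "finite (codes k)" using card_codes by blast
    show "js ` ?C \<subseteq> codes k"
    proof
      fix y assume "y \<in> js ` ?C"
      then obtain c where "c \<in> ?C" "y = js c" by blast
      moreover have "m c = k" using J[OF calculation(1)] k by linarith
      ultimately show "y \<in> codes k" using J by blast
    qed
    have "even (a + b)" using k by (metis dvd_triv_left)
    then show "card (js ` ?C) = card (codes k)"
      using card_image[OF inj] card_Conn[of a b] card_codes[of k] k by simp
  qed
  \<comment> \<open>For odd \<open>a + b\<close> this is vacuous: \<open>red_std\<close> yields
    \<open>2 * k = a + b\<close>, so no well-typed morphism exists.\<close>
  have span: "\<exists>c\<in>?C. \<exists>\<kappa>. homeq f \<kappa> (?phi c)" if f: "wt f" "src f = a" "tgt f = b" for f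
  proof -
    obtain k us where us: "us \<in> codes k" "2 * k = a + b" "f \<leadsto> std a us"
      using red_std[OF f(1,2)] f(3) by auto
    have "us \<in> js ` ?C" using onto[OF us(2)] us(1) by simp
    then obtain c where c: "us = js c" "c \<in> ?C" by (rule imageE)
    note c = c(2) c(1)[symmetric]
    obtain \<kappa> where k: "homeq f \<kappa> (std a us)" using red_homeq[OF us(3) f(1)] by blast
    have st: "src (std a us) = a" "tgt (std a us) = b" using std_type[OF us(1) us(2)[symmetric]] by blast+
    have "homeq (std a us) (inverse (\<gamma> c)) (?phi c)"
      using homeq_sym[OF Jh[OF c(1)] Jg[OF c(1)]] c(2) st ty[OF c(1)] by simp
    then have "homeq f (\<kappa> * inverse (\<gamma> c)) (?phi c)"
      by (rule homeq_trans[OF k]) (simp_all add: f st)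
    then show ?thesis using c(1) by blast
  qed
  have indep: "coef c = 0" if r: "rel_ideal a b (\<lambda>m. \<Sum>i\<in>?C. coef i * delta (?phi i) m)" and c: "c \<in> ?C" for coef c
  proof -
    have "(\<Sum>i\<in>?C. coef i * mat ?N (?phi i) (w c) (w' c)) = ev ?N (\<lambda>m. \<Sum>i\<in>?C. coef i * delta (?phi i) m) (w c) (w' c)"
      by (rule ev_sum_delta[OF card_Conn(1), symmetric]) (use ty in blast)
    also have "\<dots> = 0" using ideal_ev[OF r] by blast
    finally have "(\<Sum>i\<in>?C. coef i * mat ?N (?phi i) (w c) (w' c)) = 0" .
    moreover have "(\<Sum>i\<in>?C. coef i * mat ?N (?phi i) (w c) (w' c)) = coef c * mat ?N (?phi c) (w c) (w' c)"
    proof (rule sum_eq_single[OF card_Conn(1)])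
      fix c' assume "c' \<in> ?C" "c' \<noteq> c"
      then show "coef c' * mat ?N (?phi c') (w c) (w' c) = 0" using Ju[OF c, of c'] by auto
    qed (use c in simp)
    ultimately show ?thesis using Jz[OF c] by simp
  qed
  show ?thesis unfolding hom_basis_def
    using card_Conn(1)[of a b] ty span_of_homeq[OF card_Conn(1) span] indep by blast
qed

lemma hom_basis_dim:
  assumes "hom_basis a b C phi"
  shows "hom_dim a b (card C)"
proof -
  have B: "finite C" "\<And>i. i \<in> C \<Longrightarrow> wt (phi i) \<and> src (phi i) = a \<and> tgt (phi i) = b"
    "\<And>x. x \<in> V a b \<Longrightarrow> \<exists>coef. rel_ideal a b (\<lambda>m. x m - (\<Sum>i\<in>C. coef i * delta (phi i) m))"
    "\<And>coef i. rel_ideal a b (\<lambda>m. \<Sum>i\<in>C. coef i * delta (phi i) m) \<Longrightarrow> i \<in> C \<Longrightarrow> coef i = 0"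
    using assms unfolding hom_basis_def by blast+
  obtain h where h: "bij_betw h {..<card C} C"
    using ex_bij_betw_nat_finite[OF B(1)] by (auto simp: atLeast0LessThan)
  let ?g = "the_inv_into {..<card C} h"
  have gh: "?g (h i) = i" if "i < card C" for i
    using the_inv_into_f_f[OF bij_betw_imp_inj_on[OF h]] that by simp
  have re: "(\<Sum>i<card C. coef (h i) * delta (phi (h i)) m) = (\<Sum>i\<in>C. coef i * delta (phi i) m)" for coef m
    by (rule sum.reindex_bij_betw[OF h])
  have "hom_basis a b {..<card C} (\<lambda>i. phi (h i))"
    unfolding hom_basis_def
  proof (intro conjI ballI allI impI)
    fix i assume "i \<in> {..<card C}"
    then have "h i \<in> C" using h bij_betwE by blast
    then show "wt (phi (h i))" "src (phi (h i)) = a" "tgt (phi (h i)) = b" using B(2) by auto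
  next
    fix x assume "x \<in> V a b"
    then obtain coef where "rel_ideal a b (\<lambda>m. x m - (\<Sum>i\<in>C. coef i * delta (phi i) m))" using B(3) by blast
    then show "\<exists>coef. rel_ideal a b (\<lambda>m. x m - (\<Sum>i<card C. coef i * delta (phi (h i)) m))"
      unfolding re[symmetric] by (rule exI[of _ "\<lambda>i. coef (h i)"])
  next
    fix coef i assume r: "rel_ideal a b (\<lambda>m. \<Sum>i<card C. coef i * delta (phi (h i)) m)" and i: "i \<in> {..<card C}"
    have "(\<Sum>i<card C. coef i * delta (phi (h i)) m) = (\<Sum>i\<in>C. coef (?g i) * delta (phi i) m)" for m
      unfolding re[symmetric] by (rule sum.cong) (auto simp: gh)
    then have "rel_ideal a b (\<lambda>m. \<Sum>i\<in>C. coef (?g i) * delta (phi i) m)" using r by simp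
    from B(4)[OF this, of "h i"] show "coef i = 0" using i gh bij_betwE[OF h] by auto
  qed simp
  then show ?thesis unfolding hom_dim_def by blast
qed

section \<open>Words with crossing data\<close>

text \<open>If the letters of a boundary word name strings, this lists the caps of the bottom word,
  or the cups of the top word, by their left ends.\<close>

fun lefts :: "nat list \<Rightarrow> nat list" where
  "lefts [] = []"
| "lefts (x # l) = (if x \<in> set l then x # lefts l else lefts l)"

lemma lefts_Nil_iff: "lefts l = [] \<longleftrightarrow> distinct l"
  by (induction l) auto

lemma lefts_append: "\<exists>p. lefts (u @ t) = p @ lefts t"
  by (induction u) auto

lemma lefts_append_cong:
  "(\<And>a. a \<in> set u \<Longrightarrow> a \<in> set t \<longleftrightarrow> a \<in> set t') \<Longrightarrow> \<exists>p. lefts (u @ t) = p @ lefts t \<and> lefts (u @ t') = p @ lefts t'"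
proof (induction u)
  case (Cons a u)
  then obtain p where "lefts (u @ t) = p @ lefts t" "lefts (u @ t') = p @ lefts t'" by auto
  then show ?case using Cons.prems[of a] by (cases "a \<in> set (u @ t)") auto
qed simp

lemma lefts_count: "t \<in> set (lefts l) \<Longrightarrow> count_list l t \<ge> 2"
proof (induction l)
  case (Cons a l)
  show ?case
  proof (cases "t = a \<and> a \<in> set l")
    case True
    then have "count_list l a \<noteq> 0" by (simp add: count_list_0_iff)
    then show ?thesis using True by simp
  next
    case False
    then have "t \<in> set (lefts l)" using Cons.prems by (auto split: if_splits)
    then show ?thesis using Cons.IH by simp
  qed
qed simp

lemma distinct_lefts: "(\<And>t. count_list l t \<le> 2) \<Longrightarrow> distinct (lefts l)"
proof (induction l)
  case (Cons a l)
  have "count_list l t \<le> 2" for t using Cons.prems[of t] by (auto split: if_splits)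
  then have "distinct (lefts l)" using Cons.IH by blast
  moreover have "a \<notin> set (lefts l)"
  proof
    assume "a \<in> set (lefts l)"
    then show False using lefts_count[of a l] Cons.prems[of a] by simp
  qed
  ultimately show ?case by simp
qed simp

text \<open>\<open>x\<close> is the rightmost left end. No pair begins after it, which makes
  \<open>t\<close> distinct.\<close>

lemma lefts_last: "lefts w \<noteq> [] \<Longrightarrow> \<exists>u x t. w = u @ x # t \<and> x \<in> set t \<and> distinct t"
proof (induction w)
  case (Cons a w)
  show ?case
  proof (cases "lefts w = []")
    case True
    then have "a \<in> set w" "distinct w" using Cons.prems lefts_Nil_iff by (auto split: if_splits)
    then show ?thesis by (intro exI[of _ "[]"]) auto
  next
    case False
    then obtain u x t where "w = u @ x # t" "x \<in> set t" "distinct t" using Cons.IH by blast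
    then show ?thesis by (intro exI[of _ "a # u"]) auto
  qed
qed simp

lemma nth_split2: assumes "p < q" "q < length w"
  shows "\<exists>m. w = take p w @ w ! p # m @ w ! q # drop (Suc q) w \<and> drop (Suc p) w = m @ w ! q # drop (Suc q) w"
proof -
  let ?m = "take (q - Suc p) (drop (Suc p) w)"
  have 1: "w = take p w @ w ! p # drop (Suc p) w" using assms by (intro id_take_nth_drop) simp
  have "drop (Suc p) w = ?m @ drop (Suc p) w ! (q - Suc p) # drop (Suc (q - Suc p)) (drop (Suc p) w)"
    using assms by (intro id_take_nth_drop) simp
  then have 2: "drop (Suc p) w = ?m @ w ! q # drop (Suc q) w" using assms by simp
  show ?thesis by (rule exI[of _ ?m], rule conjI, subst 2[symmetric], rule 1, rule 2)
qed

lemma nth_in_drop: "k < l \<Longrightarrow> l < length w \<Longrightarrow> w ! l \<in> set (drop (Suc k) w)"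
  using nth_mem[of "l - Suc k" "drop (Suc k) w"] by simp

lemma lefts_mem:
  assumes "p < q" "q < length w" "w ! p = w ! q" shows "w ! p \<in> set (lefts w)"
proof -
  have w: "w = take p w @ w ! p # drop (Suc p) w" using assms by (intro id_take_nth_drop) simp
  obtain pr where "lefts w = pr @ lefts (w ! p # drop (Suc p) w)"
    using lefts_append[of "take p w" "w ! p # drop (Suc p) w"] w by auto
  moreover have "w ! p \<in> set (drop (Suc p) w)" using nth_in_drop[OF assms(1,2)] assms(3) by simp
  ultimately show ?thesis by simp
qed

lemma lefts_order:
  assumes "p < q" "q < length w" "w ! p = w ! q" "p' < q'" "q' < length w" "w ! p' = w ! q'" "p < p'"
  shows "\<exists>A B C. lefts w = A @ w ! p # B @ w ! p' # C"
proof -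
  have p': "p' < length w" using assms by simp
  obtain m where m: "w = take p w @ w ! p # m @ w ! p' # drop (Suc p') w" "drop (Suc p) w = m @ w ! p' # drop (Suc p') w"
    using nth_split2[OF assms(7) p'] by blast
  have 1: "w ! p \<in> set (m @ w ! p' # drop (Suc p') w)"
    using nth_in_drop[OF assms(1,2)] assms(3) m(2) by simp
  have 2: "w ! p' \<in> set (drop (Suc p') w)" using nth_in_drop[OF assms(4,5)] assms(6) by simp
  obtain A where "lefts w = A @ lefts (w ! p # m @ w ! p' # drop (Suc p') w)"
    using lefts_append[of "take p w" "w ! p # m @ w ! p' # drop (Suc p') w"] m(1) by auto
  moreover obtain B where "lefts (m @ w ! p' # drop (Suc p') w) = B @ lefts (w ! p' # drop (Suc p') w)"
    using lefts_append by blast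
  ultimately have "lefts w = A @ w ! p # B @ w ! p' # lefts (drop (Suc p') w)"
    using 1 2 by simp
  then show ?thesis by blast
qed

text \<open>The strings labelled \<open>x\<close> and \<open>y\<close> interlace on the boundary circle, read as the word \<open>z\<close>.\<close>

definition il :: "nat list \<Rightarrow> nat \<Rightarrow> nat \<Rightarrow> bool" where
  "il z x y \<longleftrightarrow> x \<noteq> y \<and> (filter (\<lambda>t. t = x \<or> t = y) z = [x, y, x, y] \<or> filter (\<lambda>t. t = x \<or> t = y) z = [y, x, y, x])"

lemma il_comm: "il z x y \<longleftrightarrow> il z y x"
proof -
  have "(\<lambda>t. t = x \<or> t = y) = (\<lambda>t. t = y \<or> t = x)" by auto
  then show ?thesis unfolding il_def by auto
qed

lemma il_mem: "il z x y \<Longrightarrow> x \<in> set z \<and> y \<in> set z"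
proof -
  assume "il z x y"
  then have "filter (\<lambda>t. t = x \<or> t = y) z = [x, y, x, y] \<or> filter (\<lambda>t. t = x \<or> t = y) z = [y, x, y, x]"
    unfolding il_def by blast
  then have "{x, y} \<subseteq> set (filter (\<lambda>t. t = x \<or> t = y) z)"
    by (elim disjE; elim ssubst; simp)
  then show ?thesis by auto
qed

lemma il_swap: "{p, q} \<noteq> {x, y} \<Longrightarrow> x \<noteq> y \<Longrightarrow> il (u @ x # y # r) p q \<longleftrightarrow> il (u @ y # x # r) p q"
proof -
  assume *: "{p, q} \<noteq> {x, y}" "x \<noteq> y"
  show ?thesis
  proof (cases "p = q")
    case True then show ?thesis by (simp add: il_def)
  next
    case False
    then have "\<not> (x = p \<or> x = q) \<or> \<not> (y = p \<or> y = q)" using * by auto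
    then have "filter (\<lambda>t. t = p \<or> t = q) (u @ x # y # r) = filter (\<lambda>t. t = p \<or> t = q) (u @ y # x # r)" by auto
    then show ?thesis unfolding il_def by simp
  qed
qed

text \<open>Exchanging two neighbouring ends of crossing chords uncrosses them, so a forced crossing
  is used up once it is drawn.\<close>

lemma not_il_swap: "il (u @ x # y # r) x y \<Longrightarrow> \<not> il (u @ y # x # r) x y"
proof -
  assume a: "il (u @ x # y # r) x y"
  define F G where "F = filter (\<lambda>t. t = x \<or> t = y) u" and "G = filter (\<lambda>t. t = x \<or> t = y) r"
  have n: "x \<noteq> y" using a by (simp add: il_def)
  have 1: "F @ x # y # G = [x, y, x, y] \<or> F @ x # y # G = [y, x, y, x]"
    using a by (simp add: il_def F_def G_def)
  have "\<not> (F @ y # x # G = [x, y, x, y] \<or> F @ y # x # G = [y, x, y, x])"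
    using 1 n by (cases F; cases "tl F"; cases "tl (tl F)"; auto)
  then show ?thesis by (simp add: il_def F_def G_def)
qed

text \<open>Such a word is a perfect matching of its positions. It is applied to
  \<open>w @ rev w'\<close>, the boundary read around the circle.\<close>

definition dbl :: "nat list \<Rightarrow> bool" where
  "dbl z \<longleftrightarrow> (\<forall>x\<in>set z. count_list z x = 2)"

lemma dbl_le: "dbl z \<Longrightarrow> count_list z x \<le> 2"
  unfolding dbl_def by (cases "x \<in> set z") auto

text \<open>Ordered pairs, so each forced crossing counts twice. The cardinality is the second
  component of the termination measure in \<open>realizable_all\<close>.\<close>

definition ilset :: "nat list \<Rightarrow> (nat \<times> nat) set" where "ilset z = {(x, y). il z x y}"

lemma finite_ilset: "finite (ilset z)"
  by (rule finite_subset[of _ "set z \<times> set z"]) (auto simp: ilset_def dest: il_mem)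

lemma ilset_swap:
  assumes "il (u @ x # y # r) x y"
  shows "card (ilset (u @ y # x # r)) < card (ilset (u @ x # y # r))"
proof (rule psubset_card_mono[OF finite_ilset], rule psubsetI)
  have n: "x \<noteq> y" using assms by (simp add: il_def)
  have no: "\<not> il (u @ y # x # r) x y" using not_il_swap assms by blast
  show "ilset (u @ y # x # r) \<subseteq> ilset (u @ x # y # r)"
  proof
    fix e assume e: "e \<in> ilset (u @ y # x # r)"
    obtain p q where pq: "e = (p, q)" by (cases e)
    then have i: "il (u @ y # x # r) p q" using e by (simp add: ilset_def)
    have "{p, q} \<noteq> {x, y}"
    proof
      assume "{p, q} = {x, y}"
      then have "p = x \<and> q = y \<or> p = y \<and> q = x" by (simp add: doubleton_eq_iff)
      then show False using i no il_comm by metis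
    qed
    then show "e \<in> ilset (u @ x # y # r)" using il_swap[OF _ n] i pq by (simp add: ilset_def)
  qed
  show "ilset (u @ y # x # r) \<noteq> ilset (u @ x # y # r)" using assms no by (auto simp: ilset_def)
qed

lemma filter_count: "x \<notin> set l \<Longrightarrow> filter (\<lambda>t. t = x \<or> t = y) l = replicate (count_list l y) y"
  by (induction l) auto
lemma filter_count': "y \<notin> set l \<Longrightarrow> filter (\<lambda>t. t = x \<or> t = y) l = replicate (count_list l x) x"
  by (induction l) auto

section \<open>Events of layered diagrams\<close>

datatype event = EvN | EvX nat nat | EvCap nat | EvCup nat

fun caplab :: "event \<Rightarrow> nat option" where "caplab (EvCap x) = Some x" | "caplab _ = None"
fun cuplab :: "event \<Rightarrow> nat option" where "cuplab (EvCup x) = Some x" | "cuplab _ = None"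

lemma caplab_iff[simp]: "caplab e = Some x \<longleftrightarrow> e = EvCap x" by (cases e) auto
lemma cuplab_iff[simp]: "cuplab e = Some x \<longleftrightarrow> e = EvCup x" by (cases e) auto

lemma map_filter_split:
  "List.map_filter g es = A @ x # B \<Longrightarrow> \<exists>E1 e E2. es = E1 @ e # E2 \<and> g e = Some x \<and>
     List.map_filter g E1 = A \<and> List.map_filter g E2 = B"
proof (induction es arbitrary: A)
  case (Cons e es)
  show ?case
  proof (cases "g e")
    case None
    then obtain E1 e' E2 where "es = E1 @ e' # E2" "g e' = Some x" "List.map_filter g E1 = A" "List.map_filter g E2 = B"
      using Cons by (auto simp: List.map_filter_simps)
    then show ?thesis using None by (intro exI[of _ "e # E1"]) (auto simp: List.map_filter_simps)
  next
    case (Some y)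
    show ?thesis
    proof (cases A)
      case Nil
      then show ?thesis using Cons.prems Some
        by (intro exI[of _ "[]"] exI[of _ e] exI[of _ es]) (auto simp: List.map_filter_simps)
    next
      case (Cons z A')
      then have "List.map_filter g es = A' @ x # B" "y = z" using Cons.prems Some by (auto simp: List.map_filter_simps)
      then obtain E1 e' E2 where "es = E1 @ e' # E2" "g e' = Some x" "List.map_filter g E1 = A'" "List.map_filter g E2 = B"
        using Cons.IH by blast
      then show ?thesis using Some Cons \<open>y = z\<close> by (intro exI[of _ "e # E1"]) (auto simp: List.map_filter_simps)
    qed
  qed
qed (simp add: List.map_filter_simps)

lemma map_filter_mem: "g e = Some x \<Longrightarrow> e \<in> set es \<Longrightarrow> x \<in> set (List.map_filter g es)"
  by (induction es) (auto simp: List.map_filter_simps split: option.splits)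

text \<open>\<open>h\<close> is the constructor that \<open>g\<close> undoes, later
  \<open>EvCap\<close> or \<open>EvCup\<close>. Distinctness of the extracted labels rules out a
  second event with the same label.\<close>

lemma map_filter_pos:
  assumes g: "\<And>e x. g e = Some x \<longleftrightarrow> e = h x" and d: "distinct (List.map_filter g es)"
    and s: "List.map_filter g es = A @ x # B"
  shows "\<exists>E1 E2. es = E1 @ h x # E2 \<and> List.map_filter g E1 = A \<and> List.map_filter g E2 = B \<and>
     {i. i < length es \<and> es ! i = h x} = {length E1}"
proof -
  obtain E1 E2 where E: "es = E1 @ h x # E2" "List.map_filter g E1 = A" "List.map_filter g E2 = B"
    using map_filter_split[OF s] g by blast
  have "x \<notin> set A" "x \<notin> set B" using d s by auto
  then have n: "h x \<notin> set E1" "h x \<notin> set E2" using map_filter_mem[of g "h x" x] g E by blast+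
  have "i = length E1" if i: "i < length es" "es ! i = h x" for i
  proof (rule ccontr)
    assume "i \<noteq> length E1"
    then consider "i < length E1" | "i > length E1" by linarith
    then show False
    proof cases
      case 1
      then have "E1 ! i = h x" using i E(1) by (simp add: nth_append)
      then show False using n(1) 1 nth_mem by metis
    next
      case 2
      then obtain k where k: "i = Suc (length E1 + k)" using less_iff_Suc_add by blast
      then have "E2 ! k = h x" "k < length E2" using i E(1) by (simp_all add: nth_append)
      then show False using n(2) nth_mem by metis
    qed
  qed
  then have "{i. i < length es \<and> es ! i = h x} = {length E1}" using E(1) by auto
  then show ?thesis using E by blast
qed

text \<open>Normality in terms of the events from bottom to top. The caps come in reversed order
  because their heights must decrease from left to right. A string cannot cross itself, since
  \<open>il\<close> demands different labels.\<close>

definition evinv :: "nat list \<Rightarrow> nat list \<Rightarrow> event list \<Rightarrow> bool" where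
  "evinv w w' es \<longleftrightarrow> (\<forall>x y. EvX x y \<in> set es \<longrightarrow> il (w @ rev w') x y) \<and>
     sorted_wrt (\<lambda>e e'. \<forall>x y p q. e = EvX x y \<longrightarrow> e' = EvX p q \<longrightarrow> {x, y} \<noteq> {p, q}) es \<and>
     List.map_filter caplab es = rev (lefts w) \<and> List.map_filter cuplab es = lefts w' \<and>
     sorted_wrt (\<lambda>e e'. \<forall>x y. e = EvCup x \<longrightarrow> e' \<noteq> EvCap y) es"

definition lay :: "nat \<Rightarrow> item \<Rightarrow> nat \<Rightarrow> layer" where
  "lay k x r = replicate k I1 @ x # replicate r I1"

text \<open>At most one generator per layer, so different events lie at different heights. The
  labels name strings and hence agree on the two legs of a cup or cap.\<close>

inductive levent :: "layer \<Rightarrow> nat list \<Rightarrow> nat list \<Rightarrow> event \<Rightarrow> bool" where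
  le_id: "levent (replicate (length v) I1) v v EvN"
| le_x: "levent (lay (length u) Sx (length r)) (u @ x # y # r) (u @ y # x # r) (EvX x y)"
| le_cap: "levent (lay (length u) Cap (length r)) (u @ x # x # r) (u @ r) (EvCap x)"
| le_cup: "levent (lay (length u) Cup (length r)) (u @ r) (u @ x # x # r) (EvCup x)"

fun emap :: "(nat \<Rightarrow> nat) \<Rightarrow> event \<Rightarrow> event" where
  "emap f EvN = EvN"
| "emap f (EvX x y) = EvX (f x) (f y)"
| "emap f (EvCap x) = EvCap (f x)"
| "emap f (EvCup x) = EvCup (f x)"

text \<open>Needed when a cup added below joins two strings and their labels have to be
  merged.\<close>

lemma levent_map: "levent L v v' e \<Longrightarrow> levent L (map f v) (map f v') (emap f e)"
proof (induction rule: levent.induct)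
  case (le_id v)
  then show ?case using levent.le_id[of "map f v"] by simp
next
  case (le_x u r x y)
  then show ?case using levent.le_x[of "map f u" "map f r" "f x" "f y"] by simp
next
  case (le_cap u r x)
  then show ?case using levent.le_cap[of "map f u" "map f r" "f x"] by simp
next
  case (le_cup u r x)
  then show ?case using levent.le_cup[of "map f u" "map f r" "f x"] by simp
qed

lemma lrel_step:
  "lrel t L u u' \<Longrightarrow> lrel t (I1 # L) (x # u) (x # u')"
  "lrel t L u u' \<Longrightarrow> lrel t (Sx # L) (x # y # u) (y # x # u')"
  "lrel t L u u' \<Longrightarrow> lrel t (Cap # L) (x # t x # u) u'"
  "lrel t L u u' \<Longrightarrow> lrel t (Cup # L) u (x # t x # u')"
  by simp_all

lemma lrel_prefix:
  assumes "lrel t L v v'"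
  shows "lrel t (replicate (length u) I1 @ L) (u @ v) (u @ v')"
proof (induction u)
  case Nil
  show ?case unfolding list.size(3) replicate_0 append_Nil by (rule assms)
next
  case (Cons a u)
  show ?case unfolding length_Cons replicate_Suc append_Cons by (rule lrel_step(1)[OF Cons.IH])
qed

lemma lrel_Nil: "lrel t [] [] []" by simp

lemma lrel_ids: "lrel t (replicate (length u) I1) u u"
  using lrel_prefix[OF lrel_Nil, of t u] unfolding append_Nil2 .

lemma levent_lrel: "levent L v v' e \<Longrightarrow> lrel (\<lambda>x. x) L v v'"
proof (induction rule: levent.induct)
  case (le_id v)
  show ?case by (rule lrel_ids)
next
  case (le_x u r x y)
  show ?case unfolding lay_def by (rule lrel_prefix, rule lrel_step(2)[where t = "\<lambda>x. x"], rule lrel_ids)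
next
  case (le_cap u r x)
  show ?case unfolding lay_def by (rule lrel_prefix, rule lrel_step(3)[where t = "\<lambda>x. x"], rule lrel_ids)
next
  case (le_cup u r x)
  show ?case unfolding lay_def by (rule lrel_prefix, rule lrel_step(4)[where t = "\<lambda>x. x"], rule lrel_ids)
qed

lemma occs_replicate: "x \<noteq> I1 \<Longrightarrow> (x, p, q) \<in> layer_occs ob ot (replicate k I1 @ L) \<longleftrightarrow> (x, p, q) \<in> layer_occs (ob + k) (ot + k) L"
  by (induction k arbitrary: ob ot) auto

lemma occs_ids: "x \<noteq> I1 \<Longrightarrow> (x, p, q) \<notin> layer_occs ob ot (replicate k I1)"
  by (induction k arbitrary: ob ot) auto

lemma occs_lay: "x \<noteq> I1 \<Longrightarrow> (x, p, q) \<in> layer_occs 0 0 (lay k y r) \<longleftrightarrow> x = y \<and> p = k \<and> q = k"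
  by (auto simp: lay_def occs_replicate occs_ids)

lemma levent_Sx: "levent L v v' e \<Longrightarrow> \<exists>k. \<forall>ob ot. (Sx, ob, ot) \<in> layer_occs 0 0 L \<longrightarrow>
   ob = k \<and> ot = k \<and> Suc k < length v \<and> e = EvX (v ! k) (v ! Suc k)"
proof (induction rule: levent.induct)
  case (le_x u r x y)
  show ?case by (rule exI[of _ "length u"]) (auto simp: occs_lay nth_append)
qed (auto simp: occs_lay occs_ids)

lemma levent_Cap: "levent L v v' e \<Longrightarrow> (Cap, ob, ot) \<in> layer_occs 0 0 L \<Longrightarrow> ob < length v \<and> e = EvCap (v ! ob)"
  by (induction rule: levent.induct) (auto simp: occs_lay occs_ids nth_append)

lemma levent_Cap': "levent L v v' (EvCap x) \<Longrightarrow> \<exists>ob ot. (Cap, ob, ot) \<in> layer_occs 0 0 L"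
  by (cases rule: levent.cases) (auto simp: occs_lay)

lemma levent_Cup: "levent L v v' e \<Longrightarrow> (Cup, ob, ot) \<in> layer_occs 0 0 L \<Longrightarrow> ot < length v' \<and> e = EvCup (v' ! ot)"
  by (induction rule: levent.induct) (auto simp: occs_lay occs_ids nth_append)

lemma levent_Cup': "levent L v v' (EvCup x) \<Longrightarrow> \<exists>ob ot. (Cup, ob, ot) \<in> layer_occs 0 0 L"
  by (cases rule: levent.cases) (auto simp: occs_lay)

section \<open>Prepending a layer\<close>

definition sh :: "nat \<times> nat \<Rightarrow> nat \<times> nat" where "sh u = (Suc (fst u), snd u)"

lemma conn_refl[simp]: "conn D u u" by (simp add: conn_def)
lemma conn_trans: "conn D u v \<Longrightarrow> conn D v w \<Longrightarrow> conn D u w"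
  unfolding conn_def by (rule rtrancl_trans)
lemma conn_sym: "conn D u v \<Longrightarrow> conn D v u"
  unfolding conn_def by (metis converse_Un converse_converse rtrancl_converseI sup_commute)
lemma conn_edge: "(u, v) \<in> edges D \<Longrightarrow> conn D u v"
  unfolding conn_def by blast

lemma item_edges_sh: "(u, v) \<in> item_edges i ob ot x \<Longrightarrow> (sh u, sh v) \<in> item_edges (Suc i) ob ot x"
  by (cases x) (auto simp: sh_def)

lemma edges_Cons_sh: assumes "(u, v) \<in> edges D" shows "(sh u, sh v) \<in> edges (L # D)"
proof -
  obtain x i ob ot where *: "i < length D" "(x, ob, ot) \<in> layer_occs 0 0 (D ! i)" "(u, v) \<in> item_edges i ob ot x"
    using assms by (rule edge_occ)
  have "(x, Suc i, ob, ot) \<in> occs (L # D)" using * by (simp add: occs_def)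
  then show ?thesis unfolding edges_def using item_edges_sh[OF *(3)] by blast
qed

lemma edges_Cons_0: assumes "(x, ob, ot) \<in> layer_occs 0 0 L" "e \<in> item_edges 0 ob ot x" shows "e \<in> edges (L # D)"
proof -
  have "(x, 0, ob, ot) \<in> occs (L # D)" using assms by (simp add: occs_def)
  then show ?thesis unfolding edges_def using assms(2) by blast
qed

lemma conn_sh: assumes "conn D u v" shows "conn (L # D) (sh u) (sh v)"
proof -
  have "conn (L # D) (sh u) (sh x) = conn (L # D) (sh u) (sh y)" if "(x, y) \<in> edges D" for x y
    using conn_edge[OF edges_Cons_sh[OF that]] conn_trans conn_sym by blast
  from conn_induct[OF assms, of "\<lambda>x. conn (L # D) (sh u) (sh x)", OF conn_refl this] show ?thesis .
qed

lemma occs_I1: "i < k \<Longrightarrow> (I1, ob + i, ot + i) \<in> layer_occs ob ot (replicate k I1 @ L)"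
proof (induction k arbitrary: i ob ot)
  case (Suc k)
  show ?case
  proof (cases i)
    case (Suc i')
    then show ?thesis using Suc.IH[of i' "Suc ob" "Suc ot"] Suc.prems by simp
  qed simp
qed simp

lemma occs_skip: "o1 \<in> layer_occs (ob + k) (ot + k) L \<Longrightarrow> o1 \<in> layer_occs ob ot (replicate k I1 @ L)"
  by (induction k arbitrary: ob ot) auto

lemma lay_occs:
  "i < k \<Longrightarrow> (I1, i, i) \<in> layer_occs 0 0 (lay k Y r)"
  "(Y, k, k) \<in> layer_occs 0 0 (lay k Y r)"
  "i < r \<Longrightarrow> (I1, k + isrc Y + i, k + itgt Y + i) \<in> layer_occs 0 0 (lay k Y r)"
proof -
  show "i < k \<Longrightarrow> (I1, i, i) \<in> layer_occs 0 0 (lay k Y r)"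
    using occs_I1[of i k 0 0] by (simp add: lay_def)
  show "(Y, k, k) \<in> layer_occs 0 0 (lay k Y r)"
    unfolding lay_def by (rule occs_skip) simp
  show "i < r \<Longrightarrow> (I1, k + isrc Y + i, k + itgt Y + i) \<in> layer_occs 0 0 (lay k Y r)"
    unfolding lay_def by (rule occs_skip) (use occs_I1[of i r "k + isrc Y" "k + itgt Y" "[]"] in simp)
qed

lemma lay_conn:
  "i < k \<Longrightarrow> conn (lay k Y r # D) (0, i) (1, i)"
  "i < r \<Longrightarrow> conn (lay k Y r # D) (0, k + isrc Y + i) (1, k + itgt Y + i)"
  "e \<in> item_edges 0 k k Y \<Longrightarrow> conn (lay k Y r # D) (fst e) (snd e)"
proof -
  show "i < k \<Longrightarrow> conn (lay k Y r # D) (0, i) (1, i)"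
    by (rule conn_edge, rule edges_Cons_0[OF lay_occs(1)]) auto
  show "i < r \<Longrightarrow> conn (lay k Y r # D) (0, k + isrc Y + i) (1, k + itgt Y + i)"
    by (rule conn_edge, rule edges_Cons_0[OF lay_occs(3)]) auto
  show "e \<in> item_edges 0 k k Y \<Longrightarrow> conn (lay k Y r # D) (fst e) (snd e)"
    by (rule conn_edge, rule edges_Cons_0[OF lay_occs(2)]) simp
qed

text \<open>The converse, equality of labels on connected points, follows from the labels being
  constant along edges; see \<open>realizes_conn\<close>.\<close>

definition linked :: "diagram \<Rightarrow> nat list list \<Rightarrow> bool" where
  "linked D W \<longleftrightarrow> (\<forall>u v. vertex W u \<longrightarrow> vertex W v \<longrightarrow> lab W u = lab W v \<longrightarrow> conn D u v)"

text \<open>Prepending a layer shifts all old points by \<open>sh\<close>, and \<open>f\<close>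
  renames their labels. Each new bottom point is tied to an old point of the same label, except for
  the feet of a new cap: in that case \<open>B\<close> holds, \<open>x0\<close> is the label of the
  cap, fresh by \<open>Fr\<close>, and \<open>k0\<close> is its left foot.\<close>

lemma linked_Cons:
  assumes W: "W \<noteq> []"
    and M: "\<And>z1 z2. vertex W z1 \<Longrightarrow> vertex W z2 \<Longrightarrow> f (lab W z1) = f (lab W z2) \<Longrightarrow> conn (L # D) (sh z1) (sh z2)"
    and Sv: "\<And>p. p < length v \<Longrightarrow> (\<exists>p'<length (W ! 0). f (W ! 0 ! p') = v ! p \<and> conn (L # D) (0, p) (1, p'))
       \<or> (B \<and> v ! p = x0 \<and> conn (L # D) (0, p) (0, k0))"
    and Fr: "\<And>z. B \<Longrightarrow> vertex W z \<Longrightarrow> f (lab W z) \<noteq> x0"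
  shows "linked (L # D) (v # map (map f) W)"
  unfolding linked_def
proof (intro allI impI)
  let ?W = "v # map (map f) W"
  have R: "(\<exists>z0. vertex W z0 \<and> f (lab W z0) = lab ?W z \<and> conn (L # D) z (sh z0)) \<or>
      (B \<and> lab ?W z = x0 \<and> conn (L # D) z (0, k0))" if "vertex ?W z" for z
  proof (cases z)
    case (Pair i p)
    show ?thesis
    proof (cases i)
      case 0
      then have "p < length v" "lab ?W z = v ! p" using that Pair by (auto simp: vertex_def lab_def)
      from Sv[OF this(1)] show ?thesis
      proof
        assume "\<exists>p'<length (W ! 0). f (W ! 0 ! p') = v ! p \<and> conn (L # D) (0, p) (1, p')"
        then obtain p' where "p' < length (W ! 0)" "f (W ! 0 ! p') = v ! p" "conn (L # D) (0, p) (1, p')" by blast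
        then have "vertex W (0, p') \<and> f (lab W (0, p')) = lab ?W z \<and> conn (L # D) z (sh (0, p'))"
          using W Pair 0 \<open>lab ?W z = v ! p\<close> by (simp add: vertex_def lab_def sh_def)
        then show ?thesis by blast
      qed (use Pair 0 \<open>lab ?W z = v ! p\<close> in simp)
    next
      case (Suc j)
      then have "vertex W (j, p) \<and> f (lab W (j, p)) = lab ?W z \<and> sh (j, p) = z"
        using that Pair by (auto simp: vertex_def lab_def sh_def)
      then show ?thesis by (metis conn_refl)
    qed
  qed
  fix z1 z2 assume z: "vertex ?W z1" "vertex ?W z2" "lab ?W z1 = lab ?W z2"
  from R[OF z(1)] show "conn (L # D) z1 z2"
  proof
    assume "\<exists>z0. vertex W z0 \<and> f (lab W z0) = lab ?W z1 \<and> conn (L # D) z1 (sh z0)"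
    then obtain a where a: "vertex W a" "f (lab W a) = lab ?W z1" "conn (L # D) z1 (sh a)" by blast
    from R[OF z(2)] show ?thesis
    proof
      assume "\<exists>z0. vertex W z0 \<and> f (lab W z0) = lab ?W z2 \<and> conn (L # D) z2 (sh z0)"
      then obtain b where b: "vertex W b" "f (lab W b) = lab ?W z2" "conn (L # D) z2 (sh b)" by blast
      have "conn (L # D) (sh a) (sh b)" using M[OF a(1) b(1)] a(2) b(2) z(3) by simp
      then show ?thesis using a(3) conn_sym[OF b(3)] conn_trans by blast
    next
      assume "B \<and> lab ?W z2 = x0 \<and> conn (L # D) z2 (0, k0)"
      then show ?thesis using Fr[OF _ a(1)] a(2) z(3) by simp
    qed
  next
    assume c: "B \<and> lab ?W z1 = x0 \<and> conn (L # D) z1 (0, k0)"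
    from R[OF z(2)] show ?thesis
    proof
      assume "\<exists>z0. vertex W z0 \<and> f (lab W z0) = lab ?W z2 \<and> conn (L # D) z2 (sh z0)"
      then show ?thesis using Fr c z(3) by auto
    next
      assume "B \<and> lab ?W z2 = x0 \<and> conn (L # D) z2 (0, k0)"
      then show ?thesis using c conn_sym conn_trans by blast
    qed
  qed
qed

text \<open>The last condition, that every label occurs on the boundary, is what will exclude
  loops.\<close>

definition realizes :: "nat list \<Rightarrow> nat list \<Rightarrow> diagram \<Rightarrow> nat list list \<Rightarrow> event list \<Rightarrow> bool" where
  "realizes w w' D W es \<longleftrightarrow> D \<noteq> [] \<and> length W = Suc (length D) \<and> length es = length D \<and> W ! 0 = w \<and> W ! length D = w' \<and>
     (\<forall>i<length D. levent (D ! i) (W ! i) (W ! Suc i) (es ! i)) \<and> linked D W \<and>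
     (\<forall>v\<in>set W. set v \<subseteq> set w \<union> set w')"

lemma vertex_mem: "vertex W u \<Longrightarrow> \<exists>v\<in>set W. lab W u \<in> set v"
  unfolding vertex_def lab_def by (metis nth_mem)

lemma realizes_lab: "realizes w w' D W es \<Longrightarrow> vertex W u \<Longrightarrow> lab W u \<in> set w \<union> set w'"
  using vertex_mem[of W u] unfolding realizes_def by blast

lemma realizes_Cons:
  assumes b: "realizes w1 w1' D W es" and e: "levent L v (map f w1) e" and l: "linked (L # D) (v # map (map f) W)"
    and s: "f ` set w1 \<subseteq> set v \<union> f ` set w1'"
  shows "realizes v (map f w1') (L # D) (v # map (map f) W) (e # map (emap f) es)"
  unfolding realizes_def
proof (intro conjI allI impI)
  have W: "length W = Suc (length D)" "W ! 0 = w1" "W ! length D = w1'" "length es = length D"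
    "\<And>i. i < length D \<Longrightarrow> levent (D ! i) (W ! i) (W ! Suc i) (es ! i)"
    "\<forall>v\<in>set W. set v \<subseteq> set w1 \<union> set w1'" using b by (auto simp: realizes_def)
  show "length (v # map (map f) W) = Suc (length (L # D))" "length (e # map (emap f) es) = length (L # D)"
    "(v # map (map f) W) ! length (L # D) = map f w1'" using W by simp_all
  fix i assume i: "i < length (L # D)"
  show "levent ((L # D) ! i) ((v # map (map f) W) ! i) ((v # map (map f) W) ! Suc i) ((e # map (emap f) es) ! i)"
  proof (cases i)
    case 0
    then show ?thesis using e W(1,2) by simp
  next
    case (Suc j)
    then show ?thesis using levent_map[OF W(5)[of j], of f] i W(1,4) by simp
  qed
next
  have "\<forall>v\<in>set W. set v \<subseteq> set w1 \<union> set w1'" using b by (auto simp: realizes_def)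
  then show "\<forall>u\<in>set (v # map (map f) W). set u \<subseteq> set v \<union> set (map f w1')" using s by fastforce
qed (use l in simp_all)

lemma emap_id: "map (emap (\<lambda>x. x)) es = es"
proof (rule map_idI)
  show "emap (\<lambda>x. x) e = e" for e by (cases e) auto
qed

lemma linked_M: "realizes w w' D W es \<Longrightarrow> vertex W z1 \<Longrightarrow> vertex W z2 \<Longrightarrow> lab W z1 = lab W z2 \<Longrightarrow> conn (L # D) (sh z1) (sh z2)"
  by (rule conn_sh) (auto simp: realizes_def linked_def)

text \<open>\<open>is_diagram\<close> demands at least one layer, so the construction starts from a
  single identity layer.\<close>

lemma realizes_id: assumes "distinct w" shows "realizes w w [replicate (length w) I1] [w, w] [EvN]"
proof -
  let ?D = "[replicate (length w) I1]"
  have c: "conn ?D (0, p) (1, p)" if "p < length w" for p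
    by (rule conn_edge, rule edges_Cons_0[of I1 p p]) (use occs_I1[OF that, of 0 0 "[]"] in auto)
  have "linked ?D [w, w]" unfolding linked_def
  proof (intro allI impI)
    fix u v assume *: "vertex [w, w] u" "vertex [w, w] v" "lab [w, w] u = lab [w, w] v"
    have k: "fst z < 2 \<and> snd z < length w \<and> lab [w, w] z = w ! snd z \<and> conn ?D (0, snd z) z" if "vertex [w, w] z" for z
    proof (cases z)
      case (Pair i p)
      then show ?thesis using that c[of p] by (cases i) (auto simp: vertex_def lab_def less_Suc_eq)
    qed
    have "w ! snd u = w ! snd v" using k[OF *(1)] k[OF *(2)] *(3) by simp
    then have "snd u = snd v" using nth_eq_iff_index_eq[OF assms, of "snd u" "snd v"] k[OF *(1)] k[OF *(2)] by blast
    then show "conn ?D u v" using k[OF *(1)] k[OF *(2)] conn_sym[of ?D "(0, snd u)" u] conn_trans[of ?D u "(0, snd u)" v] by simp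
  qed
  then show ?thesis unfolding realizes_def using levent.le_id[of w] by simp
qed

lemma realizes_swap:
  assumes b: "realizes (u @ y # x # r) w' D W es"
  shows "\<exists>D' W'. realizes (u @ x # y # r) w' D' W' (EvX x y # es)"
proof -
  let ?L = "lay (length u) Sx (length r)" and ?v = "u @ x # y # r" and ?w = "u @ y # x # r"
  have W: "W \<noteq> []" "W ! 0 = ?w" using b by (auto simp: realizes_def)
  have l: "linked (?L # D) (?v # map (map (\<lambda>x. x)) W)"
  \<comment> \<open>The new layer contains no cap, so the exceptional alternative is switched off,
    and its label and position are dummies.\<close>
  proof (rule linked_Cons[OF W(1), of _ _ _ _ False])
    fix p assume p: "p < length ?v"
    let ?P = "\<lambda>p'. p' < length (W ! 0) \<and> W ! 0 ! p' = ?v ! p \<and> conn (?L # D) (0, p) (1, p')"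
    consider "p < length u" | "p = length u" | "p = Suc (length u)" | i where "p = length u + 2 + i" "i < length r"
    proof -
      have "p < length u \<or> p = length u \<or> p = Suc (length u) \<or> (\<exists>i. p = length u + 2 + i)" by presburger
      then show ?thesis using that p by auto
    qed
    then have "\<exists>p'. ?P p'"
    proof cases
      case 1
      then show ?thesis using lay_conn(1)[OF 1] W by (intro exI[of _ p]) (simp add: nth_append)
    next
      case 2
      then show ?thesis using lay_conn(3)[of "((0, length u), (Suc 0, Suc (length u)))" "length u" Sx] W
        by (intro exI[of _ "Suc p"]) (simp add: nth_append)
    next
      case 3
      then show ?thesis using lay_conn(3)[of "((0, Suc (length u)), (Suc 0, length u))" "length u" Sx] W
        by (intro exI[of _ "length u"]) (simp add: nth_append)
    next
      case 4
      then show ?thesis using lay_conn(2)[OF 4(2), of "length u" Sx D] W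
        by (intro exI[of _ p]) (simp add: nth_append)
    qed
    then show "(\<exists>p'<length (W ! 0). W ! 0 ! p' = ?v ! p \<and> conn (?L # D) (0, p) (1, p'))
       \<or> (False \<and> ?v ! p = 0 \<and> conn (?L # D) (0, p) (0, 0))" by blast
  qed (use linked_M[OF b] in auto)
  have "realizes ?v (map (\<lambda>x. x) w') (?L # D) (?v # map (map (\<lambda>x. x)) W) (EvX x y # map (emap (\<lambda>x. x)) es)"
    by (rule realizes_Cons[OF b _ l]) (use levent.le_x[of u r x y] in auto)
  then show ?thesis unfolding emap_id by auto
qed

lemma realizes_cap:
  assumes b: "realizes (u @ r) w' D W es" and x: "x \<notin> set u" "x \<notin> set r" "x \<notin> set w'"
  shows "\<exists>D' W'. realizes (u @ x # x # r) w' D' W' (EvCap x # es)"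
proof -
  let ?L = "lay (length u) Cap (length r)" and ?v = "u @ x # x # r" and ?w = "u @ r"
  have W: "W \<noteq> []" "W ! 0 = ?w" using b by (auto simp: realizes_def)
  have l: "linked (?L # D) (?v # map (map (\<lambda>x. x)) W)"
  proof (rule linked_Cons[OF W(1), of _ _ _ _ True x "length u"])
    fix p assume p: "p < length ?v"
    let ?P = "\<lambda>p'. p' < length (W ! 0) \<and> W ! 0 ! p' = ?v ! p \<and> conn (?L # D) (0, p) (1, p')"
    consider "p < length u" | "p = length u" | "p = Suc (length u)" | i where "p = length u + 2 + i" "i < length r"
    proof -
      have "p < length u \<or> p = length u \<or> p = Suc (length u) \<or> (\<exists>i. p = length u + 2 + i)" by presburger
      then show ?thesis using that p by auto
    qed
    then have "(\<exists>p'. ?P p') \<or> (?v ! p = x \<and> conn (?L # D) (0, p) (0, length u))"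
    proof cases
      case 1
      then have "?P p" using lay_conn(1)[OF 1] W by (simp add: nth_append)
      then show ?thesis by blast
    next
      case 3
      have "conn (?L # D) (0, length u) (0, Suc (length u))"
        using lay_conn(3)[of "((0, length u), (0, Suc (length u)))" "length u" Cap] by simp
      then show ?thesis using 3 conn_sym by (simp add: nth_append)
    next
      case 4
      then have "?P (length u + i)" using lay_conn(2)[OF 4(2), of "length u" Cap D] W
        by (simp add: nth_append)
      then show ?thesis by blast
    qed (simp add: nth_append)
    then show "(\<exists>p'<length (W ! 0). W ! 0 ! p' = ?v ! p \<and> conn (?L # D) (0, p) (1, p'))
       \<or> (True \<and> ?v ! p = x \<and> conn (?L # D) (0, p) (0, length u))" by blast
  next
    fix z assume "vertex W z"
    then show "lab W z \<noteq> x" using realizes_lab[OF b] x by fastforce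
  qed (use linked_M[OF b] in auto)
  have "realizes ?v (map (\<lambda>x. x) w') (?L # D) (?v # map (map (\<lambda>x. x)) W) (EvCap x # map (emap (\<lambda>x. x)) es)"
    by (rule realizes_Cons[OF b _ l]) (use levent.le_cap[of u r x] in auto)
  then show ?thesis unfolding emap_id by auto
qed

text \<open>The upper part has separate strings \<open>x\<close> and \<open>y\<close>, which the new
  cup joins at their lower ends; \<open>f\<close> merges their labels. Both occur in the top word,
  so the merged label stays on the boundary.\<close>

lemma realizes_cup:
  assumes b: "realizes (u @ x # y # r) w1' D W es" and f: "f = (\<lambda>t. if t = y then x else t)"
    and y: "y \<notin> set u" "y \<notin> set r" and x: "x \<in> set w1'" "y \<in> set w1'"
  shows "\<exists>D' W'. realizes (u @ r) (map f w1') D' W' (EvCup x # map (emap f) es)"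
proof -
  let ?L = "lay (length u) Cup (length r)" and ?v = "u @ r" and ?w = "u @ x # y # r"
  have W: "W \<noteq> []" "W ! 0 = ?w" using b by (auto simp: realizes_def)
  have fu: "map f u = u" "map f r = r" using y by (auto simp: f intro!: map_idI)
  have fu': "f (u ! i) = u ! i" if "i < length u" for i using fu(1) that by (metis nth_map)
  have fr': "f (r ! i) = r ! i" if "i < length r" for i using fu(2) that by (metis nth_map)
  have vx: "vertex W (0, length u)" "lab W (0, length u) = x" "vertex W (0, Suc (length u))" "lab W (0, Suc (length u)) = y"
    using W by (auto simp: vertex_def lab_def nth_append)
  have cc: "conn (?L # D) (sh (0, length u)) (sh (0, Suc (length u)))"
    using lay_conn(3)[of "((Suc 0, length u), (Suc 0, Suc (length u)))" "length u" Cup] by (simp add: sh_def)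
  have "linked (?L # D) (?v # map (map f) W)"
  proof (rule linked_Cons[OF W(1), of _ _ _ _ False])
    fix z1 z2 assume z: "vertex W z1" "vertex W z2" "f (lab W z1) = f (lab W z2)"
    have to: "conn (?L # D) (sh z) (sh (0, length u))" if "vertex W z" "lab W z = x \<or> lab W z = y" for z
      using that(2)
    proof
      assume "lab W z = x"
      then show ?thesis using linked_M[OF b that(1) vx(1)] vx(2) by simp
    next
      assume "lab W z = y"
      then have "conn (?L # D) (sh z) (sh (0, Suc (length u)))" using linked_M[OF b that(1) vx(3)] vx(4) by simp
      then show ?thesis using conn_sym[OF cc] conn_trans by blast
    qed
    show "conn (?L # D) (sh z1) (sh z2)"
    proof (cases "lab W z1 = lab W z2")
      case True
      then show ?thesis using linked_M[OF b z(1,2)] by simp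
    next
      case False
      then have "lab W z1 \<in> {x, y}" "lab W z2 \<in> {x, y}" using z(3) by (auto simp: f split: if_splits)
      then show ?thesis using to[OF z(1)] conn_sym[OF to[OF z(2)]] conn_trans by blast
    qed
  next
    fix p assume p: "p < length ?v"
    let ?P = "\<lambda>p'. p' < length (W ! 0) \<and> f (W ! 0 ! p') = ?v ! p \<and> conn (?L # D) (0, p) (1, p')"
    consider "p < length u" | i where "p = length u + i" "i < length r"
    proof -
      have "p < length u \<or> (\<exists>i. p = length u + i)" by presburger
      then show ?thesis using that p by auto
    qed
    then have "\<exists>p'. ?P p'"
    proof cases
      case 1
      then have "?P p" using lay_conn(1)[OF 1] W fu'[OF 1] by (simp add: nth_append)
      then show ?thesis by blast
    next
      case 2
      then have "?P (length u + 2 + i)" using lay_conn(2)[OF 2(2), of "length u" Cup D] W fr'[OF 2(2)]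
        by (simp add: nth_append)
      then show ?thesis by blast
    qed
    then show "(\<exists>p'<length (W ! 0). f (W ! 0 ! p') = ?v ! p \<and> conn (?L # D) (0, p) (1, p'))
       \<or> (False \<and> ?v ! p = 0 \<and> conn (?L # D) (0, p) (0, 0))" by blast
  qed auto
  moreover have "levent ?L ?v (map f ?w) (EvCup x)"
    using levent.le_cup[of u r x] fu by (simp add: f)
  moreover have "f ` set ?w \<subseteq> set ?v \<union> f ` set w1'" using x by (auto simp: f)
  ultimately show ?thesis using realizes_Cons[OF b] by blast
qed

section \<open>Existence of normal diagrams\<close>

definition realizable :: "nat list \<Rightarrow> nat list \<Rightarrow> bool" where
  "realizable w w' \<longleftrightarrow> (\<exists>D W es. realizes w w' D W es \<and> evinv w w' es)"

text \<open>Once exchanged, \<open>x\<close> and \<open>y\<close> no longer interlace, so no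
  crossing above involves this pair. For all other pairs interlacing is unaffected by the
  exchange.\<close>

lemma realizable_swap:
  assumes g: "realizable (u @ y # x # r) w'" and i: "il ((u @ x # y # r) @ rev w') x y"
    and l: "lefts (u @ y # x # r) = lefts (u @ x # y # r)"
  shows "realizable (u @ x # y # r) w'"
proof -
  obtain D W es where b: "realizes (u @ y # x # r) w' D W es" and e: "evinv (u @ y # x # r) w' es"
    using g unfolding realizable_def by blast
  obtain D' W' where b': "realizes (u @ x # y # r) w' D' W' (EvX x y # es)" using realizes_swap[OF b] by blast
  have i: "il (u @ x # y # (r @ rev w')) x y" using i by simp
  have n: "x \<noteq> y" using i by (simp add: il_def)
  have no: "{x, y} \<noteq> {p, q} \<and> il (u @ x # y # (r @ rev w')) p q" if "EvX p q \<in> set es" for p q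
  proof -
    have pq: "il (u @ y # x # (r @ rev w')) p q" using e that by (simp add: evinv_def)
    have "{p, q} \<noteq> {x, y}"
    proof
      assume "{p, q} = {x, y}"
      then have "p = x \<and> q = y \<or> p = y \<and> q = x" by (simp add: doubleton_eq_iff)
      then show False using pq not_il_swap[OF i] il_comm by metis
    qed
    then show ?thesis using il_swap[OF _ n] pq by simp
  qed
  have "evinv (u @ x # y # r) w' (EvX x y # es)"
    unfolding evinv_def
  proof (intro conjI)
    show "\<forall>p q. EvX p q \<in> set (EvX x y # es) \<longrightarrow> il ((u @ x # y # r) @ rev w') p q"
      using no i by auto
  qed (use e no l in \<open>auto simp: evinv_def List.map_filter_simps\<close>)
  then show ?thesis using b' unfolding realizable_def by blast
qed

text \<open>The new cap is the lowest one, so its left end must be the rightmost of all; this is the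
  assumption on \<open>lefts\<close>.\<close>

lemma realizable_cap:
  assumes g: "realizable (u @ r) w'" and x: "x \<notin> set u" "x \<notin> set r" "x \<notin> set w'"
    and l: "lefts (u @ x # x # r) = lefts (u @ r) @ [x]"
  shows "realizable (u @ x # x # r) w'"
proof -
  obtain D W es where b: "realizes (u @ r) w' D W es" and e: "evinv (u @ r) w' es"
    using g unfolding realizable_def by blast
  obtain D' W' where b': "realizes (u @ x # x # r) w' D' W' (EvCap x # es)" using realizes_cap[OF b x] by blast
  have il: "il ((u @ x # x # r) @ rev w') p q" if "EvX p q \<in> set es" for p q
  proof -
    have pq: "il ((u @ r) @ rev w') p q" using e that by (simp add: evinv_def)
    then have "x \<noteq> p" "x \<noteq> q" using il_mem[OF pq] x by auto
    then show ?thesis using pq by (simp add: il_def)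
  qed
  have "evinv (u @ x # x # r) w' (EvCap x # es)"
    unfolding evinv_def
  proof (intro conjI)
    show "\<forall>p q. EvX p q \<in> set (EvCap x # es) \<longrightarrow> il ((u @ x # x # r) @ rev w') p q"
      using il by auto
  qed (use e l in \<open>auto simp: evinv_def List.map_filter_simps\<close>)
  then show ?thesis using b' unfolding realizable_def by blast
qed

lemma map_filter_emap:
  "List.map_filter caplab (map (emap f) es) = map f (List.map_filter caplab es)"
  "List.map_filter cuplab (map (emap f) es) = map f (List.map_filter cuplab es)"
proof -
  have "caplab (emap f e) = map_option f (caplab e)" "cuplab (emap f e) = map_option f (cuplab e)" for e
    by (cases e; simp)+
  then show "List.map_filter caplab (map (emap f) es) = map f (List.map_filter caplab es)"
    "List.map_filter cuplab (map (emap f) es) = map f (List.map_filter cuplab es)"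
    by (induction es; simp add: List.map_filter_simps split: option.split)+
qed

lemma emap_inv:
  "emap f e = EvX x y \<Longrightarrow> \<exists>p q. e = EvX p q \<and> x = f p \<and> y = f q"
  "emap f e = EvCap x \<Longrightarrow> \<exists>p. e = EvCap p"
  "emap f e = EvCup x \<Longrightarrow> \<exists>p. e = EvCup p"
  by (cases e; simp)+

lemma lefts_skip: "distinct p \<Longrightarrow> set p \<inter> set t = {} \<Longrightarrow> lefts (p @ t) = lefts t"
  by (induction p) auto

lemma alt_hd_last: "X = [y, t, y, t] \<or> X = [t, y, t, y] \<Longrightarrow> y \<noteq> t \<Longrightarrow> hd X \<noteq> last X"
  by auto

text \<open>An alternating word of length four begins and ends with different letters, whereas this
  one has the same letter at both ends.\<close>

lemma ends_eq_not_alt: "x \<noteq> b \<Longrightarrow> replicate k b @ x # M @ x # replicate k b \<noteq> [x, b, x, b] \<and>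
   replicate k b @ x # M @ x # replicate k b \<noteq> [b, x, b, x]"
proof -
  assume n: "x \<noteq> b"
  let ?L = "replicate k b @ x # M @ x # replicate k b"
  have "hd ?L = last ?L" by (cases k) auto
  then show ?thesis using alt_hd_last[of ?L x b] n by blast
qed

text \<open>In the extended word the left leg \<open>x\<close> of the cup interlaces nothing, so after the two legs are joined
  the cup meets any other string at most once.\<close>

lemma realizable_cup:
  assumes g: "realizable (p @ x # y # v) (p @ x # q1 @ y # q2)" (is "realizable ?w1 ?w1'")
    and d: "distinct p" "distinct v" "set p \<inter> set v = {}"
    and x: "x \<notin> set p" "x \<notin> set v" "x \<notin> set q1" "x \<notin> set q2"
    and y: "y \<notin> set p" "y \<notin> set v" "y \<notin> set q1" "y \<notin> set q2" "y \<noteq> x"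
    and pq: "set p \<inter> set q1 = {}" "set p \<inter> set q2 = {}"
    and l: "lefts (p @ x # q1 @ x # q2) = x # lefts (p @ x # q1 @ y # q2)" and ny: "y \<notin> set (lefts (p @ x # q1 @ y # q2))"
  shows "realizable (p @ v) (p @ x # q1 @ x # q2)"
proof -
  define f where "f = (\<lambda>t. if t = y then x else t)"
  let ?w = "p @ v" and ?w' = "p @ x # q1 @ x # q2"
  obtain D W es where b: "realizes ?w1 ?w1' D W es" and e: "evinv ?w1 ?w1' es"
    using g unfolding realizable_def by blast
  have fid: "map f u = u" if "y \<notin> set u" for u using that by (intro map_idI) (auto simp: f_def)
  have fw: "map f ?w1' = ?w'" using fid y by (simp add: f_def)
  obtain D' W' where b': "realizes ?w ?w' D' W' (EvCup x # map (emap f) es)"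
    using realizes_cup[OF b f_def y(1,2)] fw by auto
  have eil: "il (?w1 @ rev ?w1') s t" if "EvX s t \<in> set es" for s t using e that by (simp add: evinv_def)
  let ?F = "\<lambda>s t. filter (\<lambda>a. a = s \<or> a = t)"
  \<comment> \<open>The part \<open>p\<close> precedes \<open>x\<close> in both boundary words, so
    the circle word, restricted to \<open>x\<close> and \<open>t\<close>, has equal ends.\<close>
  have nx: "\<not> il (?w1 @ rev ?w1') x t" for t
  proof
    assume i: "il (?w1 @ rev ?w1') x t"
    then have xt: "x \<noteq> t" by (simp add: il_def)
    have "?F x t p = replicate (count_list p t) t" by (rule filter_count[OF x(1)])
    moreover have "?F x t (rev p) = replicate (count_list p t) t" using calculation by (simp flip: rev_filter)
    ultimately have E: "?F x t (?w1 @ rev ?w1') = replicate (count_list p t) t @ x #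
        ?F x t (y # v @ rev (q1 @ y # q2)) @ x # replicate (count_list p t) t"
      by simp
    show False using i[unfolded il_def E] ends_eq_not_alt[OF xt] by blast
  qed
  \<comment> \<open>A letter of \<open>p\<close> occurs near both ends of the circle word and so
    cannot alternate with \<open>y\<close>. Hence a string interlacing \<open>y\<close> has one end
    in \<open>v\<close> or \<open>q2\<close> and the other in \<open>q1\<close>, and these are
    separated by the legs of the merged cup too.\<close>
  have key: "il (?w @ rev ?w') x t" if i: "il (?w1 @ rev ?w1') y t" for t
  proof -
    have yt: "y \<noteq> t" using i by (simp add: il_def)
    have xt: "x \<noteq> t" using nx[of y] il_comm i by metis
    let ?k = "count_list p t" and ?m = "count_list (v @ rev q2) t" and ?n = "count_list (rev q1) t"
    have F: "?F y t u = replicate (count_list u t) t" if "y \<notin> set u" for u by (rule filter_count[OF that])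
    have G: "?F x t u = replicate (count_list u t) t" if "x \<notin> set u" for u by (rule filter_count[OF that])
    have rp: "count_list (rev p) t = ?k" by simp
    have z1: "?w1 @ rev ?w1' = p @ x # y # (v @ rev q2) @ y # rev q1 @ x # rev p" by simp
    have E: "?F y t (?w1 @ rev ?w1') = replicate ?k t @ y # replicate ?m t @ y # replicate ?n t @ replicate ?k t"
      unfolding z1 using F[of p] F[of "v @ rev q2"] F[of "rev q1"] F[of "rev p"] y xt rp
      by (simp del: filter_append rev_filter add: filter_append)
    have L: "replicate ?k t @ y # replicate ?m t @ y # replicate ?n t @ replicate ?k t = [y, t, y, t] \<or>
       replicate ?k t @ y # replicate ?m t @ y # replicate ?n t @ replicate ?k t = [t, y, t, y]"
      using i[unfolded il_def E] by blast
    have "?k = 0 \<and> ?m = 1 \<and> ?n = 1"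
    proof (cases ?k)
      case 0
      have "replicate ?m t @ y # replicate ?n t = [t, y, t]" using L 0 yt by auto
      then have "?m = 1 \<and> ?n = 1" using yt
        by (cases ?m; cases "?m - 1"; cases ?n; cases "?n - 1") (auto simp: Cons_eq_append_conv)
      then show ?thesis using 0 by simp
    next
      case (Suc k)
      have "last (replicate ?k t @ y # replicate ?m t @ y # replicate ?n t @ replicate ?k t) = t"
        unfolding Suc by (simp add: last_append)
      moreover have "hd (replicate ?k t @ y # replicate ?m t @ y # replicate ?n t @ replicate ?k t) = t"
        unfolding Suc by simp
      ultimately show ?thesis using alt_hd_last[OF L yt] by simp
    qed
    then have c: "?k = 0" "?m = 1" "?n = 1" by blast+
    have z: "?w @ rev ?w' = p @ (v @ rev q2) @ x # rev q1 @ x # rev p" by simp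
    have "?F x t (?w @ rev ?w') = replicate ?k t @ replicate ?m t @ x # replicate ?n t @ x # replicate ?k t"
      unfolding z using G[of p] G[of "v @ rev q2"] G[of "rev q1"] G[of "rev p"] x rp
      by (simp del: rev_filter)
    then show ?thesis unfolding c using xt by (simp add: il_def)
  qed
  have il: "il (?w @ rev ?w') (f s) (f t) \<and> s \<noteq> x \<and> t \<noteq> x" if "EvX s t \<in> set es" for s t
  proof -
    note i = eil[OF that]
    have sx: "s \<noteq> x" "t \<noteq> x" using nx i il_comm by metis+
    consider "s = y" | "t = y" | "s \<noteq> y" "t \<noteq> y" by blast
    then have "il (?w @ rev ?w') (f s) (f t)"
    proof cases
      case 1
      then have "t \<noteq> y" using i by (auto simp: il_def)
      then show ?thesis using key[of t] i 1 by (simp add: f_def)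
    next
      case 2
      then have "s \<noteq> y" using i by (auto simp: il_def)
      then show ?thesis using key[of s] i 2 il_comm by (metis f_def)
    next
      case 3
      then have "?F s t (?w1 @ rev ?w1') = ?F s t (?w @ rev ?w')" using sx by simp
      then show ?thesis using i 3 unfolding il_def f_def by simp
    qed
    then show ?thesis using sx by blast
  qed
  \<comment> \<open>The bottom word of the upper part is distinct, so no cap lies above the new
    cup.\<close>
  have nocap: "EvCap t \<notin> set es" for t
  proof
    assume "EvCap t \<in> set es"
    then have "t \<in> set (List.map_filter caplab es)" by (intro map_filter_mem[of _ "EvCap t"]) simp_all
    moreover have "distinct ?w1" using d x y by auto
    then have "lefts ?w1 = []" by (simp only: lefts_Nil_iff)
    ultimately show False using e by (simp add: evinv_def)
  qed
  \<comment> \<open>No crossing above involves \<open>x\<close>. On the labels of crossings, merging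
    \<open>y\<close> into \<open>x\<close> is therefore injective and keeps different pairs
    different.\<close>
  have inj: "inj_on f (UNIV - {x})" by (auto simp: inj_on_def f_def)
  have "evinv ?w ?w' (EvCup x # map (emap f) es)"
    unfolding evinv_def
  proof (intro conjI)
    show "\<forall>s t. EvX s t \<in> set (EvCup x # map (emap f) es) \<longrightarrow> il (?w @ rev ?w') s t"
    proof (intro allI impI)
      fix s t assume "EvX s t \<in> set (EvCup x # map (emap f) es)"
      then obtain e0 where "e0 \<in> set es" "emap f e0 = EvX s t" by auto
      then obtain s0 t0 where "EvX s0 t0 \<in> set es" "s = f s0" "t = f t0" using emap_inv(1) by blast
      then show "il (?w @ rev ?w') s t" using il by blast
    qed
    have "sorted_wrt (\<lambda>a b. \<forall>x y p q. emap f a = EvX x y \<longrightarrow> emap f b = EvX p q \<longrightarrow> {x, y} \<noteq> {p, q}) es"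
    proof (rule sorted_wrt_mono_rel[where P = "\<lambda>e e'. \<forall>x y p q. e = EvX x y \<longrightarrow> e' = EvX p q \<longrightarrow> {x, y} \<noteq> {p, q}"])
      show "sorted_wrt (\<lambda>e e'. \<forall>x y p q. e = EvX x y \<longrightarrow> e' = EvX p q \<longrightarrow> {x, y} \<noteq> {p, q}) es"
        using e by (simp add: evinv_def)
      fix a b assume ab: "a \<in> set es" "b \<in> set es" 
        and P: "\<forall>x y p q. a = EvX x y \<longrightarrow> b = EvX p q \<longrightarrow> {x, y} \<noteq> {p, q}"
      show "\<forall>x y p q. emap f a = EvX x y \<longrightarrow> emap f b = EvX p q \<longrightarrow> {x, y} \<noteq> {p, q}"
      proof (intro allI impI)
        fix s t s' t' assume "emap f a = EvX s t" "emap f b = EvX s' t'"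
        then obtain s0 t0 s1 t1 where 0: "a = EvX s0 t0" "s = f s0" "t = f t0" "b = EvX s1 t1" "s' = f s1" "t' = f t1"
          using emap_inv(1) by metis
        have n: "{s0, t0} \<subseteq> UNIV - {x}" "{s1, t1} \<subseteq> UNIV - {x}" using il ab 0(1,4) by auto
        have "{s0, t0} \<noteq> {s1, t1}" using P 0(1,4) by blast
        then have "f ` {s0, t0} \<noteq> f ` {s1, t1}" using inj_on_image_eq_iff[OF inj n] by blast
        then show "{s, t} \<noteq> {s', t'}" using 0 by simp
      qed
    qed
    then show "sorted_wrt (\<lambda>e e'. \<forall>x y p q. e = EvX x y \<longrightarrow> e' = EvX p q \<longrightarrow> {x, y} \<noteq> {p, q}) (EvCup x # map (emap f) es)"
      by (simp add: sorted_wrt_map)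
    have "distinct ?w" "distinct ?w1" using d x y by auto
    then have "lefts ?w = []" "lefts ?w1 = []" by (simp_all only: lefts_Nil_iff)
    then show "List.map_filter caplab (EvCup x # map (emap f) es) = rev (lefts ?w)"
      using e by (simp add: List.map_filter_simps map_filter_emap evinv_def)
    have "map f (lefts ?w1') = lefts ?w1'" by (rule fid[OF ny])
    then show "List.map_filter cuplab (EvCup x # map (emap f) es) = lefts ?w'"
      using e l by (simp add: List.map_filter_simps map_filter_emap evinv_def)
    have nc: "e' \<noteq> EvCap t" if "e' \<in> set (map (emap f) es)" for e' t
      using that nocap emap_inv(2) by (metis (no_types, lifting) imageE list.set_map)
    then have "sorted_wrt (\<lambda>e e'. \<forall>x y. e = EvCup x \<longrightarrow> e' \<noteq> EvCap y) (map (emap f) es)"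
      by (intro sorted_wrt_iff_nth_less[THEN iffD2]) (metis nth_mem)
    then show "sorted_wrt (\<lambda>e e'. \<forall>x y. e = EvCup x \<longrightarrow> e' \<noteq> EvCap y) (EvCup x # map (emap f) es)"
      using nc by simp
  qed
  then show ?thesis using b' unfolding realizable_def by blast
qed

lemma takeWhile_index: "distinct l \<Longrightarrow> i < length l \<Longrightarrow> length (takeWhile (\<lambda>t. t \<noteq> l ! i) l) = i"
proof (induction l arbitrary: i)
  case (Cons a l)
  show ?case
  proof (cases i)
    case (Suc j)
    then have "l ! j \<noteq> a" using Cons.prems by (metis Suc_less_eq distinct.simps(2) length_Cons nth_mem)
    then show ?thesis using Suc Cons by simp
  qed simp
qed simp

text \<open>\<open>k\<close> is the position in \<open>v\<close>. As no neighbours in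
  \<open>w\<close> are inverted in \<open>v\<close>, it increases along \<open>w\<close>, so both
  words are the elements of one set in the order of \<open>k\<close>.\<close>

lemma order_eq:
  fixes w v :: "nat list"
  assumes d: "distinct w" "distinct v" "set v = set w"
    and no: "\<And>i p q s. Suc i < length w \<Longrightarrow> v \<noteq> p @ w ! Suc i # q @ w ! i # s"
  shows "v = w"
proof -
  define k where "k = (\<lambda>x. length (takeWhile (\<lambda>t. t \<noteq> x) v))"
  have kv: "k (v ! i) = i" if "i < length v" for i unfolding k_def by (rule takeWhile_index[OF d(2) that])
  have kl: "k x < length v \<and> v ! k x = x" if "x \<in> set v" for x
    using that kv by (metis in_set_conv_nth)
  have "map k v = [0..<length v]" by (rule nth_equalityI) (auto simp: kv)
  then have sv: "sorted (map k v)" "distinct (map k v)" by simp_all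
  have inj: "inj_on k (set v)" using sv(2) by (simp add: distinct_map)
  have "sorted (map k w)"
    unfolding sorted_iff_nth_Suc
  proof (intro allI impI)
    fix i assume "Suc i < length (map k w)"
    then have i: "Suc i < length w" by simp
    then have m: "w ! i \<in> set v" "w ! Suc i \<in> set v" using d(3) by auto
    have "\<not> k (w ! Suc i) < k (w ! i)"
    proof
      assume lt: "k (w ! Suc i) < k (w ! i)"
      have kk: "k (w ! i) < length v" "v ! k (w ! i) = w ! i" "v ! k (w ! Suc i) = w ! Suc i"
        using kl[OF m(1)] kl[OF m(2)] by auto
      obtain mm where "v = take (k (w ! Suc i)) v @ w ! Suc i # mm @ w ! i # drop (Suc (k (w ! i))) v"
        using nth_split2[OF lt kk(1), unfolded kk(2,3)] by blast
      then show False using no[OF i] by blast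
    qed
    then show "map k w ! i \<le> map k w ! Suc i" using i by simp
  qed
  moreover have "distinct (map k w)" using d inj by (simp add: distinct_map)
  moreover have "set (map k w) = set (map k v)" using d(3) by simp
  ultimately have "map k w = map k v" using sv sorted_distinct_set_unique by metis
  then show ?thesis using inj d(3) by (metis map_inj_on sup.idem)
qed

lemma filter_split: "filter P l = A @ x # B \<Longrightarrow> \<exists>l1 l2. l = l1 @ x # l2 \<and> filter P l1 = A \<and> filter P l2 = B"
proof (induction l arbitrary: A)
  case (Cons a l)
  show ?case
  proof (cases "P a")
    case False
    then obtain l1 l2 where "l = l1 @ x # l2" "filter P l1 = A" "filter P l2 = B" using Cons by auto
    then show ?thesis using False by (intro exI[of _ "a # l1"] exI[of _ l2]) simp
  next
    case True
    show ?thesis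
    proof (cases A)
      case Nil
      then show ?thesis using Cons.prems True by (intro exI[of _ "[]"] exI[of _ l]) simp
    next
      case (Cons c A')
      then have "filter P l = A' @ x # B" "c = a" using Cons.prems True by auto
      then obtain l1 l2 where "l = l1 @ x # l2" "filter P l1 = A'" "filter P l2 = B" using Cons.IH by blast
      then show ?thesis using True Cons \<open>c = a\<close> by (intro exI[of _ "a # l1"] exI[of _ l2]) simp
    qed
  qed
qed simp

lemma distinct_count: "distinct l \<longleftrightarrow> (\<forall>x. count_list l x \<le> 1)"
proof (induction l)
  case (Cons a l)
  show ?case
  proof
    assume "distinct (a # l)"
    then show "\<forall>x. count_list (a # l) x \<le> 1" using Cons by (auto simp: count_notin)
  next
    assume h: "\<forall>x. count_list (a # l) x \<le> 1"
    then have "count_list l a = 0" by (metis One_nat_def Suc_le_mono count_list.simps(2) le_zero_eq add.commute plus_1_eq_Suc)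
    moreover have "\<forall>x. count_list l x \<le> 1" using h by (metis count_list.simps(2) le_add1 le_trans)
    ultimately show "distinct (a # l)" using Cons by (simp add: count_list_0_iff)
  qed
qed simp

lemma dbl_mset: "mset z = mset z' \<Longrightarrow> dbl z' \<Longrightarrow> dbl z"
  unfolding dbl_def by (metis count_mset mset_eq_setD)

text \<open>The measure is lexicographic: the number of caps and cups still to be drawn, then the
  number of forced crossings. Closing a cap or opening a cup lowers the first, and a forced crossing
  keeps the first and lowers the second.\<close>

lemma realizable_step:
  assumes IH: "\<And>v v'. (length (lefts v) + length (lefts v') < length (lefts w) + length (lefts w') \<or>
      length (lefts v) + length (lefts v') = length (lefts w) + length (lefts w') \<and>
      card (ilset (v @ rev v')) < card (ilset (w @ rev w'))) \<Longrightarrow> dbl (v @ rev v') \<Longrightarrow> realizable v v'"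
    and dbl: "dbl (w @ rev w')"
  shows "realizable w w'"
proof (cases "lefts w = []")
  case False
  have ct: "count_list w t + count_list w' t \<le> 2" for t using dbl_le[OF dbl, of t] by simp
  obtain u x t where w: "w = u @ x # t" "x \<in> set t" "distinct t" using lefts_last[OF False] by blast
  obtain y v where t: "t = y # v" using w(2) by (cases t) auto
  have "count_list t x = 1" using w(2,3) by (metis distinct_count le_antisym count_list_0_iff less_one linorder_not_less)
  then have "count_list u x = 0" "count_list w' x = 0" using ct[of x] w(1) by simp_all
  then have xn: "x \<notin> set u" "x \<notin> set w'" by (simp_all add: count_list_0_iff)
  show ?thesis
  proof (cases "x = y")
    case True
    have xv: "x \<notin> set v" "distinct v" using w(3) t True by auto
    obtain p where p: "lefts (u @ x # x # v) = p @ lefts (x # x # v)" "lefts (u @ v) = p @ lefts v"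
      using lefts_append_cong[of u "x # x # v" v] xn(1) by auto
    have l: "lefts (u @ x # x # v) = lefts (u @ v) @ [x]"
      using p xv lefts_Nil_iff[of v] by simp
    have "dbl ((u @ v) @ rev w')"
      unfolding dbl_def
    proof
      fix s assume "s \<in> set ((u @ v) @ rev w')"
      then have "s \<in> set (w @ rev w')" "s \<noteq> x" using w(1) t xn xv by auto
      moreover have "count_list (w @ rev w') s = 2" using dbl calculation(1) unfolding dbl_def by blast
      ultimately show "count_list ((u @ v) @ rev w') s = 2" unfolding w(1) t True by simp
    qed
    then have "realizable (u @ v) w'" by (intro IH) (use l w(1) t True in auto)
    then show ?thesis unfolding w(1) t True[symmetric] by (rule realizable_cap) (use xn xv l in auto)
  next
    case False
    have yv: "y \<notin> set v" "distinct v" "x \<in> set v" using w(2,3) t False by auto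
    obtain p where p: "lefts (u @ x # y # v) = p @ lefts (x # y # v)" "lefts (u @ y # x # v) = p @ lefts (y # x # v)"
      using lefts_append_cong[of u "x # y # v" "y # x # v"] by auto
    have l: "lefts (u @ y # x # v) = lefts (u @ x # y # v)"
      using p yv False lefts_Nil_iff[of v] by simp
    let ?z = "(u @ x # y # v) @ rev w'"
    \<comment> \<open>\<open>y\<close> occurs once between the two ends of \<open>x\<close>, because
      \<open>t\<close> is distinct, and its other end lies in \<open>u\<close> or \<open>w'\<close>,
      outside of them. So the crossing is forced.\<close>
    have "count_list ?z y = 2" using dbl w(1) t unfolding dbl_def by simp
    then have cy: "count_list u y + count_list w' y = 1" using yv(1) False by (simp add: count_notin)
    have cv: "count_list v x = 1" using \<open>count_list t x = 1\<close> t False by simp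
    let ?F = "filter (\<lambda>a. a = x \<or> a = y)"
    have "?F u = replicate (count_list u y) y" by (rule filter_count[OF xn(1)])
    moreover have "?F (rev w') = replicate (count_list (rev w') y) y"
      by (rule filter_count) (use xn(2) in simp)
    moreover have "?F v = replicate (count_list v x) x" by (rule filter_count'[OF yv(1)])
    ultimately have "?F ?z = replicate (count_list u y) y @ [x, y, x] @ replicate (count_list w' y) y"
      using cv by simp
    moreover have "count_list u y = 0 \<and> count_list w' y = 1 \<or> count_list u y = 1 \<and> count_list w' y = 0"
      using cy by linarith
    ultimately have il: "il ?z x y" using False unfolding il_def by auto
    have "dbl ((u @ y # x # v) @ rev w')" by (rule dbl_mset[OF _ dbl]) (simp add: w(1) t)
    moreover have "card (ilset ((u @ y # x # v) @ rev w')) < card (ilset ?z)"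
      using ilset_swap[of u x y "v @ rev w'"] il by simp
    ultimately have "realizable (u @ y # x # v) w'" by (intro IH) (use l w(1) t in auto)
    then show ?thesis unfolding w(1) t by (rule realizable_swap[OF _ il l])
  qed
next
  case True
  then have dw: "distinct w" by (simp only: lefts_Nil_iff)
  have cw: "count_list w t = 1" if "t \<in> set w" for t
    using that dw by (metis distinct_count le_antisym count_list_0_iff less_one linorder_not_less)
  have cw': "count_list w' t = 1" if "t \<in> set w" for t
  proof -
    have "count_list (w @ rev w') t = 2" using dbl that unfolding dbl_def by simp
    then show ?thesis using cw[OF that] by simp
  qed
  show ?thesis
  proof (cases "\<exists>u x y r p q s. w = u @ x # y # r \<and> w' = p @ y # q @ x # s")
    case inv: True
    then obtain u x y r p q s where w: "w = u @ x # y # r" "w' = p @ y # q @ x # s" by blast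
    have n: "x \<noteq> y" "x \<notin> set u" "y \<notin> set u" "x \<notin> set r" "y \<notin> set r" using dw w by auto
    have "count_list w' x = 1" "count_list w' y = 1" using cw' w(1) by auto
    then have n': "x \<notin> set p" "x \<notin> set q" "x \<notin> set s" "y \<notin> set p" "y \<notin> set q" "y \<notin> set s"
      unfolding w(2) using n(1) by (auto simp: count_list_0_iff)
    have "filter (\<lambda>a. a = x \<or> a = y) c = []" if "x \<notin> set c" "y \<notin> set c" for c
      using that by (auto simp: filter_empty_conv)
    then have il: "il ((u @ x # y # r) @ rev w') x y"
      unfolding il_def w(2) using n n' by simp
    have l: "lefts (u @ y # x # r) = lefts (u @ x # y # r)"
    proof -
      have "distinct (u @ x # y # r)" "distinct (u @ y # x # r)" using dw w(1) by auto
      then show ?thesis by (simp only: lefts_Nil_iff[THEN iffD2])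
    qed
    have "dbl ((u @ y # x # r) @ rev w')" by (rule dbl_mset[OF _ dbl]) (simp add: w(1))
    moreover have "card (ilset ((u @ y # x # r) @ rev w')) < card (ilset ((u @ x # y # r) @ rev w'))"
      using ilset_swap[of u x y "r @ rev w'"] il by simp
    ultimately have "realizable (u @ y # x # r) w'" by (intro IH) (use l w(1) in auto)
    then show ?thesis unfolding w(1) by (rule realizable_swap[OF _ il l])
  next
    case noinv: False
    let ?v = "filter (\<lambda>t. t \<in> set w) w'"
    have cf: "count_list (filter P l) t \<le> count_list l t" for P and l :: "nat list" and t by (induction l) auto
    \<comment> \<open>With no adjacent inversion left, the through strings arrive at the top in the
      order of \<open>w\<close>.\<close>
    have v: "?v = w"
    proof (rule order_eq[OF dw])
      show "distinct ?v" unfolding distinct_count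
      proof
        fix t show "count_list ?v t \<le> 1"
        proof (cases "t \<in> set w")
          case True then show ?thesis using cw'[OF True] cf[of "\<lambda>t. t \<in> set w" w' t] by simp
        next
          case False then show ?thesis by (simp add: count_notin)
        qed
      qed
      have "t \<in> set w'" if "t \<in> set w" for t using cw'[OF that] by (metis count_notin zero_neq_one)
      then show "set ?v = set w" by auto
      fix i p q s assume i: "Suc i < length w"
      show "?v \<noteq> p @ w ! Suc i # q @ w ! i # s"
      proof
        assume e: "?v = p @ w ! Suc i # q @ w ! i # s"
        obtain l1 l2 where 1: "w' = l1 @ w ! Suc i # l2" "filter (\<lambda>t. t \<in> set w) l2 = q @ w ! i # s"
          using filter_split[OF e] by blast
        obtain l3 l4 where "l2 = l3 @ w ! i # l4" using filter_split[OF 1(2)] by blast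
        then have 2: "w' = l1 @ w ! Suc i # l3 @ w ! i # l4" using 1(1) by simp
        have "w = take i w @ w ! i # w ! Suc i # drop (Suc (Suc i)) w"
          using id_take_nth_drop[of i w] Cons_nth_drop_Suc[of "Suc i" w] i by simp
        with 2 show False using noinv by blast
      qed
    qed
    show ?thesis
    proof (cases "set w' \<subseteq> set w")
      case True
      then have "?v = w'" by (intro filter_True) blast
      then have e: "w' = w" using v by simp
      have "evinv w w [EvN]" using True \<open>lefts w = []\<close>
        by (simp add: evinv_def List.map_filter_simps)
      then show ?thesis using realizes_id[OF dw] unfolding realizable_def e by blast
    next
      case False
      then have "\<exists>t\<in>set w'. t \<notin> set w" by blast
      \<comment> \<open>The first top letter that is not a through string is the left leg of the
        leftmost cup. Everything before it is through strings, and this yields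
        \<open>w = p @ v\<close>.\<close>
      then obtain p x zs where px: "w' = p @ x # zs" "x \<notin> set w" "\<forall>t\<in>set p. t \<in> set w"
        using split_list_first_prop[of w' "\<lambda>t. t \<notin> set w"] by blast
      have "count_list (w @ rev w') x = 2" using dbl px(1) unfolding dbl_def by simp
      then have cx: "count_list w' x = 2" using px(2) by (simp add: count_notin)
      have xp: "x \<notin> set p" using px(2,3) by blast
      then have "count_list zs x = 1" using cx px(1) by (simp add: count_notin)
      then have "x \<in> set zs" by (metis count_notin zero_neq_one)
      then obtain q1 q2 where zs: "zs = q1 @ x # q2" using split_list by metis
      have xq: "x \<notin> set q1" "x \<notin> set q2" using \<open>count_list zs x = 1\<close> zs by (auto simp: count_list_0_iff)
      define v where "v = filter (\<lambda>t. t \<in> set w) zs"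
      have wv: "w = p @ v"
      proof -
        have "filter (\<lambda>t. t \<in> set w) p = p" using px(3) by (intro filter_True) blast
        then show ?thesis using v px(1,2) v_def by simp
      qed
      have w': "w' = p @ x # q1 @ x # q2" using px(1) zs by simp
      \<comment> \<open>Cutting the cup at its lowest point produces two through strings of the part
        above; the right one needs a fresh label.\<close>
      obtain y where y: "y \<notin> set w \<union> set w'" using ex_new_if_finite[of "set w \<union> set w'"] infinite_UNIV_nat by auto
      have yn: "y \<notin> set p" "y \<notin> set v" "y \<notin> set q1" "y \<notin> set q2" "y \<noteq> x" using y wv w' by auto
      have dpv: "distinct p" "distinct v" "set p \<inter> set v = {}" using dw wv by auto
      have pq: "set p \<inter> set q1 = {}" "set p \<inter> set q2 = {}"
      proof -
        have "t \<notin> set q1 \<and> t \<notin> set q2" if "t \<in> set p" for t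
        proof -
          have "count_list w' t = 1" using cw' px(3) that by blast
          moreover have "count_list p t \<noteq> 0" using that by (simp add: count_list_0_iff)
          ultimately have "count_list q1 t = 0 \<and> count_list q2 t = 0" unfolding w' by (auto split: if_splits)
          then show ?thesis by (simp add: count_list_0_iff)
        qed
        then show "set p \<inter> set q1 = {}" "set p \<inter> set q2 = {}" by blast+
      qed
      let ?w1 = "p @ x # y # v" and ?w1' = "p @ x # q1 @ y # q2"
      obtain pr where pr: "lefts (q1 @ x # q2) = pr @ lefts (x # q2)" "lefts (q1 @ y # q2) = pr @ lefts (y # q2)"
        using lefts_append_cong[of q1 "x # q2" "y # q2"] xq yn by auto
      have l1: "lefts ?w1' = lefts (q1 @ y # q2)"
        using lefts_skip[of p "x # q1 @ y # q2"] dpv pq xp yn xq by auto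
      have l2: "lefts w' = x # lefts (q1 @ x # q2)"
        unfolding w' using lefts_skip[of p "x # q1 @ x # q2"] dpv pq xp by auto
      have l: "lefts (p @ x # q1 @ x # q2) = x # lefts ?w1'"
        using l1 l2 pr xq yn w' by simp
      have ny: "y \<notin> set (lefts ?w1')"
      proof
        assume "y \<in> set (lefts ?w1')"
        from lefts_count[OF this] yn show False by (simp add: count_notin)
      qed
      have "dbl (?w1 @ rev ?w1')"
        unfolding dbl_def
      proof
        fix t assume t: "t \<in> set (?w1 @ rev ?w1')"
        show "count_list (?w1 @ rev ?w1') t = 2"
        proof (cases "t = x \<or> t = y")
          case True
          then show ?thesis using yn xp xq px(2) wv by (auto simp: count_notin)
        next
          case False
          then have "t \<in> set (w @ rev w')" using t wv w' by auto
          then have "count_list (w @ rev w') t = 2" using dbl unfolding dbl_def by blast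
          then show ?thesis using False wv w' by simp
        qed
      qed
      moreover have "lefts ?w1 = []"
      proof -
        have "distinct ?w1" using dpv yn xp px(2) wv by auto
        then show ?thesis by (simp only: lefts_Nil_iff)
      qed
      ultimately have "realizable ?w1 ?w1'" by (intro IH) (use l w' in auto)
      then have "realizable (p @ v) (p @ x # q1 @ x # q2)"
        by (rule realizable_cup) (use dpv xp xq px(2) wv yn pq l ny in auto)
      then show ?thesis using wv w' by simp
    qed
  qed
qed

lemma realizable_all: "dbl (w @ rev w') \<Longrightarrow> realizable w w'"
proof -
  define f1 f2 :: "nat list \<times> nat list \<Rightarrow> nat"
    where "f1 = (\<lambda>p. length (lefts (fst p)) + length (lefts (snd p)))" and "f2 = (\<lambda>p. card (ilset (fst p @ rev (snd p))))"
  have "dbl (fst p @ rev (snd p)) \<longrightarrow> realizable (fst p) (snd p)" for p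
  proof (induction p rule: wf_induct_rule[OF wf_measures[of "[f1, f2]"]])
    case (1 p)
    show ?case
    proof
      assume d: "dbl (fst p @ rev (snd p))"
      show "realizable (fst p) (snd p)"
      proof (rule realizable_step[OF _ d])
        fix v v' assume "length (lefts v) + length (lefts v') < length (lefts (fst p)) + length (lefts (snd p)) \<or>
            length (lefts v) + length (lefts v') = length (lefts (fst p)) + length (lefts (snd p)) \<and>
            card (ilset (v @ rev v')) < card (ilset (fst p @ rev (snd p)))" "dbl (v @ rev v')"
        then show "realizable v v'" using 1[of "(v, v')"] by (auto simp: f1_def f2_def)
      qed
    qed
  qed
  from this[of "(w, w')"] show "dbl (w @ rev w') \<Longrightarrow> realizable w w'" by simp
qed

section \<open>Normality of the constructed diagrams\<close>

lemma occs_iff: "(x, i, ob, ot) \<in> occs D \<longleftrightarrow> i < length D \<and> (x, ob, ot) \<in> layer_occs 0 0 (D ! i)"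
  by (auto simp: occs_def)

lemma realizes_path: "realizes w w' D W es \<Longrightarrow> path (\<lambda>x. x) D W"
  unfolding realizes_def path_def using levent_lrel by blast

lemma realizes_conn:
  assumes b: "realizes w w' D W es" and v: "vertex W u" "vertex W v"
  shows "conn D u v \<longleftrightarrow> lab W u = lab W v"
proof
  assume c: "conn D u v"
  have "lab W u = lab W x \<longleftrightarrow> lab W u = lab W y" if "(x, y) \<in> edges D" for x y
    using edges_lab[OF that, of "\<lambda>x. x"] realizes_path[OF b] by auto
  from conn_induct[OF c, of "\<lambda>x. lab W u = lab W x", OF refl this] show "lab W u = lab W v" .
next
  assume "lab W u = lab W v"
  then show "conn D u v" using b v unfolding realizes_def linked_def by blast
qed

lemma map_filter_order:
  assumes g: "\<And>e x. g e = Some x \<longleftrightarrow> e = h x" and s: "List.map_filter g es = A @ x # B @ y # C"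
  shows "\<exists>i j. i < j \<and> j < length es \<and> es ! i = h x \<and> es ! j = h y"
proof -
  obtain E1 e E2 where 1: "es = E1 @ e # E2" "g e = Some x" "List.map_filter g E2 = B @ y # C"
    using map_filter_split[OF s] by blast
  obtain E3 e' E4 where 2: "E2 = E3 @ e' # E4" "g e' = Some y" using map_filter_split[OF 1(3)] by blast
  have "es = E1 @ h x # E3 @ h y # E4" using 1 2 g by simp
  then show ?thesis
    by (intro exI[of _ "length E1"] exI[of _ "Suc (length E1 + length E3)"]) (simp add: nth_append)
qed

text \<open>By \<open>realizes_conn\<close> every condition on strings becomes a condition on
  labels, which can be checked on the list of events.\<close>

lemma realizes_normal:
  assumes b: "realizes w w' D W es" and e: "evinv w w' es" and d: "dbl (w @ rev w')"
    and len: "length w = a" "length w' = b"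
  shows "is_diagram a b D" "no_loops a b D" "normal a b D"
    "connector a b D = {{x, y} | x y. x \<in> pts a b \<and> y \<in> pts a b \<and> x \<noteq> y \<and> lab W (vtx D x) = lab W (vtx D y)}"
proof -
  have W: "D \<noteq> []" "length W = Suc (length D)" "length es = length D" "W ! 0 = w" "W ! length D = w'"
    and lev: "\<And>i. i < length D \<Longrightarrow> levent (D ! i) (W ! i) (W ! Suc i) (es ! i)"
    using b by (auto simp: realizes_def)
  note P = realizes_path[OF b]
  note cn = realizes_conn[OF b]
  have vx: "vertex W (vtx D x)" if "x \<in> pts a b" for x
    using that W len by (auto simp: pts_def vertex_def)
  have ln: "length (W ! i) = lsrc (D ! i) \<and> length (W ! Suc i) = ltgt (D ! i)" if "i < length D" for i
    using P that lrel_length unfolding path_def by blast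
  show "is_diagram a b D"
    unfolding is_diagram_def
  proof (intro conjI allI impI)
    show "lsrc (hd D) = a" using ln[of 0] W len by (simp add: hd_conv_nth)
    show "ltgt (last D) = b" using ln[of "length D - 1"] W len by (simp add: last_conv_nth)
    fix i assume "Suc i < length D"
    then show "ltgt (D ! i) = lsrc (D ! Suc i)" using ln[of i] ln[of "Suc i"] by simp
  qed (use W in simp)
  have bnd: "\<exists>x\<in>pts a b. conn D u (vtx D x)" if u: "vertex W u" for u
  proof -
    have "lab W u \<in> set w \<or> lab W u \<in> set w'" using realizes_lab[OF b u] by blast
    then have "\<exists>x\<in>pts a b. lab W (vtx D x) = lab W u"
    proof
      assume "lab W u \<in> set w"
      then obtain p where "p < length w" "w ! p = lab W u" by (auto simp: in_set_conv_nth)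
      then show ?thesis using W len by (intro bexI[of _ "Bot p"]) (auto simp: lab_def pts_def)
    next
      assume "lab W u \<in> set w'"
      then obtain p where "p < length w'" "w' ! p = lab W u" by (auto simp: in_set_conv_nth)
      then show ?thesis using W len by (intro bexI[of _ "Top p"]) (auto simp: lab_def pts_def)
    qed
    then show ?thesis using cn[OF u vx] by metis
  qed
  show "no_loops a b D" unfolding no_loops_def
  proof (intro ballI, clarify)
    fix i p j q assume "((i, p), (j, q)) \<in> edges D"
    then show "\<exists>x\<in>pts a b. conn D (i, p) (vtx D x)" using bnd edges_vertex(1) P by blast
  qed
  have cv: "conn D (vtx D x) (vtx D y) \<longleftrightarrow> lab W (vtx D x) = lab W (vtx D y)"
    if "x \<in> pts a b" "y \<in> pts a b" for x y
    by (rule cn[OF vx[OF that(1)] vx[OF that(2)]])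
  show "connector a b D = {{x, y} | x y. x \<in> pts a b \<and> y \<in> pts a b \<and> x \<noteq> y \<and> lab W (vtx D x) = lab W (vtx D y)}"
    unfolding connector_def using cv by blast
  have cr: "vertex W (i, ob) \<and> vertex W (i, Suc ob) \<and> i < length es \<and> es ! i = EvX (lab W (i, ob)) (lab W (i, Suc ob)) \<and>
     lab W (i, ob) \<noteq> lab W (i, Suc ob)"
    if c: "(i, ob) \<in> crossings D" for i ob
  proof -
    obtain ot where o: "i < length D" "(Sx, ob, ot) \<in> layer_occs 0 0 (D ! i)"
      using c unfolding crossings_def occs_iff by blast
    obtain k where k: "\<And>ob ot. (Sx, ob, ot) \<in> layer_occs 0 0 (D ! i) \<Longrightarrow>
       ob = k \<and> ot = k \<and> Suc k < length (W ! i) \<and> es ! i = EvX (W ! i ! k) (W ! i ! Suc k)"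
      using levent_Sx[OF lev[OF o(1)]] by blast
    have 1: "Suc ob < length (W ! i)" "es ! i = EvX (W ! i ! ob) (W ! i ! Suc ob)" using k[OF o(2)] by auto
    have "EvX (W ! i ! ob) (W ! i ! Suc ob) \<in> set es" using 1(2) o(1) W(3) by (metis nth_mem)
    then have "il (w @ rev w') (W ! i ! ob) (W ! i ! Suc ob)" using e by (simp add: evinv_def)
    then have "W ! i ! ob \<noteq> W ! i ! Suc ob" by (simp add: il_def)
    then show ?thesis using 1 o(1) W by (simp add: vertex_def lab_def)
  qed
  have cr_same: "ob = oc" if c: "(i, ob) \<in> crossings D" "(i, oc) \<in> crossings D" for i ob oc
  proof -
    obtain ot ot' where o: "i < length D" "(Sx, ob, ot) \<in> layer_occs 0 0 (D ! i)" "(Sx, oc, ot') \<in> layer_occs 0 0 (D ! i)"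
      using c unfolding crossings_def occs_iff by blast
    then show ?thesis using levent_Sx[OF lev[OF o(1)]] by blast
  qed
  have pair: "{lab W (i, ob), lab W (i, Suc ob)} \<noteq> {lab W (j, oc), lab W (j, Suc oc)}"
    if "(i, ob) \<in> crossings D" "(j, oc) \<in> crossings D" "(i, ob) \<noteq> (j, oc)" for i ob j oc
  proof -
    have ij: "i \<noteq> j" using that cr_same by blast
    have s: "sorted_wrt (\<lambda>e e'. \<forall>x y p q. e = EvX x y \<longrightarrow> e' = EvX p q \<longrightarrow> {x, y} \<noteq> {p, q}) es"
      using e by (simp add: evinv_def)
    have "i < j \<or> j < i" using ij by linarith
    then show ?thesis
    proof
      assume "i < j"
      from sorted_wrt_nth_less[OF s this] cr[OF that(1)] cr[OF that(2)] show ?thesis by blast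
    next
      assume "j < i"
      from sorted_wrt_nth_less[OF s this] cr[OF that(1)] cr[OF that(2)] show ?thesis by blast
    qed
  qed
  have dl: "distinct (lefts w)" "distinct (lefts w')"
  proof -
    have "count_list w t \<le> 2 \<and> count_list w' t \<le> 2" for t using dbl_le[OF d, of t] by simp
    then show "distinct (lefts w)" "distinct (lefts w')" using distinct_lefts by blast+
  qed
  have cap: "\<exists>q>p. q < length w \<and> w ! p = w ! q" if c: "p \<in> cap_lefts a D" for p
  proof -
    obtain q where q: "p < q" "q < a" "conn D (0, p) (0, q)" using c unfolding cap_lefts_def by blast
    then have "lab W (0, p) = lab W (0, q)" using cn[of "(0, p)" "(0, q)"] W len by (simp add: vertex_def)
    then show ?thesis using q W len by (auto simp: lab_def)
  qed
  have cup: "\<exists>q>p. q < length w' \<and> w' ! p = w' ! q" if c: "p \<in> cup_lefts b D" for p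
  proof -
    obtain q where q: "p < q" "q < b" "conn D (length D, p) (length D, q)" using c unfolding cup_lefts_def by blast
    then have "lab W (length D, p) = lab W (length D, q)" using cn[of "(length D, p)" "(length D, q)"] W len by (simp add: vertex_def)
    then show ?thesis using q W len by (auto simp: lab_def)
  qed
  have ml: "List.map_filter caplab es = rev (lefts w)" "List.map_filter cuplab es = lefts w'"
    using e by (simp_all add: evinv_def)
  \<comment> \<open>The set whose maximum is the cap height becomes a set of event positions. It
    will be a singleton because the cap labels in \<open>es\<close> are distinct.\<close>
  have capset: "{i. \<exists>ob ot. (Cap, i, ob, ot) \<in> occs D \<and> conn D (i, ob) (0, p)} = {i. i < length es \<and> es ! i = EvCap (w ! p)}"
    if p: "p < length w" for p
  proof (intro equalityI subsetI)
    have v0: "vertex W (0, p)" "lab W (0, p) = w ! p" using p W by (auto simp: vertex_def lab_def)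
    fix i
    {
      assume "i \<in> {i. \<exists>ob ot. (Cap, i, ob, ot) \<in> occs D \<and> conn D (i, ob) (0, p)}"
      then obtain ob ot where o: "i < length D" "(Cap, ob, ot) \<in> layer_occs 0 0 (D ! i)" "conn D (i, ob) (0, p)"
        unfolding occs_iff by blast
      have 1: "ob < length (W ! i)" "es ! i = EvCap (W ! i ! ob)" using levent_Cap[OF lev[OF o(1)] o(2)] by auto
      then have "vertex W (i, ob)" using o(1) W by (simp add: vertex_def)
      then have "W ! i ! ob = w ! p" using cn[OF _ v0(1)] o(3) v0(2) by (simp add: lab_def)
      then show "i \<in> {i. i < length es \<and> es ! i = EvCap (w ! p)}" using 1 o(1) W by simp
    next
      assume "i \<in> {i. i < length es \<and> es ! i = EvCap (w ! p)}"
      then have i: "i < length D" "es ! i = EvCap (w ! p)" using W by auto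
      have "levent (D ! i) (W ! i) (W ! Suc i) (EvCap (w ! p))" using lev[OF i(1)] i(2) by simp
      then obtain ob ot where o: "(Cap, ob, ot) \<in> layer_occs 0 0 (D ! i)" using levent_Cap' by blast
      have 1: "ob < length (W ! i)" "es ! i = EvCap (W ! i ! ob)" using levent_Cap[OF lev[OF i(1)] o] by auto
      then have "vertex W (i, ob)" "lab W (i, ob) = w ! p" using i W by (simp_all add: vertex_def lab_def)
      then have "conn D (i, ob) (0, p)" using cn[OF _ v0(1)] v0(2) by simp
      then show "i \<in> {i. \<exists>ob ot. (Cap, i, ob, ot) \<in> occs D \<and> conn D (i, ob) (0, p)}"
        using o i(1) unfolding occs_iff by blast
    }
  qed
  have cupset: "{i. \<exists>ob ot. (Cup, i, ob, ot) \<in> occs D \<and> conn D (Suc i, ot) (length D, p)} = {i. i < length es \<and> es ! i = EvCup (w' ! p)}"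
    if p: "p < length w'" for p
  proof (intro equalityI subsetI)
    have v0: "vertex W (length D, p)" "lab W (length D, p) = w' ! p" using p W by (auto simp: vertex_def lab_def)
    fix i
    {
      assume "i \<in> {i. \<exists>ob ot. (Cup, i, ob, ot) \<in> occs D \<and> conn D (Suc i, ot) (length D, p)}"
      then obtain ob ot where o: "i < length D" "(Cup, ob, ot) \<in> layer_occs 0 0 (D ! i)" "conn D (Suc i, ot) (length D, p)"
        unfolding occs_iff by blast
      have 1: "ot < length (W ! Suc i)" "es ! i = EvCup (W ! Suc i ! ot)" using levent_Cup[OF lev[OF o(1)] o(2)] by auto
      then have "vertex W (Suc i, ot)" using o(1) W by (simp add: vertex_def)
      then have "W ! Suc i ! ot = w' ! p" using cn[OF _ v0(1)] o(3) v0(2) by (simp add: lab_def)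
      then show "i \<in> {i. i < length es \<and> es ! i = EvCup (w' ! p)}" using 1 o(1) W by simp
    next
      assume "i \<in> {i. i < length es \<and> es ! i = EvCup (w' ! p)}"
      then have i: "i < length D" "es ! i = EvCup (w' ! p)" using W by auto
      have "levent (D ! i) (W ! i) (W ! Suc i) (EvCup (w' ! p))" using lev[OF i(1)] i(2) by simp
      then obtain ob ot where o: "(Cup, ob, ot) \<in> layer_occs 0 0 (D ! i)" using levent_Cup' by blast
      have 1: "ot < length (W ! Suc i)" "es ! i = EvCup (W ! Suc i ! ot)" using levent_Cup[OF lev[OF i(1)] o] by auto
      then have "vertex W (Suc i, ot)" "lab W (Suc i, ot) = w' ! p" using i W by (simp_all add: vertex_def lab_def)
      then have "conn D (Suc i, ot) (length D, p)" using cn[OF _ v0(1)] v0(2) by simp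
      then show "i \<in> {i. \<exists>ob ot. (Cup, i, ob, ot) \<in> occs D \<and> conn D (Suc i, ot) (length D, p)}"
        using o i(1) unfolding occs_iff by blast
    }
  qed
  have caph: "cap_height D p < length es \<and> es ! cap_height D p = EvCap (w ! p) \<and>
      (\<forall>i<length es. es ! i = EvCap (w ! p) \<longrightarrow> i = cap_height D p)" if c: "p \<in> cap_lefts a D" for p
  proof -
    obtain q where q: "p < q" "q < length w" "w ! p = w ! q" using cap[OF c] by blast
    have "w ! p \<in> set (rev (lefts w))" using lefts_mem[OF q] by simp
    then obtain A B where "List.map_filter caplab es = A @ w ! p # B" unfolding ml(1) using split_list by fast
    moreover have "distinct (List.map_filter caplab es)" unfolding ml(1) using dl(1) by simp
    ultimately obtain i where i: "{i. i < length es \<and> es ! i = EvCap (w ! p)} = {i}"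
      using map_filter_pos[of caplab EvCap es A "w ! p" B] by auto
    have pl: "p < length w" using q by simp
    have "cap_height D p = i" unfolding cap_height_def capset[OF pl] i by simp
    then show ?thesis using i by blast
  qed
  have cuph: "cup_height D p < length es \<and> es ! cup_height D p = EvCup (w' ! p) \<and>
      (\<forall>i<length es. es ! i = EvCup (w' ! p) \<longrightarrow> i = cup_height D p)" if c: "p \<in> cup_lefts b D" for p
  proof -
    obtain q where q: "p < q" "q < length w'" "w' ! p = w' ! q" using cup[OF c] by blast
    obtain A B where "List.map_filter cuplab es = A @ w' ! p # B" unfolding ml(2) using split_list lefts_mem[OF q] by fast
    moreover have "distinct (List.map_filter cuplab es)" unfolding ml(2) using dl(2) by simp
    ultimately obtain i where i: "{i. i < length es \<and> es ! i = EvCup (w' ! p)} = {i}"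
      using map_filter_pos[of cuplab EvCup es A "w' ! p" B] by auto
    have pl: "p < length w'" using q by simp
    have "cup_height D p = i" unfolding cup_height_def cupset[OF pl] i by simp
    then show ?thesis using i by blast
  qed
  have cap_ord: "cap_height D p' < cap_height D p"
    if c: "p \<in> cap_lefts a D" "p' \<in> cap_lefts a D" "p < p'" for p p'
  proof -
    obtain q where q: "p < q" "q < length w" "w ! p = w ! q" using cap[OF c(1)] by blast
    obtain q' where q': "p' < q'" "q' < length w" "w ! p' = w ! q'" using cap[OF c(2)] by blast
    obtain A B C where "lefts w = A @ w ! p # B @ w ! p' # C" using lefts_order[OF q q' c(3)] by blast
    then have "List.map_filter caplab es = rev C @ w ! p' # rev B @ w ! p # rev A" unfolding ml(1) by simp
    from map_filter_order[OF caplab_iff this] obtain i j where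
      "i < j" "j < length es" "es ! i = EvCap (w ! p')" "es ! j = EvCap (w ! p)" by blast
    then have "i = cap_height D p'" "j = cap_height D p" using caph[OF c(1)] caph[OF c(2)] by auto
    then show ?thesis using \<open>i < j\<close> by simp
  qed
  have cup_ord: "cup_height D p < cup_height D p'"
    if c: "p \<in> cup_lefts b D" "p' \<in> cup_lefts b D" "p < p'" for p p'
  proof -
    obtain q where q: "p < q" "q < length w'" "w' ! p = w' ! q" using cup[OF c(1)] by blast
    obtain q' where q': "p' < q'" "q' < length w'" "w' ! p' = w' ! q'" using cup[OF c(2)] by blast
    obtain A B C where "lefts w' = A @ w' ! p # B @ w' ! p' # C" using lefts_order[OF q q' c(3)] by blast
    then have "List.map_filter cuplab es = A @ w' ! p # B @ w' ! p' # C" unfolding ml(2) by simp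
    from map_filter_order[OF cuplab_iff this] obtain i j where
      "i < j" "j < length es" "es ! i = EvCup (w' ! p)" "es ! j = EvCup (w' ! p')" by blast
    then have "i = cup_height D p" "j = cup_height D p'" using cuph[OF c(1)] cuph[OF c(2)] by auto
    then show ?thesis using \<open>i < j\<close> by simp
  qed
  have cap_cup: "cap_height D p < cup_height D q" if c: "q \<in> cup_lefts b D" "p \<in> cap_lefts a D" for p q
  proof -
    have s: "sorted_wrt (\<lambda>e e'. \<forall>x y. e = EvCup x \<longrightarrow> e' \<noteq> EvCap y) es" using e by (simp add: evinv_def)
    have "\<not> cup_height D q < cap_height D p"
      using sorted_wrt_nth_less[OF s, of "cup_height D q" "cap_height D p"] caph[OF c(2)] cuph[OF c(1)] by blast
    moreover have "cup_height D q \<noteq> cap_height D p"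
      using caph[OF c(2)] cuph[OF c(1)] by (metis event.distinct(11))
    ultimately show ?thesis by linarith
  qed
  show "normal a b D"
    unfolding normal_def
  proof (intro conjI ballI impI)
    fix x assume x: "x \<in> crossings D"
    obtain i ob where xi: "x = (i, ob)" by (cases x)
    show "case x of (i, ob) \<Rightarrow> \<not> conn D (i, ob) (i, Suc ob)"
      unfolding xi prod.case using cr[OF x[unfolded xi]] cn[of "(i, ob)" "(i, Suc ob)"] by blast
  next
    fix x assume x: "x \<in> crossings D"
    obtain i ob where xi: "x = (i, ob)" by (cases x)
    note ci = cr[OF x[unfolded xi]]
    show "case x of (i, ob) \<Rightarrow> \<forall>(j, oc)\<in>crossings D. (i, ob) \<noteq> (j, oc) \<longrightarrow>
        \<not> ((conn D (i, ob) (j, oc) \<and> conn D (i, Suc ob) (j, Suc oc)) \<or>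
           (conn D (i, ob) (j, Suc oc) \<and> conn D (i, Suc ob) (j, oc)))"
      unfolding xi prod.case
    proof (intro ballI)
      fix y assume y: "y \<in> crossings D"
      obtain j oc where yj: "y = (j, oc)" by (cases y)
      note cj = cr[OF y[unfolded yj]]
      show "case y of (j, oc) \<Rightarrow> (i, ob) \<noteq> (j, oc) \<longrightarrow>
        \<not> ((conn D (i, ob) (j, oc) \<and> conn D (i, Suc ob) (j, Suc oc)) \<or>
           (conn D (i, ob) (j, Suc oc) \<and> conn D (i, Suc ob) (j, oc)))"
        unfolding yj prod.case
      proof (rule impI)
        assume "(i, ob) \<noteq> (j, oc)"
        from pair[OF x[unfolded xi] y[unfolded yj] this]
        show "\<not> ((conn D (i, ob) (j, oc) \<and> conn D (i, Suc ob) (j, Suc oc)) \<or>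
           (conn D (i, ob) (j, Suc oc) \<and> conn D (i, Suc ob) (j, oc)))"
          using cn[of "(i, ob)" "(j, oc)"] cn[of "(i, Suc ob)" "(j, Suc oc)"] cn[of "(i, ob)" "(j, Suc oc)"]
            cn[of "(i, Suc ob)" "(j, oc)"] ci cj by auto
      qed
    qed
  next
    fix q q' assume q: "q \<in> cup_lefts b D" "q' \<in> cup_lefts b D" "q \<noteq> q'"
    then have "q < q' \<or> q' < q" by linarith
    then show "cup_height D q \<noteq> cup_height D q'" using cup_ord q by fastforce
  next
    fix q q' assume q: "q \<in> cap_lefts a D" "q' \<in> cap_lefts a D" "q \<noteq> q'"
    then have "q < q' \<or> q' < q" by linarith
    then show "cap_height D q \<noteq> cap_height D q'" using cap_ord q by fastforce
  next
    fix q p assume "q \<in> cup_lefts b D" "p \<in> cap_lefts a D"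
    from cap_cup[OF this] show "cup_height D q \<noteq> cap_height D p" by simp
  qed (use cap_cup cap_ord cup_ord in blast)+
qed

section \<open>From matchings to boundary words\<close>

lemma Conn_labels:
  assumes c: "c \<in> Conn a b"
  obtains g :: "pt \<Rightarrow> nat" where
    "\<And>x y. x \<in> pts a b \<Longrightarrow> y \<in> pts a b \<Longrightarrow> x \<noteq> y \<Longrightarrow> g x = g y \<longleftrightarrow> {x, y} \<in> c"
    "\<And>x. x \<in> pts a b \<Longrightarrow> card {y \<in> pts a b. g y = g x} = 2"
proof -
  have c1: "\<And>e. e \<in> c \<Longrightarrow> e \<subseteq> pts a b \<and> card e = 2" and c2: "\<And>x. x \<in> pts a b \<Longrightarrow> \<exists>!e. e \<in> c \<and> x \<in> e"
    using c unfolding Conn_def by simp_all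
  have "c \<subseteq> Pow (pts a b)" using c1 by blast
  then have "finite c" using card_pts(1)[of a b] by (simp add: finite_subset)
  \<comment> \<open>The pairs of \<open>c\<close> are numbered, and each point will be labelled by
    the number of its pair.\<close>
  then obtain h :: "pt set \<Rightarrow> nat" where h: "inj_on h c" using finite_imp_inj_to_nat_seg by blast
  define cl where "cl = (\<lambda>x. THE e. e \<in> c \<and> x \<in> e)"
  have cl: "cl x \<in> c \<and> x \<in> cl x" if "x \<in> pts a b" for x unfolding cl_def by (rule theI'[OF c2[OF that]])
  have cu: "e = cl x" if "x \<in> pts a b" "e \<in> c" "x \<in> e" for x e using c2[OF that(1)] cl[OF that(1)] that by blast
  have eq: "h (cl y) = h (cl x) \<longleftrightarrow> y \<in> cl x" if "x \<in> pts a b" "y \<in> pts a b" for x y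
  proof
    assume "h (cl y) = h (cl x)"
    then have "cl y = cl x" using inj_onD[OF h] cl that by blast
    then show "y \<in> cl x" using cl[OF that(2)] by simp
  next
    assume "y \<in> cl x"
    then have "cl x = cl y" using cu[OF that(2)] cl[OF that(1)] by blast
    then show "h (cl y) = h (cl x)" by simp
  qed
  show ?thesis
  proof (rule that[of "\<lambda>x. h (cl x)"])
    fix x y assume xy: "x \<in> pts a b" "y \<in> pts a b" "x \<noteq> y"
    show "h (cl x) = h (cl y) \<longleftrightarrow> {x, y} \<in> c"
    proof
      assume "h (cl x) = h (cl y)"
      then have "x \<in> cl y" using eq[OF xy(2,1)] by simp
      then have "{x, y} \<subseteq> cl y" "card (cl y) = 2" using cl[OF xy(2)] c1 by auto
      moreover have "card {x, y} = 2" using xy(3) by simp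
      moreover have "finite (cl y)" using calculation(2) by (intro card_ge_0_finite) simp
      ultimately have "{x, y} = cl y" using card_subset_eq by metis
      then show "{x, y} \<in> c" using cl[OF xy(2)] by simp
    next
      assume "{x, y} \<in> c"
      then have "{x, y} = cl x" "{x, y} = cl y" using cu[OF xy(1)] cu[OF xy(2)] by blast+
      then show "h (cl x) = h (cl y)" by simp
    qed
  next
    fix x assume x: "x \<in> pts a b"
    have "{y \<in> pts a b. h (cl y) = h (cl x)} = cl x" using eq[OF x] c1 cl[OF x] by blast
    then show "card {y \<in> pts a b. h (cl y) = h (cl x)} = 2" using c1 cl[OF x] by simp
  qed
qed

lemma normal_diagram_exists:
  assumes c: "c \<in> Conn a b"
  shows "\<exists>D. is_diagram a b D \<and> no_loops a b D \<and> normal a b D \<and> connector a b D = c"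
proof -
  obtain g :: "pt \<Rightarrow> nat" where g: "\<And>x y. x \<in> pts a b \<Longrightarrow> y \<in> pts a b \<Longrightarrow> x \<noteq> y \<Longrightarrow> g x = g y \<longleftrightarrow> {x, y} \<in> c"
    "\<And>x. x \<in> pts a b \<Longrightarrow> card {y \<in> pts a b. g y = g x} = 2"
    using c by (rule Conn_labels) blast
  let ?w = "map (\<lambda>p. g (Bot p)) [0..<a]" and ?w' = "map (\<lambda>p. g (Top p)) [0..<b]"
  \<comment> \<open>The boundary points around the circle: the bottom from left to right, then the
    top from right to left.\<close>
  let ?pl = "map Bot [0..<a] @ rev (map Top [0..<b])"
  have pl: "distinct ?pl" "set ?pl = pts a b"
    by (auto simp: distinct_map inj_on_def pts_def atLeast0LessThan)
  have z: "?w @ rev ?w' = map g ?pl" by (simp add: rev_map comp_def)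
  have "dbl (?w @ rev ?w')"
    unfolding dbl_def z
  proof
    fix t assume "t \<in> set (map g ?pl)"
    then obtain x where x: "x \<in> pts a b" "t = g x" using pl(2) by (metis imageE list.set_map)
    have "count_list (map g ?pl) t = length (filter (\<lambda>y. t = g y) ?pl)"
      unfolding count_list_eq_length_filter filter_map length_map comp_def ..
    also have "\<dots> = card (set (filter (\<lambda>y. t = g y) ?pl))"
      using pl(1) by (intro distinct_card[symmetric]) (simp only: distinct_filter)
    also have "set (filter (\<lambda>y. t = g y) ?pl) = {y \<in> pts a b. g y = g x}" using pl(2) x(2) by auto
    finally show "count_list (map g ?pl) t = 2" using g(2)[OF x(1)] by simp
  qed
  note d = this
  obtain D W es where b: "realizes ?w ?w' D W es" "evinv ?w ?w' es"
    using realizable_all[OF d] unfolding realizable_def by blast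
  note n = realizes_normal[OF b d, of a b]
  have W: "W ! 0 = ?w" "W ! length D = ?w'" using b(1) by (auto simp: realizes_def)
  have lv: "lab W (vtx D x) = g x" if "x \<in> pts a b" for x
    using that W by (auto simp: pts_def lab_def)
  have "connector a b D = {{x, y} | x y. x \<in> pts a b \<and> y \<in> pts a b \<and> x \<noteq> y \<and> lab W (vtx D x) = lab W (vtx D y)}"
    using n(4) by simp
  also have "\<dots> = c"
  proof (intro equalityI subsetI)
    fix e assume "e \<in> {{x, y} | x y. x \<in> pts a b \<and> y \<in> pts a b \<and> x \<noteq> y \<and> lab W (vtx D x) = lab W (vtx D y)}"
    then obtain x y where "e = {x, y}" "x \<in> pts a b" "y \<in> pts a b" "x \<noteq> y" "lab W (vtx D x) = lab W (vtx D y)" by blast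
    then show "e \<in> c" using g(1) lv by simp
  next
    fix e assume e: "e \<in> c"
    then have "e \<subseteq> pts a b" "card e = 2" using c unfolding Conn_def by blast+
    then obtain x y where xy: "e = {x, y}" "x \<noteq> y" "x \<in> pts a b" "y \<in> pts a b" by (metis card_2_iff insert_subset)
    then have "lab W (vtx D x) = lab W (vtx D y)" using g(1)[OF xy(3,4,2)] lv e by simp
    then show "e \<in> {{x, y} | x y. x \<in> pts a b \<and> y \<in> pts a b \<and> x \<noteq> y \<and> lab W (vtx D x) = lab W (vtx D y)}"
      using xy by blast
  qed
  finally show ?thesis using n(1-3) by (intro exI[of _ D]) simp
qed

lemma normal_choice_exists: "\<exists>d. normal_choice a b d"
  unfolding normal_choice_def using normal_diagram_exists by (intro bchoice) blast

text \<open>The first conjunct keeps the second from being vacuous. The dimension is then the number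
  of matchings.\<close>

theorem theorem1:
  fixes a b :: nat
  shows "(\<exists>d. normal_choice a b d) \<and>
         (\<forall>d. normal_choice a b d \<longrightarrow> hom_basis a b (Conn a b) (\<lambda>c. diag_mor (d c))) \<and>
         hom_dim a b (if even (a + b) then dfact (a + b - 1) else 0)"
proof -
  obtain d where d: "normal_choice a b d" using normal_choice_exists by blast
  have "hom_dim a b (card (Conn a b))"
    by (rule hom_basis_dim[OF normal_choice_basis[OF d]])
  then show ?thesis using d normal_choice_basis by (auto simp: card_Conn)
qed

end
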